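(* Let $X$ be a $2$-dimensional smooth complete connected Riemannian manifold without boundary. Let $Y_1\subset X$ be a $2$-dimensional closed connected $C^0$-submanifold with boundary $\partial Y_1\ne\varnothing$ which satisfies condition (i) and has property $(\circ)$. Let $Y_2\subset X$ be a $2$-dimensional closed connected $C^0$-submanifold with $\partial Y_2\neq\varnothing$ satisfying condition (i), and suppose that $\partial Y_1$ and $\partial Y_2$ are isometric in the metrics $\rho_{Y_j}$, $j=1,2$. Then $Y_2$ has property $(\circ)$ as well.
   Context: An $n$-dimensional $C^0$-submanifold $Y$ with boundary of an $n$-dimensional manifold $X$ is a subset which is an $n$-dimensional topological manifold with boundary in the induced topology; it is closed if it is a closed subset of $X$; $\partial Y$ is its boundary and $\mathrm{Int}\,Y=Y\setminus\partial Y$ its interior. Condition (i) for $Y$: for all $x,y\in Y$, $$\rho_Y(x,y)=\liminf_{x'\to x,\;y'\to y;\;x',y'\in\mathrm{Int}\,Y}\{\inf[l(\gamma_{x',y',\mathrm{Int}\,Y})]\}<\infty,$$ where the infimum is over the Riemannian lengths of smooth paths $\gamma_{x',y',\mathrm{Int}\,Y}:[0,1]\to\mathrm{Int}\,Y$ joining $x'$ and $y'$ in $\mathrm{Int}\,Y$. This formula also defines the function $\rho_Y$. A shortest path in the metric $\rho_Y$ between distinct points $x,y\in Y$ is a path $\gamma:[0,1]\to Y$ with $\gamma(0)=x$, $\gamma(1)=y$ and $\rho_Y(\gamma(s),\gamma(t))=(t-s)\rho_Y(x,y)$ for $0\le s<t\le1$. Paths are continuous and non-constant. $Y$ has property $(\circ)$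 if, for any two points $x,y\in\partial Y$ and every shortest path $\gamma:[0,1]\to Y$ in the metric $\rho_Y$ joining them, $\gamma(]0,1[)\subset\mathrm{Int}\,Y$. $\partial Y_1$ and $\partial Y_2$ are isometric in the metrics $\rho_{Y_j}$ if there is a surjective map $f:\partial Y_1\to\partial Y_2$ with $\rho_{Y_2}(f(x),f(y))=\rho_{Y_1}(x,y)$ for all $x,y\in\partial Y_1$. *)

theory Defs
  imports "HOL-Analysis.Analysis"
begin

text \<open>
  Derivatives are taken within \<open>S\<close>. The notion is used only for sets in which derivatives
  within the set are unique: open subsets of Euclidean space and relatively open subsets of the
  unit interval (where end points carry one-sided derivatives).
\<close>

primrec Ck_on :: "nat \<Rightarrow> 'e::real_normed_vector set \<Rightarrow> ('e \<Rightarrow> 'f::real_normed_vector) \<Rightarrow> bool" where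
  "Ck_on 0 = (\<lambda>S f. continuous_on S f)"
| "Ck_on (Suc k) = (\<lambda>S f. f differentiable_on S \<and>
     (\<forall>v. Ck_on k S (\<lambda>x. frechet_derivative f (at x within S) v)))"

definition smooth_on :: "'e::real_normed_vector set \<Rightarrow> ('e \<Rightarrow> 'f::real_normed_vector) \<Rightarrow> bool" where
  "smooth_on S f \<longleftrightarrow> (\<forall>k. Ck_on k S f)"

text \<open>
  The underlying set of a surface is a whole type. A chart is a pair of its domain \<open>U\<close> and a map
  \<open>\<phi>\<close>, of which only the values on \<open>U\<close> matter.
\<close>

type_synonym 'a chart = "'a set \<times> ('a \<Rightarrow> real ^ 2)"

definition transition :: "'a chart \<Rightarrow> 'a chart \<Rightarrow> real ^ 2 \<Rightarrow> real ^ 2" where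
  "transition c d = snd d \<circ> inv_into (fst c) (snd c)"

definition smooth_atlas :: "'a::topological_space chart set \<Rightarrow> bool" where
  "smooth_atlas A \<longleftrightarrow>
     (\<forall>(U, \<phi>)\<in>A. open U \<and> open (\<phi> ` U) \<and> (\<exists>\<psi>. homeomorphism U (\<phi> ` U) \<phi> \<psi>)) \<and>
     (\<Union>(U, \<phi>)\<in>A. U) = UNIV \<and>
     (\<forall>c\<in>A. \<forall>d\<in>A. smooth_on (snd c ` (fst c \<inter> fst d)) (transition c d))"

text \<open>
  A Riemannian metric is given by its Gram matrices: \<open>g c p\<close> is the matrix of the inner product on
  the tangent space at \<open>p\<close> with respect to the coordinate basis of the chart \<open>c\<close>. The last
  conjunct is the transformation law of a covariant 2-tensor under change of charts.
\<close>

definition riemannian_metric ::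
  "'a::topological_space chart set \<Rightarrow> ('a chart \<Rightarrow> 'a \<Rightarrow> real ^ 2 ^ 2) \<Rightarrow> bool" where
  "riemannian_metric A g \<longleftrightarrow>
     (\<forall>c\<in>A. smooth_on (snd c ` fst c) (g c \<circ> inv_into (fst c) (snd c))) \<and>
     (\<forall>c\<in>A. \<forall>p\<in>fst c. transpose (g c p) = g c p \<and> (\<forall>v. v \<noteq> 0 \<longrightarrow> 0 < v \<bullet> (g c p *v v))) \<and>
     (\<forall>c\<in>A. \<forall>d\<in>A. \<forall>p\<in>fst c \<inter> fst d. \<forall>v w.
        let D = frechet_derivative (transition c d) (at (snd c p))
        in v \<bullet> (g c p *v w) = D v \<bullet> (g d p *v D w))"

text \<open>
  Paths are non-constant by convention. This only excludes constant loops: since there are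
  arbitrarily short non-constant loops, the infimum of lengths is still 0 for coinciding end points.
\<close>

definition smooth_path :: "'a::topological_space chart set \<Rightarrow> (real \<Rightarrow> 'a) \<Rightarrow> bool" where
  "smooth_path A \<gamma> \<longleftrightarrow> path \<gamma> \<and> \<not> \<gamma> constant_on {0..1} \<and>
     (\<forall>(U, \<phi>)\<in>A. smooth_on {t \<in> {0..1}. \<gamma> t \<in> U} (\<phi> \<circ> \<gamma>))"

text \<open>By the transformation law of \<open>g\<close>, the choice of the chart does not affect the speed.\<close>

definition riem_speed ::
  "'a chart set \<Rightarrow> ('a chart \<Rightarrow> 'a \<Rightarrow> real ^ 2 ^ 2) \<Rightarrow> (real \<Rightarrow> 'a) \<Rightarrow> real \<Rightarrow> real" where
  "riem_speed A g \<gamma> t =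
     (let c = (SOME c. c \<in> A \<and> \<gamma> t \<in> fst c);
          v = vector_derivative (snd c \<circ> \<gamma>) (at t within {0..1})
      in sqrt (v \<bullet> (g c (\<gamma> t) *v v)))"

definition riem_length ::
  "'a chart set \<Rightarrow> ('a chart \<Rightarrow> 'a \<Rightarrow> real ^ 2 ^ 2) \<Rightarrow> (real \<Rightarrow> 'a) \<Rightarrow> real" where
  "riem_length A g \<gamma> = integral {0..1} (riem_speed A g \<gamma>)"

text \<open>The infimum is \<open>\<infinity>\<close> if no smooth path in \<open>S\<close> joins the two points.\<close>

definition inf_length ::
  "'a::topological_space chart set \<Rightarrow> ('a chart \<Rightarrow> 'a \<Rightarrow> real ^ 2 ^ 2) \<Rightarrow> 'a set \<Rightarrow> 'a \<Rightarrow> 'a \<Rightarrow> ereal" where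
  "inf_length A g S x y =
     (INF \<gamma>\<in>{\<gamma>. smooth_path A \<gamma> \<and> path_image \<gamma> \<subseteq> S \<and> pathstart \<gamma> = x \<and> pathfinish \<gamma> = y}.
        ereal (riem_length A g \<gamma>))"

definition riem_dist ::
  "'a::topological_space chart set \<Rightarrow> ('a chart \<Rightarrow> 'a \<Rightarrow> real ^ 2 ^ 2) \<Rightarrow> 'a \<Rightarrow> 'a \<Rightarrow> real" where
  "riem_dist A g x y = real_of_ereal (inf_length A g UNIV x y)"

definition complete_riemannian_surface ::
  "'a::topological_space chart set \<Rightarrow> ('a chart \<Rightarrow> 'a \<Rightarrow> real ^ 2 ^ 2) \<Rightarrow> bool" where
  "complete_riemannian_surface A g \<longleftrightarrow>
     smooth_atlas A \<and> riemannian_metric A g \<and> Metric_space.mcomplete UNIV (riem_dist A g)"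

definition half_plane :: "(real ^ 2) set" where
  "half_plane = {v. 0 \<le> v $ 1}"

definition boundary_chart ::
  "'a::topological_space set \<Rightarrow> 'a set \<Rightarrow> ('a \<Rightarrow> real ^ 2) \<Rightarrow> bool" where
  "boundary_chart Y V \<phi> \<longleftrightarrow>
     openin (top_of_set Y) V \<and> openin (top_of_set half_plane) (\<phi> ` V) \<and>
     (\<exists>\<psi>. homeomorphism V (\<phi> ` V) \<phi> \<psi>)"

text \<open>The Hausdorff property and second countability are inherited from the ambient surface.\<close>

definition C0_submanifold :: "'a::topological_space set \<Rightarrow> bool" where
  "C0_submanifold Y \<longleftrightarrow> (\<forall>p\<in>Y. \<exists>V \<phi>. p \<in> V \<and> boundary_chart Y V \<phi>)"

definition manifold_boundary :: "'a::topological_space set \<Rightarrow> 'a set" where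
  "manifold_boundary Y = {p. \<exists>V \<phi>. p \<in> V \<and> boundary_chart Y V \<phi> \<and> \<phi> p $ 1 = 0}"

definition manifold_interior :: "'a::topological_space set \<Rightarrow> 'a set" where
  "manifold_interior Y = Y - manifold_boundary Y"

text \<open>
  The filter consists of the neighbourhoods of \<open>(x, y)\<close> relative to the interior; the limit point
  itself is not excluded if \<open>x\<close> and \<open>y\<close> are interior.
\<close>

definition rho ::
  "'a::topological_space chart set \<Rightarrow> ('a chart \<Rightarrow> 'a \<Rightarrow> real ^ 2 ^ 2) \<Rightarrow> 'a set \<Rightarrow> 'a \<Rightarrow> 'a \<Rightarrow> ereal" where
  "rho A g Y x y =
     Liminf (inf (nhds (x, y)) (principal (manifold_interior Y \<times> manifold_interior Y)))
       (\<lambda>(x', y'). inf_length A g (manifold_interior Y) x' y')"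

definition condition_i ::
  "'a::topological_space chart set \<Rightarrow> ('a chart \<Rightarrow> 'a \<Rightarrow> real ^ 2 ^ 2) \<Rightarrow> 'a set \<Rightarrow> bool" where
  "condition_i A g Y \<longleftrightarrow> (\<forall>x\<in>Y. \<forall>y\<in>Y. rho A g Y x y < \<infinity>)"

definition shortest_path ::
  "'a::topological_space chart set \<Rightarrow> ('a chart \<Rightarrow> 'a \<Rightarrow> real ^ 2 ^ 2) \<Rightarrow> 'a set \<Rightarrow> 'a \<Rightarrow> 'a
     \<Rightarrow> (real \<Rightarrow> 'a) \<Rightarrow> bool" where
  "shortest_path A g Y x y \<gamma> \<longleftrightarrow>
     x \<noteq> y \<and> path \<gamma> \<and> path_image \<gamma> \<subseteq> Y \<and> pathstart \<gamma> = x \<and> pathfinish \<gamma> = y \<and>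
     (\<forall>s t. 0 \<le> s \<and> s < t \<and> t \<le> 1 \<longrightarrow> rho A g Y (\<gamma> s) (\<gamma> t) = ereal (t - s) * rho A g Y x y)"

definition property_circ ::
  "'a::topological_space chart set \<Rightarrow> ('a chart \<Rightarrow> 'a \<Rightarrow> real ^ 2 ^ 2) \<Rightarrow> 'a set \<Rightarrow> bool" where
  "property_circ A g Y \<longleftrightarrow>
     (\<forall>x\<in>manifold_boundary Y. \<forall>y\<in>manifold_boundary Y. \<forall>\<gamma>.
        shortest_path A g Y x y \<gamma> \<longrightarrow> \<gamma> ` {0<..<1} \<subseteq> manifold_interior Y)"

definition isometric_boundaries ::
  "'a::topological_space chart set \<Rightarrow> ('a chart \<Rightarrow> 'a \<Rightarrow> real ^ 2 ^ 2) \<Rightarrow> 'a set \<Rightarrow> 'a set \<Rightarrow> bool" where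
  "isometric_boundaries A g Y1 Y2 \<longleftrightarrow>
     (\<exists>f. f ` manifold_boundary Y1 = manifold_boundary Y2 \<and>
        (\<forall>x\<in>manifold_boundary Y1. \<forall>y\<in>manifold_boundary Y1.
           rho A g Y2 (f x) (f y) = rho A g Y1 x y))"

end

theory Submission
  imports Defs
begin

text \<open>
Suppose that a shortest path of \<open>Y2\<close> between boundary points \<open>x\<close> and \<open>y\<close> meets the boundary at a
point \<open>z\<close> strictly between them. Then \<open>rho(x,z) + rho(z,y) = rho(x,y)\<close>, and this equality only
involves distances of boundary points, so that it holds in \<open>Y1\<close> for preimages \<open>x'\<close>, \<open>z'\<close>, \<open>y'\<close> under
the isometry. If \<open>x'\<close> and \<open>z'\<close>, as well as \<open>z'\<close> and \<open>y'\<close>, can be joined by shortest paths of \<open>Y1\<close>,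
the concatenation of these is a shortest path from \<open>x'\<close> to \<open>y'\<close> through the boundary point \<open>z'\<close>, which
contradicts the property of \<open>Y1\<close>. Two facts about \<open>rho\<close> carry the argument.

\<^item> The triangle inequality (\<open>rho_triangle\<close>). It is particular to dimension two: the
  curves which nearly realize \<open>rho(x,y)\<close> and \<open>rho(y,z)\<close> end at different points of the interior near
  the boundary point \<open>y\<close>, and such points may be far apart inside \<open>Y\<close>. But both curves have to cross
  one and the same arc that a small circle around \<open>y\<close> cuts out of the interior, because the
  arcs met by the first curve and the remaining arcs cannot separate \<open>y\<close> from the outside unless
  one of the two families does (\<open>half_disc_crossing\<close>, a consequence of Janiszewski's theorem).
  Hence one can change from one curve to the other along a piece of a circle, at arbitrarily small
  cost (\<open>boundary_crossing\<close>).

\<^item> The existence of shortest paths (\<open>lipschitz_limit_curve\<close>). The topology of \<open>rho\<close> may be strictly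
  finer than that of \<open>Y\<close>, but \<open>rho\<close> is lower semicontinuous. Almost shortest
  curves of the interior, parametrized proportionally to arc length, stay in a compact set by the
  Hopf-Rinow argument (\<open>compact_riem_ball\<close>). A pointwise cluster point of them satisfies
  \<open>rho(\<Gamma> s, \<Gamma> t) \<le> (t - s) rho(x,y)\<close>, and the triangle inequality turns this into an equality
  (\<open>shortest_pathI\<close>).

Since lengths are only measured along smooth paths, already the triangle inequality for the interior
distance needs a smooth concatenation. Both paths are slowed down by \<open>beta t = exp (1 - 1 / t)\<close>,
whose derivatives all vanish at the common point (\<open>smooth_path_join\<close>).
\<close>

section \<open>Smooth functions of one real variable\<close>

lemma has_derivative_within_cong:
  assumes "x \<in> S" "\<And>y. y \<in> S \<Longrightarrow> f y = g y"
  shows "(f has_derivative F) (at x within S) \<longleftrightarrow> (g has_derivative F) (at x within S)"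
  using assms by (metis has_derivative_transform)

lemma Ck_on_cong:
  assumes "\<And>x. x \<in> S \<Longrightarrow> f x = g x"
  shows "Ck_on k S f \<longleftrightarrow> Ck_on k S g"
  using assms
proof (induction k arbitrary: f g)
  case 0
  then show ?case by (auto intro!: continuous_on_cong)
next
  case (Suc k)
  have hd: "(f has_derivative F) (at x within S) \<longleftrightarrow> (g has_derivative F) (at x within S)"
    if "x \<in> S" for x F
    using that Suc.prems by (intro has_derivative_within_cong) auto
  have "frechet_derivative f (at x within S) = frechet_derivative g (at x within S)" if "x \<in> S" for x
    using hd[OF that] by (simp add: frechet_derivative_def)
  then have "Ck_on k S (\<lambda>x. frechet_derivative f (at x within S) v)
      \<longleftrightarrow> Ck_on k S (\<lambda>x. frechet_derivative g (at x within S) v)" for v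
    by (intro Suc.IH) simp
  moreover have "f differentiable_on S \<longleftrightarrow> g differentiable_on S"
    using hd by (simp add: differentiable_on_def differentiable_def)
  ultimately show ?case by simp
qed

lemma Ck_on_SucD: "Ck_on (Suc k) S f \<Longrightarrow> Ck_on k S f"
proof (induction k arbitrary: f)
  case 0
  then show ?case by (simp add: differentiable_imp_continuous_on)
next
  case (Suc k)
  have "Ck_on k S (\<lambda>x. frechet_derivative f (at x within S) v)" for v
    by (rule Suc.IH) (use Suc.prems in simp)
  then show ?case using Suc.prems by simp
qed

text \<open>
On a set of real numbers without isolated points, derivatives within the set are unique. This
holds for relatively open subsets of an interval, on which the coordinates of a path are given.
\<close>

definition nonisolated :: "real set \<Rightarrow> bool" where
  "nonisolated S \<longleftrightarrow> (\<forall>x\<in>S. at x within S \<noteq> bot)"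

text \<open>
On a line all directional derivatives are multiples of one vector, so smoothness can be handled with
ordinary vector derivatives.
\<close>

lemma Ck_on_Suc_real:
  fixes f :: "real \<Rightarrow> 'f::real_normed_vector"
  assumes "nonisolated S" "\<And>x. x \<in> S \<Longrightarrow> (f has_vector_derivative f' x) (at x within S)"
  shows "Ck_on (Suc k) S f \<longleftrightarrow> (\<forall>v. Ck_on k S (\<lambda>x. v *\<^sub>R f' x))"
proof -
  have *: "frechet_derivative f (at x within S) = (\<lambda>v. v *\<^sub>R f' x)" if "x \<in> S" for x
  proof -
    have d: "f differentiable (at x within S)"
      using assms(2)[OF that] by (auto simp: has_vector_derivative_def differentiable_def)
    then have F: "(f has_derivative frechet_derivative f (at x within S)) (at x within S)"
      by (simp add: frechet_derivative_works)
    then interpret F: bounded_linear "frechet_derivative f (at x within S)"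
      by (rule has_derivative_bounded_linear)
    have lin: "frechet_derivative f (at x within S) v = v *\<^sub>R frechet_derivative f (at x within S) 1" for v
      using F.scaleR[of v 1] by simp
    then have "(f has_vector_derivative frechet_derivative f (at x within S) 1) (at x within S)"
      using F by (simp add: has_vector_derivative_def flip: lin)
    then have "frechet_derivative f (at x within S) 1 = f' x"
      using vector_derivative_unique_within assms that unfolding nonisolated_def by blast
    with lin show ?thesis by auto
  qed
  have "f differentiable_on S"
    using assms(2) by (auto simp: has_vector_derivative_def differentiable_on_def differentiable_def)
  moreover have "Ck_on k S (\<lambda>x. frechet_derivative f (at x within S) v)
     \<longleftrightarrow> Ck_on k S (\<lambda>x. v *\<^sub>R f' x)" for v
    by (rule Ck_on_cong) (simp add: *)
  ultimately show ?thesis by simp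
qed

lemma Ck_on_Suc_realE:
  fixes f :: "real \<Rightarrow> 'f::real_normed_vector"
  assumes "nonisolated S" "Ck_on (Suc k) S f"
  obtains f' where "\<And>x. x \<in> S \<Longrightarrow> (f has_vector_derivative f' x) (at x within S)"
    "Ck_on k S f'"
proof -
  define f' where "f' x = frechet_derivative f (at x within S) 1" for x
  have "(f has_vector_derivative f' x) (at x within S)" if "x \<in> S" for x
  proof -
    have F: "(f has_derivative frechet_derivative f (at x within S)) (at x within S)"
      using assms that by (simp add: differentiable_on_def frechet_derivative_works)
    then interpret F: bounded_linear "frechet_derivative f (at x within S)"
      by (rule has_derivative_bounded_linear)
    have lin: "frechet_derivative f (at x within S) v = v *\<^sub>R f' x" for v
      using F.scaleR[of v 1] by (simp add: f'_def)
    show ?thesis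
      using F by (simp add: has_vector_derivative_def flip: lin)
  qed
  moreover have "Ck_on k S f'" using assms by (simp add: f'_def[abs_def])
  ultimately show ?thesis using that by blast
qed

lemma Ck_on_scaleR_real:
  fixes f :: "real \<Rightarrow> 'f::real_normed_vector"
  assumes S: "nonisolated S"
  shows "Ck_on k S f \<Longrightarrow> Ck_on k S (\<lambda>x. c *\<^sub>R f x)"
proof (induction k arbitrary: f c)
  case 0
  then show ?case by (auto intro: continuous_intros)
next
  case (Suc k)
  obtain f' where f': "\<And>x. x \<in> S \<Longrightarrow> (f has_vector_derivative f' x) (at x within S)"
    and c: "Ck_on k S f'" using Ck_on_Suc_realE[OF S Suc.prems] by blast
  have "((\<lambda>x. c *\<^sub>R f x) has_vector_derivative c *\<^sub>R f' x) (at x within S)" if "x \<in> S" for x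
    using f'[OF that] by (auto intro!: derivative_eq_intros)
  moreover have "Ck_on k S (\<lambda>x. v *\<^sub>R c *\<^sub>R f' x)" for v
    using Suc.IH[OF c, of "v * c"] by simp
  ultimately show ?case by (subst Ck_on_Suc_real[OF S]) auto
qed

lemma Ck_on_Suc_realI:
  fixes f :: "real \<Rightarrow> 'f::real_normed_vector"
  assumes "nonisolated S" "\<And>x. x \<in> S \<Longrightarrow> (f has_vector_derivative f' x) (at x within S)"
    and "Ck_on k S f'"
  shows "Ck_on (Suc k) S f"
  using Ck_on_Suc_real[OF assms(1,2)] Ck_on_scaleR_real[OF assms(1,3)] by blast

lemma Ck_on_add_real:
  fixes f g :: "real \<Rightarrow> 'f::real_normed_vector"
  assumes S: "nonisolated S"
  shows "Ck_on k S f \<Longrightarrow> Ck_on k S g \<Longrightarrow> Ck_on k S (\<lambda>x. f x + g x)"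
proof (induction k arbitrary: f g)
  case 0
  then show ?case by (auto intro: continuous_intros)
next
  case (Suc k)
  obtain f' where f': "\<And>x. x \<in> S \<Longrightarrow> (f has_vector_derivative f' x) (at x within S)"
    and c: "Ck_on k S f'" using Ck_on_Suc_realE[OF S Suc.prems(1)] by blast
  obtain g' where g': "\<And>x. x \<in> S \<Longrightarrow> (g has_vector_derivative g' x) (at x within S)"
    and cg: "Ck_on k S g'" using Ck_on_Suc_realE[OF S Suc.prems(2)] by blast
  show ?case
    by (rule Ck_on_Suc_realI[OF S _ Suc.IH[OF c cg]])
      (use f' g' in \<open>auto intro!: derivative_eq_intros\<close>)
qed

text \<open>
For an affine inner function the chain rule produces no products, so that a direct induction on the
order of differentiability works. With a real domain it
handles subarcs and reversed paths, with a planar one straight segments seen in other charts.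
\<close>

lemma Ck_on_affine:
  fixes F :: "'e::real_normed_vector \<Rightarrow> 'f::real_normed_vector"
  assumes T: "nonisolated T" and sub: "\<And>t. t \<in> T \<Longrightarrow> a + t *\<^sub>R v \<in> W"
  shows "Ck_on k W F \<Longrightarrow> Ck_on k T (\<lambda>t. F (a + t *\<^sub>R v))"
proof (induction k arbitrary: F)
  case 0
  then show ?case
    using sub by (auto intro!: continuous_on_compose2[of W F T] continuous_intros)
next
  case (Suc k)
  have "((\<lambda>t. F (a + t *\<^sub>R v)) has_vector_derivative frechet_derivative F (at (a + t *\<^sub>R v) within W) v)
     (at t within T)" if t: "t \<in> T" for t
  proof -
    have F: "(F has_derivative frechet_derivative F (at (a + t *\<^sub>R v) within W)) (at (a + t *\<^sub>R v) within W)"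
      using Suc.prems sub[OF t] by (simp add: differentiable_on_def frechet_derivative_works)
    then interpret F: bounded_linear "frechet_derivative F (at (a + t *\<^sub>R v) within W)"
      by (rule has_derivative_bounded_linear)
    have "((\<lambda>t. a + t *\<^sub>R v) has_derivative (\<lambda>h. h *\<^sub>R v)) (at t within T)"
      by (auto intro!: derivative_eq_intros)
    moreover have "(\<lambda>t. a + t *\<^sub>R v) ` T \<subseteq> W" using sub by auto
    ultimately have "((F \<circ> (\<lambda>t. a + t *\<^sub>R v)) has_derivative
       (frechet_derivative F (at (a + t *\<^sub>R v) within W) \<circ> (\<lambda>h. h *\<^sub>R v))) (at t within T)"
      by (intro diff_chain_within) (use F has_derivative_subset in auto)
    then show ?thesis by (simp add: has_vector_derivative_def o_def F.scaleR)
  qed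
  then show ?case
    using Suc.prems
    by (intro Ck_on_Suc_realI[OF T, where f'="\<lambda>t. frechet_derivative F (at (a + t *\<^sub>R v) within W) v"]
      Suc.IH[of "\<lambda>x. frechet_derivative F (at x within W) v"]) auto
qed

lemma has_vector_derivative_within_Un:
  assumes "(f has_vector_derivative f') (at x within S)" "(f has_vector_derivative f') (at x within T)"
  shows "(f has_vector_derivative f') (at x within (S \<union> T))"
  using assms unfolding has_vector_derivative_def has_derivative_within by (auto intro: Lim_Un)

text \<open>
For \<open>x \<noteq> 0\<close> one of the two one-sided filters is trivial, which is why the condition on that side is
only required when \<open>x\<close> belongs to it.
\<close>

lemma has_vector_derivative_two_sided:
  fixes f :: "real \<Rightarrow> 'f::real_normed_vector"
  assumes r: "0 \<le> x \<Longrightarrow> (f has_vector_derivative f') (at x within (T \<inter> {0..}))"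
    and l: "x \<le> 0 \<Longrightarrow> (f has_vector_derivative f') (at x within (T \<inter> {..0}))"
  shows "(f has_vector_derivative f') (at x within T)"
proof -
  have triv: "(f has_vector_derivative f') (at x within S)" if "x \<notin> closure S" for S :: "real set"
  proof -
    have "at x within S = bot" using that by (rule not_in_closure_trivial_limitI)
    then show ?thesis
      unfolding has_vector_derivative_def has_derivative_within by (simp add: bounded_linear_scaleR_left)
  qed
  have "closure (T \<inter> {0..}) \<subseteq> {0..}" "closure (T \<inter> {..0}) \<subseteq> {..0}"
    by (rule closure_minimal; simp)+
  then have "(f has_vector_derivative f') (at x within (T \<inter> {0..}))"
    "(f has_vector_derivative f') (at x within (T \<inter> {..0}))"
    using r l triv by (metis subsetD atLeast_iff, metis subsetD atMost_iff)
  then have "(f has_vector_derivative f') (at x within ((T \<inter> {0..}) \<union> (T \<inter> {..0})))"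
    by (rule has_vector_derivative_within_Un)
  moreover have "(T \<inter> {0..}) \<union> (T \<inter> {..0}) = T" by auto
  ultimately show ?thesis by simp
qed

section \<open>Gluing smooth functions at a point\<close>

text \<open>
These functions vanish to infinite order at \<open>0\<close>. The family is closed, up to linear
combinations, under differentiation and under multiplication by the derivative of \<open>beta\<close>.
\<close>

definition flat :: "nat \<Rightarrow> nat \<Rightarrow> real \<Rightarrow> real" where
  "flat m n t = (if 0 < t then exp (- (real m / t)) / t ^ n else 0)"

lemma flat_tendsto_0:
  assumes "0 < m"
  shows "(flat m n \<longlongrightarrow> 0) (at 0)"
proof -
  have l: "((\<lambda>t. exp (- (real m / t)) / t ^ n) \<longlongrightarrow> 0) (at_right 0)"
  proof -
    have a: "((\<lambda>x. x ^ n / exp (real m * x)) \<longlongrightarrow> 0) at_top"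
    proof -
      have "((\<lambda>x. (real m * x) ^ n / exp (real m * x)) \<longlongrightarrow> 0) at_top"
        by (rule filterlim_compose[OF tendsto_power_div_exp_0])
          (use assms in \<open>auto intro!: filterlim_tendsto_pos_mult_at_top[OF tendsto_const] filterlim_ident\<close>)
      then have "((\<lambda>x. (1 / real m ^ n) * ((real m * x) ^ n / exp (real m * x))) \<longlongrightarrow> (1 / real m ^ n) * 0) at_top"
        by (intro tendsto_intros)
      then show ?thesis using assms by (simp add: power_mult_distrib)
    qed
    have "((\<lambda>t. inverse t ^ n / exp (real m * inverse t)) \<longlongrightarrow> 0) (at_right 0)"
      by (rule filterlim_compose[OF a filterlim_inverse_at_top_right])
    then show ?thesis
      by (simp add: exp_minus divide_simps power_inverse mult.commute)
  qed
  have "(flat m n \<longlongrightarrow> 0) (at_right 0)"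
    using l by (rule Lim_transform_eventually) (auto simp: flat_def eventually_at_filter)
  moreover have "(flat m n \<longlongrightarrow> 0) (at_left 0)"
    by (rule Lim_transform_eventually[OF tendsto_const]) (auto simp: flat_def eventually_at_filter)
  ultimately show ?thesis by (simp add: filterlim_split_at)
qed

lemma DERIV_flat:
  assumes "0 < m"
  shows "(flat m n has_real_derivative real m * flat m (n + 2) t - real n * flat m (n + 1) t) (at t)"
proof -
  consider "t > 0" | "t < 0" | "t = 0" by linarith
  then show ?thesis
  proof cases
    case 1
    have "((\<lambda>t. exp (- (real m / t)) / t ^ n) has_real_derivative
       real m * flat m (n + 2) t - real n * flat m (n + 1) t) (at t)"
    proof -
      have p: "((\<lambda>t. inverse t ^ n) has_real_derivative - real n * inverse t ^ (n + 1)) (at t)"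
      proof -
        have "((\<lambda>t. inverse t ^ n) has_real_derivative real n * inverse t ^ (n - 1) * - (inverse t ^ 2)) (at t)"
          using 1 by (auto intro!: derivative_eq_intros simp: power2_eq_square)
        moreover have "real n * inverse t ^ (n - 1) * - (inverse t ^ 2) = - real n * inverse t ^ (n + 1)"
          by (cases n) (auto simp: power2_eq_square algebra_simps)
        ultimately show ?thesis by (simp only:)
      qed
      have e: "((\<lambda>t. exp (- (real m / t))) has_real_derivative exp (- (real m / t)) * (real m * inverse t ^ 2)) (at t)"
        using 1 by (auto intro!: derivative_eq_intros simp: power2_eq_square field_simps)
      show ?thesis
        using DERIV_mult[OF e p] 1
        by (simp add: flat_def power_add power_inverse field_simps power2_eq_square)
    qed
    then show ?thesis
      by (rule has_field_derivative_transform_within_open[of _ _ _ "{0<..}"])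
        (use 1 in \<open>auto simp: flat_def\<close>)
  next
    case 2
    have "((\<lambda>t. 0) has_real_derivative real m * flat m (n + 2) t - real n * flat m (n + 1) t) (at t)"
      using 2 by (simp add: flat_def)
    then show ?thesis
      by (rule has_field_derivative_transform_within_open[of _ _ _ "{..<0}"])
        (use 2 in \<open>auto simp: flat_def\<close>)
  next
    case 3
    have "(\<lambda>h. (flat m n (0 + h) - flat m n 0) / h) = flat m (n + 1)"
      by (auto simp: flat_def fun_eq_iff)
    then have "(flat m n has_real_derivative 0) (at 0)"
      using flat_tendsto_0[OF assms, of "n + 1"] by (simp add: DERIV_def)
    then show ?thesis using 3 by (simp add: flat_def)
  qed
qed

text \<open>
The reparametrization \<open>exp (1 - 1 / t)\<close> of the unit interval, which starts with infinite slowness.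
\<close>

definition beta :: "real \<Rightarrow> real" where "beta t = exp 1 * flat 1 0 t"

lemma DERIV_beta: "(beta has_real_derivative exp 1 * flat 1 2 t) (at t)"
  unfolding beta_def[abs_def] using DERIV_flat[of 1 0 t]
  by (auto intro!: derivative_eq_intros simp: numeral_2_eq_2)

lemma beta_0 [simp]: "beta 0 = 0" and beta_1 [simp]: "beta 1 = 1"
  by (auto simp: beta_def flat_def simp flip: exp_add)

lemma beta_bounds: "t \<le> 1 \<Longrightarrow> 0 \<le> beta t \<and> beta t \<le> 1"
  by (auto simp: beta_def flat_def field_simps simp flip: exp_add)

lemma continuous_on_flat: "0 < m \<Longrightarrow> continuous_on S (flat m n)"
  by (meson DERIV_flat DERIV_isCont continuous_at_imp_continuous_on)

lemma continuous_on_beta: "continuous_on S beta"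
  by (meson DERIV_beta DERIV_isCont continuous_at_imp_continuous_on)

lemma has_vector_derivative_comp_beta:
  assumes "(h has_vector_derivative h') (at (beta t) within S)" "\<And>t. t \<in> T \<Longrightarrow> beta t \<in> S"
  shows "((\<lambda>t. h (beta t)) has_vector_derivative (exp 1 * flat 1 2 t) *\<^sub>R h') (at t within T)"
proof -
  have "(beta has_vector_derivative exp 1 * flat 1 2 t) (at t within T)"
    using DERIV_beta has_field_derivative_at_within has_real_derivative_iff_has_vector_derivative by blast
  moreover have "(h has_vector_derivative h') (at (beta t) within beta ` T)"
    using assms by (meson has_vector_derivative_within_subset image_subsetI)
  ultimately show ?thesis
    using vector_diff_chain_within[of beta "exp 1 * flat 1 2 t" t T h h'] by (simp add: o_def)
qed

text \<open>
Differentiating a product \<open>flat m n t *\<^sub>R h (beta t)\<close> gives a sum of products of the same kind, with \<open>h\<close>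
or its derivative. This makes the induction close for all \<open>m\<close>, \<open>n\<close> and \<open>h\<close> at once.
\<close>

lemma Ck_on_flat_times:
  fixes h :: "real \<Rightarrow> 'f::real_normed_vector"
  assumes S: "nonisolated S" and T: "nonisolated T" and sub: "\<And>t. t \<in> T \<Longrightarrow> 0 \<le> t \<Longrightarrow> beta t \<in> S"
  shows "Ck_on k S h \<Longrightarrow> 0 < m \<Longrightarrow> Ck_on k T (\<lambda>t. flat m n t *\<^sub>R h (beta t))"
proof (induction k arbitrary: h m n)
  case 0
  have r: "continuous_on (T \<inter> {0..}) (\<lambda>t. flat m n t *\<^sub>R h (beta t))"
    by (rule continuous_on_scaleR[OF continuous_on_flat[OF 0(2)] continuous_on_compose2[OF _ continuous_on_beta, of S]])
      (use 0 sub in auto)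
  have "continuous_on (T \<inter> {..0}) (\<lambda>t. flat m n t *\<^sub>R h (beta t)) \<longleftrightarrow> continuous_on (T \<inter> {..0}) (\<lambda>t. 0::'f)"
    by (rule continuous_on_cong) (auto simp: flat_def)
  then have l: "continuous_on (T \<inter> {..0}) (\<lambda>t. flat m n t *\<^sub>R h (beta t))" by simp
  have eq: "(T \<inter> {0..}) \<union> (T \<inter> {..0}) = T" by auto
  have "continuous_on ((T \<inter> {0..}) \<union> (T \<inter> {..0})) (\<lambda>t. flat m n t *\<^sub>R h (beta t))"
    using r l by (intro continuous_on_Un_local) (simp_all add: eq closedin_closed_Int)
  then show ?case unfolding eq by simp
next
  case (Suc k)
  obtain h' where h': "\<And>x. x \<in> S \<Longrightarrow> (h has_vector_derivative h' x) (at x within S)"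
    and c: "Ck_on k S h'" using Ck_on_Suc_realE[OF S Suc.prems(1)] by blast
  let ?d = "\<lambda>t. (real m *\<^sub>R (flat m (n + 2) t *\<^sub>R h (beta t)) + (- real n) *\<^sub>R (flat m (n + 1) t *\<^sub>R h (beta t)))
      + exp 1 *\<^sub>R (flat (m + 1) (n + 2) t *\<^sub>R h' (beta t))"
  have ck: "Ck_on k T ?d"
    by (intro Ck_on_add_real[OF T] Ck_on_scaleR_real[OF T] Suc.IH c Ck_on_SucD[OF Suc.prems(1)])
      (use Suc.prems in auto)
  have "((\<lambda>t. flat m n t *\<^sub>R h (beta t)) has_vector_derivative ?d t) (at t within T)" if t: "t \<in> T" for t
  proof (rule has_vector_derivative_two_sided)
    assume "0 \<le> t"
    then have bS: "beta t \<in> S" using sub t by auto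
    have "((\<lambda>t. h (beta t)) has_vector_derivative (exp 1 * flat 1 2 t) *\<^sub>R h' (beta t)) (at t within T \<inter> {0..})"
      by (rule has_vector_derivative_comp_beta[OF h'[OF bS]]) (use sub in auto)
    moreover have "(flat m n has_vector_derivative real m * flat m (n + 2) t - real n * flat m (n + 1) t) (at t within T \<inter> {0..})"
      using DERIV_flat[OF Suc.prems(2)] has_field_derivative_at_within has_real_derivative_iff_has_vector_derivative by blast
    ultimately have "((\<lambda>t. flat m n t *\<^sub>R h (beta t)) has_vector_derivative
       flat m n t *\<^sub>R ((exp 1 * flat 1 2 t) *\<^sub>R h' (beta t)) +
       (real m * flat m (n + 2) t - real n * flat m (n + 1) t) *\<^sub>R h (beta t)) (at t within T \<inter> {0..})"
      by (intro has_vector_derivative_scaleR) (simp_all only: has_real_derivative_iff_has_vector_derivative)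
    moreover have "flat m n t * flat 1 2 t = flat (m + 1) (n + 2) t"
    proof -
      have "exp (- (real m / t)) * exp (- (1 / t)) = exp (- (real (m + 1) / t))"
        unfolding exp_add[symmetric] by (simp add: add_divide_distrib)
      then show ?thesis by (simp add: flat_def power_add power2_eq_square)
    qed
    ultimately show "((\<lambda>t. flat m n t *\<^sub>R h (beta t)) has_vector_derivative ?d t) (at t within T \<inter> {0..})"
      by (simp add: algebra_simps)
  next
    assume l: "t \<le> 0"
    have "((\<lambda>t. 0) has_vector_derivative ?d t) (at t within T \<inter> {..0})"
      using l by (simp add: flat_def)
    then show "((\<lambda>t. flat m n t *\<^sub>R h (beta t)) has_vector_derivative ?d t) (at t within T \<inter> {..0})"
      by (rule has_vector_derivative_transform[rotated 2]) (use t l in \<open>auto simp: flat_def\<close>)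
  qed
  with ck show ?case by (intro Ck_on_Suc_realI[OF T])
qed


lemma nonisolated_iff: "nonisolated S \<longleftrightarrow> (\<forall>x\<in>S. \<forall>e>0. \<exists>y\<in>S. y \<noteq> x \<and> dist y x < e)"
  by (auto simp: nonisolated_def trivial_limit_within islimpt_approachable)

lemma nonisolated_uminus: "nonisolated S \<Longrightarrow> nonisolated (uminus ` S)"
  unfolding nonisolated_iff by (fastforce simp: dist_real_def)

lemma at_within_relopen:
  assumes "openin (top_of_set {a..b}) S" "x \<in> S"
  shows "at x within S = at x within {a..b::real}"
proof -
  obtain W where W: "open W" "S = {a..b} \<inter> W" using assms openin_open by metis
  show ?thesis by (rule at_within_nhd[of x W]) (use W assms in auto)
qed

lemma nonisolated_relopen:
  assumes "openin (top_of_set {a..b}) S" "a < b"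
  shows "nonisolated S"
proof -
  have "at x within S \<noteq> bot" if "x \<in> S" for x
  proof -
    have "x \<in> {a..b}" using assms that openin_imp_subset by blast
    then show ?thesis
      using assms that islimpt_Icc[of a b x] by (simp add: at_within_relopen trivial_limit_within)
  qed
  then show ?thesis by (simp add: nonisolated_def)
qed

text \<open>
Two functions with the same value at \<open>0\<close> are traversed one after the other: the first one backwards
for \<open>-1 \<le> t \<le> 0\<close>, the second one forwards for \<open>0 \<le> t \<le> 1\<close>.
\<close>

definition glue :: "(real \<Rightarrow> 'b) \<Rightarrow> (real \<Rightarrow> 'b) \<Rightarrow> real \<Rightarrow> 'b" where
  "glue h1 h2 t = (if 0 \<le> t then h2 (beta t) else h1 (beta (- t)))"

lemma has_vector_derivative_glue:
  fixes h1 h2 :: "real \<Rightarrow> 'f::real_normed_vector"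
  assumes t: "t \<in> T"
    and sub2: "\<And>t. t \<in> T \<Longrightarrow> 0 \<le> t \<Longrightarrow> beta t \<in> S2"
    and sub1: "\<And>t. t \<in> T \<Longrightarrow> t \<le> 0 \<Longrightarrow> beta (- t) \<in> S1"
    and h1: "t \<le> 0 \<Longrightarrow> (h1 has_vector_derivative d1) (at (beta (- t)) within S1)"
    and h2: "0 \<le> t \<Longrightarrow> (h2 has_vector_derivative d2) (at (beta t) within S2)"
    and eq: "0 \<in> T \<Longrightarrow> h1 0 = h2 0"
  shows "(glue h1 h2 has_vector_derivative (exp 1 * flat 1 2 t) *\<^sub>R d2 + (- exp 1 * flat 1 2 (- t)) *\<^sub>R d1) (at t within T)"
    (is "(_ has_vector_derivative ?F') _")
proof (rule has_vector_derivative_two_sided)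
  assume p: "0 \<le> t"
  have "((\<lambda>t. h2 (beta t)) has_vector_derivative (exp 1 * flat 1 2 t) *\<^sub>R d2) (at t within T \<inter> {0..})"
    by (rule has_vector_derivative_comp_beta[OF h2]) (use sub2 t p in auto)
  then have "((\<lambda>t. h2 (beta t)) has_vector_derivative ?F') (at t within T \<inter> {0..})"
    using p by (simp add: flat_def)
  then show "(glue h1 h2 has_vector_derivative ?F') (at t within T \<inter> {0..})"
    by (rule has_vector_derivative_transform[rotated 2]) (use t p in \<open>auto simp: glue_def\<close>)
next
  assume p: "t \<le> 0"
  have "((\<lambda>t. h1 (beta t)) has_vector_derivative (exp 1 * flat 1 2 (- t)) *\<^sub>R d1) (at (- t) within (uminus ` (T \<inter> {..0})))"
    by (rule has_vector_derivative_comp_beta[OF h1]) (use sub1 t p in auto)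
  moreover have "(uminus has_vector_derivative - 1) (at t within T \<inter> {..0})"
    by (auto intro!: derivative_eq_intros)
  ultimately have "(((\<lambda>t. h1 (beta t)) \<circ> uminus) has_vector_derivative (- 1) *\<^sub>R ((exp 1 * flat 1 2 (- t)) *\<^sub>R d1))
      (at t within T \<inter> {..0})"
    by (intro vector_diff_chain_within)
  then have "((\<lambda>t. h1 (beta (- t))) has_vector_derivative ?F') (at t within T \<inter> {..0})"
    using p by (simp add: flat_def o_def)
  then show "(glue h1 h2 has_vector_derivative ?F') (at t within T \<inter> {..0})"
    by (rule has_vector_derivative_transform[rotated 2]) (use t p eq in \<open>auto simp: glue_def\<close>)
qed

text \<open>
The first derivative of the glued function is the sum of a right and a left part, each of which
extends smoothly by \<open>0\<close> over the junction.
\<close>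

lemma smooth_on_glue:
  fixes h1 h2 :: "real \<Rightarrow> 'f::real_normed_vector"
  assumes S: "nonisolated S1" "nonisolated S2" and T: "nonisolated T"
    and sub2: "\<And>t. t \<in> T \<Longrightarrow> 0 \<le> t \<Longrightarrow> beta t \<in> S2"
    and sub1: "\<And>t. t \<in> T \<Longrightarrow> t \<le> 0 \<Longrightarrow> beta (- t) \<in> S1"
    and h1: "smooth_on S1 h1" and h2: "smooth_on S2 h2" and eq: "0 \<in> T \<Longrightarrow> h1 0 = h2 0"
  shows "smooth_on T (glue h1 h2)"
proof -
  have "Ck_on (Suc k) T (glue h1 h2)" for k
  proof -
    obtain h1' where h1': "\<And>x. x \<in> S1 \<Longrightarrow> (h1 has_vector_derivative h1' x) (at x within S1)"
      and c1: "Ck_on k S1 h1'" using Ck_on_Suc_realE[OF S(1)] h1 unfolding smooth_on_def by metis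
    obtain h2' where h2': "\<And>x. x \<in> S2 \<Longrightarrow> (h2 has_vector_derivative h2' x) (at x within S2)"
      and c2: "Ck_on k S2 h2'" using Ck_on_Suc_realE[OF S(2)] h2 unfolding smooth_on_def by metis
    let ?r = "\<lambda>t. flat 1 2 t *\<^sub>R h2' (beta t)"
    let ?l = "\<lambda>t. flat 1 2 t *\<^sub>R h1' (beta t)"
    let ?F' = "\<lambda>t. exp 1 *\<^sub>R ?r t + (- exp 1) *\<^sub>R ?l (0 + t *\<^sub>R (- 1))"
    have "Ck_on k T ?r"
      by (rule Ck_on_flat_times[OF S(2) T sub2 c2]) auto
    moreover have "Ck_on k (uminus ` T) ?l"
      by (rule Ck_on_flat_times[OF S(1) nonisolated_uminus[OF T] _ c1]) (use sub1 in auto)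
    then have "Ck_on k T (\<lambda>t. ?l (0 + t *\<^sub>R (- 1)))"
      by (intro Ck_on_affine[OF T, of 0 "- 1" "uminus ` T"]) auto
    ultimately have ck: "Ck_on k T ?F'"
      by (intro Ck_on_add_real[OF T] Ck_on_scaleR_real[OF T])
    have "(glue h1 h2 has_vector_derivative ?F' t) (at t within T)" if t: "t \<in> T" for t
      using has_vector_derivative_glue[OF t sub2 sub1 h1' h2' eq] sub1 sub2 t by simp
    with ck show ?thesis by (intro Ck_on_Suc_realI[OF T])
  qed
  then have "Ck_on k T (glue h1 h2)" for k using Ck_on_SucD by blast
  then show ?thesis by (simp add: smooth_on_def)
qed

lemma continuous_on_glue:
  fixes h1 h2 :: "real \<Rightarrow> 'b::topological_space"
  assumes "continuous_on {0..1} h1" "continuous_on {0..1} h2" "h1 0 = h2 0"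
  shows "continuous_on {-1..1} (glue h1 h2)"
proof -
  have "continuous_on ({0..1} \<union> {-1..0}) (\<lambda>t. if 0 \<le> t then h2 (beta t) else h1 (beta (- t)))"
  proof (rule continuous_on_cases)
    show "continuous_on {0..1} (\<lambda>t. h2 (beta t))"
      by (rule continuous_on_compose2[OF assms(2) continuous_on_beta]) (auto simp: beta_bounds)
    have "continuous_on {-1..0} (\<lambda>t. beta (- t))"
      by (rule continuous_on_compose2[OF continuous_on_beta[of UNIV]]) (auto intro!: continuous_intros)
    then show "continuous_on {-1..0} (\<lambda>t. h1 (beta (- t)))"
      by (rule continuous_on_compose2[OF assms(1)]) (auto simp: beta_bounds)
    show "\<forall>t. t \<in> {0..1} \<and> \<not> 0 \<le> t \<or> t \<in> {-1..0} \<and> 0 \<le> t \<longrightarrow> h2 (beta t) = h1 (beta (- t))"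
      using assms(3) by auto
  qed auto
  moreover have "{0..1} \<union> {-1..0::real} = {-1..1}" by auto
  ultimately show ?thesis by (simp add: glue_def[abs_def])
qed

lemma beta_surj:
  assumes "u \<in> {0..1}" obtains t where "t \<in> {0..1}" "beta t = u"
  using IVT'[of beta 0 u 1] continuous_on_beta assms by auto

section \<open>Speed and arc length\<close>

text \<open>
With \<open>b < a\<close> the arc is traversed backwards, so that reversal is a special case.
\<close>

definition subarc :: "real \<Rightarrow> real \<Rightarrow> (real \<Rightarrow> 'b) \<Rightarrow> real \<Rightarrow> 'b" where
  "subarc a b \<gamma> t = \<gamma> (a + t * (b - a))"

locale riem_surface =
  fixes A :: "'a::{t2_space, second_countable_topology} chart set"
    and g :: "'a chart \<Rightarrow> 'a \<Rightarrow> real ^ 2 ^ 2"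
  assumes atlas: "smooth_atlas A" and metric: "riemannian_metric A g"
begin

abbreviation cinv :: "'a chart \<Rightarrow> real ^ 2 \<Rightarrow> 'a" where
  "cinv c \<equiv> inv_into (fst c) (snd c)"

abbreviation speed :: "(real \<Rightarrow> 'a) \<Rightarrow> real \<Rightarrow> real" where "speed \<equiv> riem_speed A g"
abbreviation len :: "(real \<Rightarrow> 'a) \<Rightarrow> real" where "len \<equiv> riem_length A g"

definition gnorm :: "'a chart \<Rightarrow> 'a \<Rightarrow> real ^ 2 \<Rightarrow> real" where
  "gnorm c p v = sqrt (v \<bullet> (g c p *v v))"

lemma chart_open: "c \<in> A \<Longrightarrow> open (fst c)" "c \<in> A \<Longrightarrow> open (snd c ` fst c)"
  using atlas by (auto simp: smooth_atlas_def)

lemma chart_cover: obtains c where "c \<in> A" "p \<in> fst c"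
proof -
  have "p \<in> (\<Union>(U, \<phi>)\<in>A. U)" using atlas by (simp add: smooth_atlas_def)
  then show ?thesis using that by force
qed

lemma chart_homeo:
  assumes "c \<in> A" shows "homeomorphism (fst c) (snd c ` fst c) (snd c) (cinv c)"
proof -
  have "\<exists>\<psi>. homeomorphism (fst c) (snd c ` fst c) (snd c) \<psi>"
    using atlas assms by (auto simp: smooth_atlas_def case_prod_unfold)
  then obtain \<psi> where \<psi>: "homeomorphism (fst c) (snd c ` fst c) (snd c) \<psi>" ..
  have inj: "inj_on (snd c) (fst c)"
    by (rule inj_on_inverseI[of _ \<psi>]) (use \<psi> in \<open>simp add: homeomorphism_def\<close>)
  have "\<psi> x = cinv c x" if "x \<in> snd c ` fst c" for x
    using that inj \<psi> by (auto simp: homeomorphism_def)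
  then show ?thesis
    by (intro homeomorphism_cong[OF \<psi>]) auto
qed

lemma cinv_chart [simp]: "c \<in> A \<Longrightarrow> p \<in> fst c \<Longrightarrow> cinv c (snd c p) = p"
  and chart_cinv [simp]: "c \<in> A \<Longrightarrow> x \<in> snd c ` fst c \<Longrightarrow> snd c (cinv c x) = x"
  and cinv_in: "c \<in> A \<Longrightarrow> x \<in> snd c ` fst c \<Longrightarrow> cinv c x \<in> fst c"
  and cont_chart: "c \<in> A \<Longrightarrow> continuous_on (fst c) (snd c)"
  and cont_cinv: "c \<in> A \<Longrightarrow> continuous_on (snd c ` fst c) (cinv c)"
  using chart_homeo[of c] by (auto simp: homeomorphism_def)

lemma chart_image_open:
  assumes "c \<in> A" "open S" shows "open (snd c ` (fst c \<inter> S))"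
proof -
  have "openin (top_of_set (snd c ` fst c)) (snd c ` (fst c \<inter> S))"
    using homeomorphism_imp_open_map[OF chart_homeo[OF assms(1)]] assms(2)
    by (simp add: openin_open_Int)
  then show ?thesis using openin_open_trans chart_open(2) assms by blast
qed

lemma chart_preimage_open:
  assumes "c \<in> A" "open S" shows "open {p \<in> fst c. snd c p \<in> S}"
  using continuous_open_preimage[OF cont_chart chart_open(1)] assms
  by (simp add: vimage_def Int_def conj_commute)

lemma transition_has_derivative:
  assumes "c \<in> A" "d \<in> A" "p \<in> fst c" "p \<in> fst d"
  shows "(transition c d has_derivative frechet_derivative (transition c d) (at (snd c p))) (at (snd c p))"
proof -
  have "smooth_on (snd c ` (fst c \<inter> fst d)) (transition c d)"
    using atlas assms by (auto simp: smooth_atlas_def)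
  then have "Ck_on (Suc 0) (snd c ` (fst c \<inter> fst d)) (transition c d)"
    unfolding smooth_on_def by blast
  then have "transition c d differentiable_on (snd c ` (fst c \<inter> fst d))" by simp
  moreover have "open (snd c ` (fst c \<inter> fst d))"
    using chart_image_open chart_open assms by blast
  moreover have "snd c p \<in> snd c ` (fst c \<inter> fst d)" using assms by blast
  ultimately show ?thesis
    by (metis at_within_open differentiable_on_def frechet_derivative_works)
qed

lemma gnorm_transform:
  assumes "c \<in> A" "d \<in> A" "p \<in> fst c" "p \<in> fst d"
  shows "gnorm c p v = gnorm d p (frechet_derivative (transition c d) (at (snd c p)) v)"
proof -
  have "v \<bullet> (g c p *v v) = frechet_derivative (transition c d) (at (snd c p)) v \<bullet>
      (g d p *v frechet_derivative (transition c d) (at (snd c p)) v)"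
    using metric assms unfolding riemannian_metric_def Let_def by (meson IntI)
  then show ?thesis by (simp add: gnorm_def)
qed

lemma gnorm_pos: "c \<in> A \<Longrightarrow> p \<in> fst c \<Longrightarrow> v \<noteq> 0 \<Longrightarrow> 0 < gnorm c p v"
  using metric unfolding riemannian_metric_def gnorm_def real_sqrt_gt_0_iff by blast

lemma gnorm_nonneg: "c \<in> A \<Longrightarrow> p \<in> fst c \<Longrightarrow> 0 \<le> gnorm c p v"
  using gnorm_pos[of c p v] by (cases "v = 0") (auto simp: gnorm_def)

lemma gnorm_scaleR: "gnorm c p (r *\<^sub>R v) = \<bar>r\<bar> * gnorm c p v"
  by (simp add: gnorm_def matrix_vector_mult_scaleR real_sqrt_mult flip: mult.assoc power2_eq_square)

lemma cont_g:
  assumes "c \<in> A" shows "continuous_on (fst c) (g c)"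
proof -
  have "smooth_on (snd c ` fst c) (g c \<circ> cinv c)"
    using metric assms unfolding riemannian_metric_def by blast
  then have "Ck_on 0 (snd c ` fst c) (g c \<circ> cinv c)" unfolding smooth_on_def by blast
  then have "continuous_on (snd c ` fst c) (g c \<circ> cinv c)" by (simp only: Ck_on.simps)
  then have "continuous_on (fst c) ((g c \<circ> cinv c) \<circ> snd c)"
    by (rule continuous_on_compose[OF cont_chart[OF assms]])
  then show ?thesis using assms by (simp cong: continuous_on_cong)
qed

lemma continuous_on_gnorm:
  assumes "c \<in> A" "continuous_on T p" "continuous_on T v" "p ` T \<subseteq> fst c"
  shows "continuous_on T (\<lambda>t. gnorm c (p t) (v t))"
proof -
  have "continuous_on T (\<lambda>t. g c (p t))"
    using continuous_on_compose2[OF cont_g] assms by blast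
  then have "continuous_on T (\<lambda>t. g c (p t) *v v t)"
    using assms unfolding matrix_vector_mult_def
    by (auto intro!: continuous_intros)
  then show ?thesis using assms unfolding gnorm_def by (auto intro!: continuous_intros)
qed

lemma eventually_in_chart:
  assumes "continuous_on {0..1} \<gamma>" "t \<in> {0..1::real}" "\<gamma> t \<in> U" "open (U :: 'a set)"
  shows "eventually (\<lambda>s. \<gamma> s \<in> U) (at t within {0..1})"
  using assms topological_tendstoD unfolding continuous_on_def by blast

text \<open>
The chart chosen by Hilbert's operator in the definition of the speed can be replaced by any other
one, because of the transformation law of the metric.
\<close>

lemma riem_speed_eq:
  assumes cont: "continuous_on {0..1} \<gamma>" and t: "t \<in> {0..1}" and c: "c \<in> A" "\<gamma> t \<in> fst c"
    and v: "((snd c \<circ> \<gamma>) has_vector_derivative v) (at t within {0..1})"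
  shows "speed \<gamma> t = gnorm c (\<gamma> t) v"
proof -
  define d where "d = (SOME c. c \<in> A \<and> \<gamma> t \<in> fst c)"
  have d: "d \<in> A" "\<gamma> t \<in> fst d" using someI[of "\<lambda>c. c \<in> A \<and> \<gamma> t \<in> fst c"] c d_def by auto
  let ?D = "frechet_derivative (transition c d) (at (snd c (\<gamma> t)))"
  have D: "(transition c d has_derivative ?D) (at (snd c (\<gamma> t)))"
    by (rule transition_has_derivative) (use c d in auto)
  have "((transition c d \<circ> (snd c \<circ> \<gamma>)) has_derivative (?D \<circ> (\<lambda>h. h *\<^sub>R v))) (at t within {0..1})"
    by (rule diff_chain_within) (use v D has_derivative_at_withinI in \<open>auto simp: has_vector_derivative_def\<close>)
  then have "((snd d \<circ> \<gamma>) has_derivative (?D \<circ> (\<lambda>h. h *\<^sub>R v))) (at t within {0..1})"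
  proof (rule has_derivative_transform_eventually)
    show "\<forall>\<^sub>F x' in at t within {0..1}. (transition c d \<circ> (snd c \<circ> \<gamma>)) x' = (snd d \<circ> \<gamma>) x'"
      using eventually_in_chart[OF cont t c(2) chart_open(1)[OF c(1)]]
      by eventually_elim (use c in \<open>simp add: transition_def\<close>)
  qed (use t c in \<open>auto simp: transition_def\<close>)
  moreover have "?D \<circ> (\<lambda>h. h *\<^sub>R v) = (\<lambda>h. h *\<^sub>R ?D v)"
    using linear_scale[OF has_derivative_linear[OF D]] by auto
  ultimately have "((snd d \<circ> \<gamma>) has_vector_derivative ?D v) (at t within {0..1})"
    by (simp add: has_vector_derivative_def)
  then have "vector_derivative (snd d \<circ> \<gamma>) (at t within {0..1}) = ?D v"
    using t vector_derivative_within_cbox[of 0 1 t] by simp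
  then have "speed \<gamma> t = gnorm d (\<gamma> t) (?D v)"
    by (simp add: riem_speed_def gnorm_def Let_def flip: d_def)
  also have "\<dots> = gnorm c (\<gamma> t) v"
    by (rule gnorm_transform[symmetric]) (use c d in auto)
  finally show ?thesis .
qed

lemma openin_path_preimage:
  assumes "continuous_on {a..b::real} \<gamma>" "open U"
  shows "openin (top_of_set {a..b}) {t \<in> {a..b}. \<gamma> t \<in> U}"
  using continuous_openin_preimage_gen[OF assms] by (simp add: vimage_def Int_def)

definition vel :: "'a chart \<Rightarrow> (real \<Rightarrow> 'a) \<Rightarrow> real \<Rightarrow> real ^ 2" where
  "vel c \<gamma> t = vector_derivative (snd c \<circ> \<gamma>) (at t within {0..1})"

lemma smooth_path_velocity:
  assumes "smooth_path A \<gamma>" "c \<in> A"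
  shows has_velocity: "\<And>t. t \<in> {0..1} \<Longrightarrow> \<gamma> t \<in> fst c \<Longrightarrow>
      ((snd c \<circ> \<gamma>) has_vector_derivative vel c \<gamma> t) (at t within {0..1})"
    and continuous_on_velocity: "continuous_on {t \<in> {0..1}. \<gamma> t \<in> fst c} (vel c \<gamma>)"
proof -
  let ?T = "{t \<in> {0..1}. \<gamma> t \<in> fst c}"
  have ro: "openin (top_of_set {0..1}) ?T"
    using assms chart_open by (intro openin_path_preimage) (auto simp: smooth_path_def path_def)
  have "smooth_on ?T (snd c \<circ> \<gamma>)" using assms by (cases c) (auto simp: smooth_path_def)
  then have "Ck_on (Suc 0) ?T (snd c \<circ> \<gamma>)" unfolding smooth_on_def by blast
  moreover have "nonisolated ?T" by (rule nonisolated_relopen[OF ro]) simp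
  ultimately obtain v
    where v: "\<And>t. t \<in> ?T \<Longrightarrow> ((snd c \<circ> \<gamma>) has_vector_derivative v t) (at t within ?T)" "Ck_on 0 ?T v"
    using Ck_on_Suc_realE by blast
  have *: "((snd c \<circ> \<gamma>) has_vector_derivative v t) (at t within {0..1}) \<and> vel c \<gamma> t = v t" if t: "t \<in> ?T" for t
    using v(1)[OF t] at_within_relopen[OF ro t] vector_derivative_within_cbox[of 0 1 t] t
    by (simp add: vel_def)
  then show "((snd c \<circ> \<gamma>) has_vector_derivative vel c \<gamma> t) (at t within {0..1})"
    if "t \<in> {0..1}" "\<gamma> t \<in> fst c" for t using that by simp
  have "continuous_on ?T v" using v(2) by (simp only: Ck_on.simps)
  then show "continuous_on ?T (vel c \<gamma>)" by (rule continuous_on_eq) (use * in simp)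
qed

lemma speed_velocity:
  assumes "smooth_path A \<gamma>" "c \<in> A" "t \<in> {0..1}" "\<gamma> t \<in> fst c"
  shows "speed \<gamma> t = gnorm c (\<gamma> t) (vel c \<gamma> t)"
  by (rule riem_speed_eq) (use assms has_velocity in \<open>auto simp: smooth_path_def path_def\<close>)

lemma riem_speed_nonneg:
  assumes "c \<in> A" "\<gamma> t \<in> fst c" shows "0 \<le> speed \<gamma> t"
proof -
  define d where "d = (SOME c. c \<in> A \<and> \<gamma> t \<in> fst c)"
  have d: "d \<in> A" "\<gamma> t \<in> fst d" using someI[of "\<lambda>c. c \<in> A \<and> \<gamma> t \<in> fst c"] assms d_def by auto
  then show ?thesis
    using gnorm_nonneg[OF d] by (simp add: riem_speed_def Let_def gnorm_def flip: d_def)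
qed

lemma continuous_on_riem_speed:
  assumes "smooth_path A \<gamma>" shows "continuous_on {0..1} (speed \<gamma>)"
proof -
  have cont: "continuous_on {0..1} \<gamma>" using assms by (simp add: smooth_path_def path_def)
  have "continuous (at t within {0..1}) (speed \<gamma>)" if t: "t \<in> {0..1}" for t
  proof -
    obtain c where c: "c \<in> A" "\<gamma> t \<in> fst c" using chart_cover by metis
    let ?T = "{t \<in> {0..1}. \<gamma> t \<in> fst c}"
    have ro: "openin (top_of_set {0..1}) ?T"
      using openin_path_preimage[OF cont] chart_open c by simp
    have "continuous_on ?T (\<lambda>t. gnorm c (\<gamma> t) (vel c \<gamma> t))"
      by (rule continuous_on_gnorm) (use c continuous_on_velocity[OF assms] cont in \<open>auto intro: continuous_on_subset\<close>)
    then have "continuous_on ?T (speed \<gamma>)"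
      by (rule continuous_on_eq) (use speed_velocity[OF assms c(1)] in simp)
    then have "continuous (at t within ?T) (speed \<gamma>)"
      using t c by (simp add: continuous_on_eq_continuous_within)
    then show ?thesis using at_within_relopen[OF ro, of t] t c by simp
  qed
  then show ?thesis by (simp add: continuous_on_eq_continuous_within)
qed

text \<open>
Arc length is described by its derivative, because its behaviour under reparametrization and
concatenation is then read off from the chain rule.
\<close>

definition arclength :: "(real \<Rightarrow> 'a) \<Rightarrow> (real \<Rightarrow> real) \<Rightarrow> bool" where
  "arclength \<gamma> \<Lambda> \<longleftrightarrow> (\<forall>t\<in>{0..1}. (\<Lambda> has_vector_derivative speed \<gamma> t) (at t within {0..1}))"

lemma arclength_exists:
  assumes "smooth_path A \<gamma>" obtains \<Lambda> where "arclength \<gamma> \<Lambda>" "\<Lambda> 0 = 0"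
proof -
  have "arclength \<gamma> (\<lambda>x. integral {0..x} (speed \<gamma>))"
    unfolding arclength_def using integral_has_vector_derivative continuous_on_riem_speed[OF assms] by blast
  then show ?thesis using that by fastforce
qed

lemma arclength_riem_length:
  assumes "arclength \<gamma> \<Lambda>" shows "len \<gamma> = \<Lambda> 1 - \<Lambda> 0"
  unfolding riem_length_def
  by (rule integral_unique, rule fundamental_theorem_of_calculus) (use assms in \<open>auto simp: arclength_def\<close>)

lemma arclength_continuous: "arclength \<gamma> \<Lambda> \<Longrightarrow> continuous_on {0..1} \<Lambda>"
  unfolding arclength_def continuous_on_eq_continuous_within by (meson has_vector_derivative_continuous)

lemma arclength_mono:
  assumes "arclength \<gamma> \<Lambda>" "0 \<le> s" "s \<le> t" "t \<le> 1" shows "\<Lambda> s \<le> \<Lambda> t"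
proof -
  have "norm (0 - 0 :: real) \<le> \<Lambda> t - \<Lambda> s" if "s < t"
  proof (rule differentiable_bound_general[OF that, of "\<lambda>_. 0" \<Lambda> "\<lambda>_. 0" "speed \<gamma>"])
    show "continuous_on {s..t} \<Lambda>"
      using arclength_continuous[OF assms(1)] assms by (auto intro: continuous_on_subset)
    fix x assume x: "s < x" "x < t"
    have "x \<in> interior {0..1}" using x assms by simp
    then have "at x within {0..1} = at x" by (rule at_within_interior)
    then show "(\<Lambda> has_vector_derivative speed \<gamma> x) (at x)"
      using assms x unfolding arclength_def by (metis atLeastAtMost_iff less_eq_real_def order_trans)
    obtain c where "c \<in> A" "\<gamma> x \<in> fst c" using chart_cover by metis
    then show "norm (0::real) \<le> speed \<gamma> x" using riem_speed_nonneg by simp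
  qed auto
  then show ?thesis using assms by (cases "s = t") auto
qed

lemma riem_length_nonneg:
  assumes "smooth_path A \<gamma>" shows "0 \<le> len \<gamma>"
proof -
  obtain \<Lambda> where "arclength \<gamma> \<Lambda>" using arclength_exists assms by blast
  then show ?thesis using arclength_riem_length arclength_mono[of \<gamma> \<Lambda> 0 1] by simp
qed

lemma smooth_subarc:
  assumes \<gamma>: "smooth_path A \<gamma>" and ab: "a \<in> {0..1}" "b \<in> {0..1}" "a \<noteq> b"
    and nc: "\<not> subarc a b \<gamma> constant_on {0..1}" and \<Lambda>: "arclength \<gamma> \<Lambda>"
  shows "smooth_path A (subarc a b \<gamma>)" "arclength (subarc a b \<gamma>) (\<lambda>t. sgn (b - a) * \<Lambda> (a + t * (b - a)))"
proof -
  let ?s = "subarc a b \<gamma>"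
  have cont: "continuous_on {0..1} \<gamma>" using assms by (simp add: smooth_path_def path_def)
  have in01: "a + t * (b - a) \<in> {0..1}" if "t \<in> {0..1}" for t
  proof -
    have "(1 - t) *\<^sub>R a + t *\<^sub>R b \<in> {0..1}" by (rule convexD_alt) (use ab that in auto)
    then show ?thesis by (simp add: algebra_simps)
  qed
  have p: "path ?s" unfolding path_def subarc_def
    by (rule continuous_on_compose2[OF cont]) (use in01 in \<open>auto intro!: continuous_intros\<close>)
  have "smooth_on {t \<in> {0..1}. ?s t \<in> U} (\<phi> \<circ> ?s)" if c: "(U, \<phi>) \<in> A" for U \<phi>
  proof -
    have oU: "open U" using chart_open[OF c] by simp
    have ni: "nonisolated {t \<in> {0..1}. ?s t \<in> U}"
      using nonisolated_relopen[OF openin_path_preimage[OF _ oU]] p by (simp add: path_def)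
    have "smooth_on {t \<in> {0..1}. \<gamma> t \<in> U} (\<phi> \<circ> \<gamma>)" using \<gamma> c by (auto simp: smooth_path_def)
    then have "Ck_on k {t \<in> {0..1}. ?s t \<in> U} (\<lambda>t. (\<phi> \<circ> \<gamma>) (a + t *\<^sub>R (b - a)))" for k
      using in01 by (intro Ck_on_affine[OF ni, where W="{t \<in> {0..1}. \<gamma> t \<in> U}" and F="\<phi> \<circ> \<gamma>"])
        (simp_all add: smooth_on_def subarc_def)
    then show ?thesis by (simp add: smooth_on_def subarc_def o_def)
  qed
  with p nc show "smooth_path A ?s" by (auto simp: smooth_path_def)
  have aff: "((\<lambda>t. a + t * (b - a)) has_vector_derivative (b - a)) (at t within {0..1})" for t
    by (auto intro!: derivative_eq_intros)
  have img: "(\<lambda>t. a + t * (b - a)) ` {0..1} \<subseteq> {0..1}" using in01 by blast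
  show "arclength ?s (\<lambda>t. sgn (b - a) * \<Lambda> (a + t * (b - a)))"
    unfolding arclength_def
  proof
    fix t :: real assume t: "t \<in> {0..1}"
    let ?u = "a + t * (b - a)"
    obtain c where c: "c \<in> A" "\<gamma> ?u \<in> fst c" using chart_cover by metis
    have v1: "((snd c \<circ> \<gamma>) has_vector_derivative vel c \<gamma> ?u) (at ?u within {0..1})"
      by (rule has_velocity[OF \<gamma> c(1) in01[OF t] c(2)])
    have "(((snd c \<circ> \<gamma>) \<circ> (\<lambda>t. a + t * (b - a))) has_vector_derivative (b - a) *\<^sub>R vel c \<gamma> ?u) (at t within {0..1})"
      by (rule vector_diff_chain_within[OF aff]) (use v1 img has_vector_derivative_within_subset in blast)
    then have "((snd c \<circ> ?s) has_vector_derivative (b - a) *\<^sub>R vel c \<gamma> ?u) (at t within {0..1})"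
      by (simp add: subarc_def o_def)
    then have "speed ?s t = gnorm c (?s t) ((b - a) *\<^sub>R vel c \<gamma> ?u)"
      using p t c by (intro riem_speed_eq) (auto simp: path_def subarc_def)
    also have "\<dots> = \<bar>b - a\<bar> * speed \<gamma> ?u"
      using speed_velocity[OF \<gamma> c(1) in01[OF t] c(2)]
      by (simp add: gnorm_scaleR subarc_def)
    finally have sp: "speed ?s t = \<bar>b - a\<bar> * speed \<gamma> ?u" .
    have "(\<Lambda> has_vector_derivative speed \<gamma> ?u) (at ?u within {0..1})"
      using \<Lambda> in01 t by (auto simp: arclength_def)
    then have "((\<Lambda> \<circ> (\<lambda>t. a + t * (b - a))) has_vector_derivative (b - a) *\<^sub>R speed \<gamma> ?u) (at t within {0..1})"
      by (intro vector_diff_chain_within[OF aff]) (use img has_vector_derivative_within_subset in blast)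
    then have "((\<lambda>t. sgn (b - a) * \<Lambda> (a + t * (b - a))) has_vector_derivative sgn (b - a) * ((b - a) *\<^sub>R speed \<gamma> ?u)) (at t within {0..1})"
      by (auto intro!: derivative_eq_intros simp: o_def)
    then show "((\<lambda>t. sgn (b - a) * \<Lambda> (a + t * (b - a))) has_vector_derivative speed ?s t) (at t within {0..1})"
      by (simp add: sp abs_sgn mult_ac)
  qed
qed

text \<open>
Both paths start at the common point, so that a concatenation arises from the first one being
traversed backwards. The affine map \<open>2 * s - 1\<close> passes from the unit interval to the domain of \<open>glue\<close>.
\<close>

lemma smooth_path_join:
  assumes \<gamma>1: "smooth_path A \<gamma>1" and \<gamma>2: "smooth_path A \<gamma>2" and eq: "\<gamma>1 0 = \<gamma>2 0"
  defines "\<Gamma> \<equiv> \<lambda>s. glue \<gamma>1 \<gamma>2 (2 * s - 1)"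
  shows "smooth_path A \<Gamma>" "len \<Gamma> = len \<gamma>1 + len \<gamma>2"
    "pathstart \<Gamma> = \<gamma>1 1" "pathfinish \<Gamma> = \<gamma>2 1" "path_image \<Gamma> \<subseteq> path_image \<gamma>1 \<union> path_image \<gamma>2"
proof -
  let ?G = "glue \<gamma>1 \<gamma>2"
  have c1: "continuous_on {0..1} \<gamma>1" and c2: "continuous_on {0..1} \<gamma>2"
    using \<gamma>1 \<gamma>2 by (auto simp: smooth_path_def path_def)
  have cG: "continuous_on {-1..1} ?G" using continuous_on_glue c1 c2 eq by blast
  have c\<Gamma>: "continuous_on {0..1} \<Gamma>" unfolding \<Gamma>_def
    by (rule continuous_on_compose2[OF cG]) (auto intro!: continuous_intros)
  have comp: "f \<circ> \<Gamma> = (\<lambda>s. glue (f \<circ> \<gamma>1) (f \<circ> \<gamma>2) (- 1 + s *\<^sub>R 2))" for f :: "'a \<Rightarrow> 'x"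
    by (auto simp: \<Gamma>_def glue_def fun_eq_iff algebra_simps)
  have "smooth_on {s \<in> {0..1}. \<Gamma> s \<in> U} (\<phi> \<circ> \<Gamma>)" if c: "(U, \<phi>) \<in> A" for U \<phi>
  proof -
    have oU: "open U" using chart_open[OF c] by simp
    let ?T = "{t \<in> {-1..1}. ?G t \<in> U}"
    have "smooth_on ?T (glue (\<phi> \<circ> \<gamma>1) (\<phi> \<circ> \<gamma>2))"
    proof (rule smooth_on_glue)
      show "nonisolated {t \<in> {0..1}. \<gamma>1 t \<in> U}" "nonisolated {t \<in> {0..1}. \<gamma>2 t \<in> U}" "nonisolated ?T"
        by (rule nonisolated_relopen[OF openin_path_preimage[OF _ oU]]; use c1 c2 cG in simp)+
      show "smooth_on {t \<in> {0..1}. \<gamma>1 t \<in> U} (\<phi> \<circ> \<gamma>1)" "smooth_on {t \<in> {0..1}. \<gamma>2 t \<in> U} (\<phi> \<circ> \<gamma>2)"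
        using \<gamma>1 \<gamma>2 c by (auto simp: smooth_path_def)
      show "\<And>t. t \<in> ?T \<Longrightarrow> 0 \<le> t \<Longrightarrow> beta t \<in> {t \<in> {0..1}. \<gamma>2 t \<in> U}"
        "\<And>t. t \<in> ?T \<Longrightarrow> t \<le> 0 \<Longrightarrow> beta (- t) \<in> {t \<in> {0..1}. \<gamma>1 t \<in> U}"
        using eq by (auto simp: beta_bounds glue_def split: if_splits)
    qed (use eq in auto)
    moreover have "nonisolated {s \<in> {0..1}. \<Gamma> s \<in> U}"
      by (rule nonisolated_relopen[OF openin_path_preimage[OF c\<Gamma> oU]]) simp
    ultimately have "Ck_on k {s \<in> {0..1}. \<Gamma> s \<in> U} (\<lambda>s. glue (\<phi> \<circ> \<gamma>1) (\<phi> \<circ> \<gamma>2) (- 1 + s *\<^sub>R 2))" for k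
      by (intro Ck_on_affine[where W="?T" and F="glue (\<phi> \<circ> \<gamma>1) (\<phi> \<circ> \<gamma>2)"]) (simp_all add: smooth_on_def \<Gamma>_def algebra_simps)
    then show ?thesis unfolding comp by (simp add: smooth_on_def)
  qed
  moreover have "\<not> \<Gamma> constant_on {0..1}"
  proof
    assume "\<Gamma> constant_on {0..1}"
    then obtain p where p: "\<And>s. s \<in> {0..1} \<Longrightarrow> \<Gamma> s = p" by (auto simp: constant_on_def)
    have "\<gamma>2 u = p" if u: "u \<in> {0..1}" for u
    proof -
      obtain t where "t \<in> {0..1}" "beta t = u" using beta_surj u by blast
      moreover have "2 * ((t + 1) / 2) - 1 = t" by (simp add: field_simps)
      ultimately show ?thesis using p[of "(t + 1) / 2"] unfolding \<Gamma>_def glue_def by auto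
    qed
    then show False using \<gamma>2 by (auto simp: smooth_path_def constant_on_def)
  qed
  ultimately show "smooth_path A \<Gamma>" using c\<Gamma> by (auto simp: smooth_path_def path_def)
  show "pathstart \<Gamma> = \<gamma>1 1" "pathfinish \<Gamma> = \<gamma>2 1"
    by (auto simp: pathstart_def pathfinish_def \<Gamma>_def glue_def)
  show "path_image \<Gamma> \<subseteq> path_image \<gamma>1 \<union> path_image \<gamma>2"
    by (auto simp: path_image_def \<Gamma>_def glue_def beta_bounds split: if_splits)
  obtain \<Lambda>1 where \<Lambda>1: "arclength \<gamma>1 \<Lambda>1" "\<Lambda>1 0 = 0" using arclength_exists \<gamma>1 by blast
  obtain \<Lambda>2 where \<Lambda>2: "arclength \<gamma>2 \<Lambda>2" "\<Lambda>2 0 = 0" using arclength_exists \<gamma>2 by blast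
  have aff: "((\<lambda>s. - 1 + s *\<^sub>R 2) has_vector_derivative (2::real)) (at s within {0..1})" for s :: real
    by (auto intro!: derivative_eq_intros)
  have img: "(\<lambda>s::real. - 1 + s *\<^sub>R (2::real)) ` {0..1} \<subseteq> {-1..1}" by auto
  have glued: "((\<lambda>s. glue h1 h2 (- 1 + s *\<^sub>R 2)) has_vector_derivative
       2 *\<^sub>R ((exp 1 * flat 1 2 t) *\<^sub>R d2 + (- exp 1 * flat 1 2 (- t)) *\<^sub>R d1)) (at s within {0..1})"
    if s: "s \<in> {0..1}" and t: "t = 2 * s - 1"
      and h1: "t \<le> 0 \<Longrightarrow> (h1 has_vector_derivative d1) (at (beta (- t)) within {0..1})"
      and h2: "0 \<le> t \<Longrightarrow> (h2 has_vector_derivative d2) (at (beta t) within {0..1})"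
      and e: "h1 0 = h2 0" for s t h1 h2 and d1 d2 :: "'y::real_normed_vector"
  proof -
    have "(glue h1 h2 has_vector_derivative (exp 1 * flat 1 2 t) *\<^sub>R d2 + (- exp 1 * flat 1 2 (- t)) *\<^sub>R d1) (at t within {-1..1})"
      by (rule has_vector_derivative_glue[OF _ _ _ h1 h2]) (use s t e in \<open>auto simp: beta_bounds\<close>)
    moreover have "t = - 1 + s *\<^sub>R 2" using t by simp
    ultimately show ?thesis
      using vector_diff_chain_within[OF aff[of s], of "glue h1 h2"] img
      by (auto simp: o_def intro: has_vector_derivative_within_subset)
  qed
  let ?L = "\<lambda>s. glue (\<lambda>u. - \<Lambda>1 u) \<Lambda>2 (- 1 + s *\<^sub>R 2)"
  have "arclength \<Gamma> ?L" unfolding arclength_def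
  proof
    fix s :: real assume s: "s \<in> {0..1}"
    define t where "t = 2 * s - 1"
    obtain c where c: "c \<in> A" "\<Gamma> s \<in> fst c" using chart_cover by metis
    have t1: "t \<le> 0 \<Longrightarrow> beta (- t) \<in> {0..1} \<and> \<gamma>1 (beta (- t)) = \<Gamma> s"
      using s eq by (cases "t = 0") (auto simp: t_def beta_bounds \<Gamma>_def glue_def)
    have t2: "0 \<le> t \<Longrightarrow> beta t \<in> {0..1} \<and> \<gamma>2 (beta t) = \<Gamma> s"
      using s by (auto simp: t_def beta_bounds \<Gamma>_def glue_def)
    have d1: "t \<le> 0 \<Longrightarrow> ((snd c \<circ> \<gamma>1) has_vector_derivative vel c \<gamma>1 (beta (- t))) (at (beta (- t)) within {0..1})"
      using t1 c by (intro has_velocity[OF \<gamma>1]) auto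
    have d2: "0 \<le> t \<Longrightarrow> ((snd c \<circ> \<gamma>2) has_vector_derivative vel c \<gamma>2 (beta t)) (at (beta t) within {0..1})"
      using t2 c by (intro has_velocity[OF \<gamma>2]) auto
    have "((snd c \<circ> \<Gamma>) has_vector_derivative
       2 *\<^sub>R ((exp 1 * flat 1 2 t) *\<^sub>R vel c \<gamma>2 (beta t) + (- exp 1 * flat 1 2 (- t)) *\<^sub>R vel c \<gamma>1 (beta (- t)))) (at s within {0..1})"
      unfolding comp by (rule glued[OF s t_def d1 d2]) (use eq in auto)
    then have sp: "speed \<Gamma> s = gnorm c (\<Gamma> s)
       (2 *\<^sub>R ((exp 1 * flat 1 2 t) *\<^sub>R vel c \<gamma>2 (beta t) + (- exp 1 * flat 1 2 (- t)) *\<^sub>R vel c \<gamma>1 (beta (- t))))"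
      by (rule riem_speed_eq[OF c\<Gamma> s c])
    have l1: "t \<le> 0 \<Longrightarrow> ((\<lambda>u. - \<Lambda>1 u) has_vector_derivative - speed \<gamma>1 (beta (- t))) (at (beta (- t)) within {0..1})"
      using \<Lambda>1 t1 unfolding arclength_def by (auto intro!: derivative_eq_intros)
    have l2: "0 \<le> t \<Longrightarrow> (\<Lambda>2 has_vector_derivative speed \<gamma>2 (beta t)) (at (beta t) within {0..1})"
      using \<Lambda>2 t2 unfolding arclength_def by auto
    have "(?L has_vector_derivative 2 *\<^sub>R ((exp 1 * flat 1 2 t) *\<^sub>R speed \<gamma>2 (beta t) +
        (- exp 1 * flat 1 2 (- t)) *\<^sub>R (- speed \<gamma>1 (beta (- t))))) (at s within {0..1})"
      by (rule glued[OF s t_def l1 l2]) (use \<Lambda>1 \<Lambda>2 in auto)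
    moreover have "2 *\<^sub>R ((exp 1 * flat 1 2 t) *\<^sub>R speed \<gamma>2 (beta t) +
        (- exp 1 * flat 1 2 (- t)) *\<^sub>R (- speed \<gamma>1 (beta (- t)))) = speed \<Gamma> s"
    proof (cases "0 \<le> t")
      case True
      have "speed \<gamma>2 (beta t) = gnorm c (\<Gamma> s) (vel c \<gamma>2 (beta t))"
        using speed_velocity[OF \<gamma>2 c(1)] t2 True c by simp
      then show ?thesis using True by (simp add: sp flat_def gnorm_scaleR)
    next
      case False
      have "speed \<gamma>1 (beta (- t)) = gnorm c (\<Gamma> s) (vel c \<gamma>1 (beta (- t)))"
        using speed_velocity[OF \<gamma>1 c(1)] t1 False c by simp
      then show ?thesis using False gnorm_scaleR[of c "\<Gamma> s" "- r" for r] by (simp add: sp flat_def gnorm_scaleR)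
    qed
    ultimately show "(?L has_vector_derivative speed \<Gamma> s) (at s within {0..1})" by simp
  qed
  from arclength_riem_length[OF this] show "len \<Gamma> = len \<gamma>1 + len \<gamma>2"
    using arclength_riem_length \<Lambda>1 \<Lambda>2 by (simp add: glue_def)
qed

end

text \<open>
The last property says that \<open>\<gamma> \<tau>\<close> is a limit of earlier points of the curve, in the form in which it
is used: closed conditions persist up to the exit time.
\<close>

lemma first_exit:
  fixes \<gamma> :: "real \<Rightarrow> 'b::topological_space"
  assumes cont: "continuous_on {0..1} \<gamma>" and W: "open W" "\<gamma> 0 \<in> W" "\<gamma> 1 \<notin> W"
  obtains \<tau> where "0 < \<tau>" "\<tau> \<le> 1" "\<gamma> \<tau> \<notin> W" "\<And>t. 0 \<le> t \<Longrightarrow> t < \<tau> \<Longrightarrow> \<gamma> t \<in> W"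
    "\<And>K. closed K \<Longrightarrow> (\<And>t. 0 \<le> t \<Longrightarrow> t < \<tau> \<Longrightarrow> \<gamma> t \<in> K) \<Longrightarrow> \<gamma> \<tau> \<in> K"
proof -
  define T where "T = {0..1} \<inter> \<gamma> -` (- W)"
  have "closedin (top_of_set {0..1}) T"
    unfolding T_def by (rule continuous_closedin_preimage[OF cont]) (use W in auto)
  then have "compact T" using closedin_compact compact_Icc by blast
  moreover have "1 \<in> T" using W by (simp add: T_def)
  then have "T \<noteq> {}" by blast
  ultimately have "\<exists>\<tau>\<in>T. \<forall>t\<in>T. \<tau> \<le> t" by (rule compact_attains_inf)
  then obtain \<tau> where \<tau>1: "\<tau> \<in> T" and \<tau>2: "\<forall>t\<in>T. \<tau> \<le> t" by blast
  have \<tau>: "0 \<le> \<tau>" "\<tau> \<le> 1" "\<gamma> \<tau> \<notin> W" using \<tau>1 by (auto simp: T_def)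
  then have "0 < \<tau>" using W by (cases "\<tau> = 0") auto
  moreover have "\<gamma> t \<in> W" if "0 \<le> t" "t < \<tau>" for t
  proof -
    have "t \<notin> T" using \<tau>2 that by fastforce
    then show ?thesis using that \<tau> by (auto simp: T_def)
  qed
  moreover have "\<gamma> \<tau> \<in> K" if K: "closed K" "\<And>t. 0 \<le> t \<Longrightarrow> t < \<tau> \<Longrightarrow> \<gamma> t \<in> K" for K
  proof -
    have "closedin (top_of_set {0..1}) ({0..1} \<inter> \<gamma> -` K)"
      by (rule continuous_closedin_preimage[OF cont K(1)])
    then have "closed ({0..1} \<inter> \<gamma> -` K)" using closedin_closed_trans by blast
    moreover have "{0..<\<tau>} \<subseteq> {0..1} \<inter> \<gamma> -` K" using K(2) \<tau> by auto
    ultimately have "closure {0..<\<tau>} \<subseteq> {0..1} \<inter> \<gamma> -` K" by (rule closure_minimal[rotated])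
    moreover have "\<tau> \<in> closure {0..<\<tau>}" using \<open>0 < \<tau>\<close> by simp
    ultimately show ?thesis by blast
  qed
  ultimately show ?thesis using that \<tau> by blast
qed

section \<open>The infimum of lengths as a distance\<close>

context riem_surface
begin

abbreviation idist :: "'a set \<Rightarrow> 'a \<Rightarrow> 'a \<Rightarrow> ereal" where "idist \<equiv> inf_length A g"

lemma idist_nonneg: "0 \<le> idist S x y"
  unfolding inf_length_def using riem_length_nonneg by (auto intro!: INF_greatest)

lemma idist_mono: "S \<subseteq> T \<Longrightarrow> idist T x y \<le> idist S x y"
  unfolding inf_length_def by (intro INF_superset_mono) auto

lemma idist_le_length:
  assumes "smooth_path A \<gamma>" "path_image \<gamma> \<subseteq> S" "pathstart \<gamma> = x" "pathfinish \<gamma> = y"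
  shows "idist S x y \<le> ereal (len \<gamma>)"
  unfolding inf_length_def by (rule INF_lower) (use assms in auto)

lemma idist_lessE:
  assumes "idist S x y < ereal a"
  obtains \<gamma> where "smooth_path A \<gamma>" "path_image \<gamma> \<subseteq> S" "pathstart \<gamma> = x" "pathfinish \<gamma> = y"
    "len \<gamma> < a"
  using assms unfolding inf_length_def INF_less_iff by auto

lemma idist_subarc:
  assumes \<gamma>: "smooth_path A \<gamma>" "path_image \<gamma> \<subseteq> S" and \<Lambda>: "arclength \<gamma> \<Lambda>"
    and ab: "a \<in> {0..1}" "b \<in> {0..1}" "\<gamma> a \<noteq> \<gamma> b"
  shows "idist S (\<gamma> a) (\<gamma> b) \<le> ereal \<bar>\<Lambda> b - \<Lambda> a\<bar>"
proof -
  have "a \<noteq> b" using ab by auto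
  have "\<not> subarc a b \<gamma> constant_on {0..1}"
  proof
    assume "subarc a b \<gamma> constant_on {0..1}"
    then obtain p where p: "\<And>t. t \<in> {0..1} \<Longrightarrow> subarc a b \<gamma> t = p" unfolding constant_on_def by blast
    from p[of 0] p[of 1] ab show False by (simp add: subarc_def)
  qed
  note s = smooth_subarc[OF \<gamma>(1) ab(1,2) \<open>a \<noteq> b\<close> this \<Lambda>]
  have in01: "a + t * (b - a) \<in> {0..1}" if "t \<in> {0..1}" for t
  proof -
    have "(1 - t) *\<^sub>R a + t *\<^sub>R b \<in> {0..1}" by (rule convexD_alt) (use ab that in auto)
    then show ?thesis by (simp add: algebra_simps)
  qed
  have "path_image (subarc a b \<gamma>) \<subseteq> S"
    using \<gamma>(2) in01 by (auto simp: path_image_def subarc_def)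
  then have "idist S (\<gamma> a) (\<gamma> b) \<le> ereal (len (subarc a b \<gamma>))"
    by (rule idist_le_length[OF s(1)]) (auto simp: pathstart_def pathfinish_def subarc_def)
  also have "len (subarc a b \<gamma>) = \<bar>\<Lambda> b - \<Lambda> a\<bar>"
  proof -
    have "len (subarc a b \<gamma>) = sgn (b - a) * (\<Lambda> b - \<Lambda> a)"
      using arclength_riem_length[OF s(2)] by (simp add: algebra_simps)
    moreover have "a < b \<Longrightarrow> \<Lambda> a \<le> \<Lambda> b" "b < a \<Longrightarrow> \<Lambda> b \<le> \<Lambda> a"
      using arclength_mono[OF \<Lambda>] ab by auto
    ultimately show ?thesis using \<open>a \<noteq> b\<close> by (cases "a < b") (auto simp: sgn_if)
  qed
  finally show ?thesis .
qed

lemma smooth_path_reverse: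
  assumes \<gamma>: "smooth_path A \<gamma>"
  shows "smooth_path A (subarc 1 0 \<gamma>)" "len (subarc 1 0 \<gamma>) = len \<gamma>"
    "path_image (subarc 1 0 \<gamma>) = path_image \<gamma>"
proof -
  have "\<not> subarc 1 0 \<gamma> constant_on {0..1}"
  proof
    assume "subarc 1 0 \<gamma> constant_on {0..1}"
    then obtain p where p: "\<And>t. t \<in> {0..1} \<Longrightarrow> \<gamma> (1 - t) = p" unfolding constant_on_def subarc_def by auto
    have "\<gamma> t = p" if "t \<in> {0..1}" for t using p[of "1 - t"] that by simp
    then show False using \<gamma> by (auto simp: smooth_path_def constant_on_def)
  qed
  moreover obtain \<Lambda> where \<Lambda>: "arclength \<gamma> \<Lambda>" using arclength_exists \<gamma> by blast
  ultimately have s: "smooth_path A (subarc 1 0 \<gamma>)" "arclength (subarc 1 0 \<gamma>) (\<lambda>t. sgn (0 - 1) * \<Lambda> (1 + t * (0 - 1)))"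
    using smooth_subarc[OF \<gamma>, of 1 0 \<Lambda>] by auto
  then show "smooth_path A (subarc 1 0 \<gamma>)" "len (subarc 1 0 \<gamma>) = len \<gamma>"
    using arclength_riem_length[OF s(2)] arclength_riem_length[OF \<Lambda>] by auto
  have "(\<lambda>t::real. 1 - t) ` {0..1} = {0..1}" by (simp add: image_diff_atLeastAtMost)
  then show "path_image (subarc 1 0 \<gamma>) = path_image \<gamma>"
    unfolding path_image_def by (metis (no_types, lifting) image_cong image_image subarc_def mult_minus1_right diff_0 diff_conv_add_uminus)
qed

lemma idist_commute_le: "idist S y x \<le> idist S x y"
proof -
  have "idist S y x \<le> ereal (len \<gamma>)"
    if "smooth_path A \<gamma>" "path_image \<gamma> \<subseteq> S" "pathstart \<gamma> = x" "pathfinish \<gamma> = y" for \<gamma>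
    using idist_le_length[of "subarc 1 0 \<gamma>" S y x] smooth_path_reverse[OF that(1)] that
    by (simp add: pathstart_def pathfinish_def subarc_def)
  then show ?thesis unfolding inf_length_def[of A g S x y] by (auto intro!: INF_greatest)
qed

lemma idist_commute: "idist S x y = idist S y x"
  using idist_commute_le by (intro antisym)

lemma idist_triangle_less:
  assumes "idist S x y < ereal a" "idist S y z < ereal b"
  shows "idist S x z < ereal (a + b)"
proof -
  obtain \<gamma>1 where 1: "smooth_path A \<gamma>1" "path_image \<gamma>1 \<subseteq> S" "pathstart \<gamma>1 = y" "pathfinish \<gamma>1 = x"
    "len \<gamma>1 < a" using assms(1) idist_commute idist_lessE by metis
  obtain \<gamma>2 where 2: "smooth_path A \<gamma>2" "path_image \<gamma>2 \<subseteq> S" "pathstart \<gamma>2 = y" "pathfinish \<gamma>2 = z"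
    "len \<gamma>2 < b" using assms(2) idist_lessE by metis
  have eq: "\<gamma>1 0 = \<gamma>2 0" using 1 2 by (simp add: pathstart_def)
  note j = smooth_path_join[OF 1(1) 2(1) eq]
  have "idist S x z \<le> ereal (len \<gamma>1 + len \<gamma>2)"
    unfolding j(2)[symmetric]
    by (rule idist_le_length[OF j(1)]) (use j(3-5) 1 2 in \<open>auto simp: pathfinish_def\<close>)
  also have "\<dots> < ereal (a + b)" using 1 2 by simp
  finally show ?thesis .
qed

lemma idist_triangle: "idist S x z \<le> idist S x y + idist S y z"
proof (rule ccontr)
  assume n: "\<not> ?thesis"
  then have lt: "idist S x y + idist S y z < idist S x z" by simp
  then have "idist S x y \<noteq> \<infinity>" "idist S y z \<noteq> \<infinity>" by auto
  then obtain u v where uv: "idist S x y = ereal u" "idist S y z = ereal v"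
    using idist_nonneg[of S x y] idist_nonneg[of S y z] by (cases "idist S x y"; cases "idist S y z") auto
  obtain r where r: "ereal (u + v) < ereal r" "ereal r < idist S x z"
    using lt ereal_dense2[of "ereal (u + v)" "idist S x z"] uv by auto
  define e where "e = (r - (u + v)) / 2"
  have "0 < e" using r by (simp add: e_def)
  then have "idist S x z < ereal ((u + e) + (v + e))"
    using uv by (intro idist_triangle_less[where y=y and a="u + e" and b="v + e"]) auto
  also have "(u + e) + (v + e) = r" by (simp add: e_def)
  finally show False using r by simp
qed

text \<open>
By compactness of a closed coordinate disc times the unit circle, the Riemannian norm is comparable
to the Euclidean one.
\<close>

lemma chart_constants:
  assumes "open S" "p \<in> S"
  obtains c R m C where "c \<in> A" "p \<in> fst c" "0 < R" "0 < m" "0 < C"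
    "cball (snd c p) R \<subseteq> snd c ` (fst c \<inter> S)"
    "\<And>q v. q \<in> fst c \<Longrightarrow> snd c q \<in> cball (snd c p) R \<Longrightarrow> m * norm v \<le> gnorm c q v \<and> gnorm c q v \<le> C * norm v"
proof -
  obtain c where c: "c \<in> A" "p \<in> fst c" using chart_cover by metis
  have "open (snd c ` (fst c \<inter> S))" using chart_image_open c assms by blast
  moreover have "snd c p \<in> snd c ` (fst c \<inter> S)" using c assms by blast
  ultimately obtain R where R: "0 < R" "cball (snd c p) R \<subseteq> snd c ` (fst c \<inter> S)"
    using open_contains_cball by metis
  let ?K = "cball (snd c p) R \<times> sphere (0 :: real ^ 2) 1"
  let ?f = "\<lambda>z. gnorm c (cinv c (fst z)) (snd z)"
  have sub: "cball (snd c p) R \<subseteq> snd c ` fst c" using R by blast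
  have cont: "continuous_on ?K ?f"
  proof (rule continuous_on_gnorm[OF c(1)])
    show "continuous_on ?K (\<lambda>z. cinv c (fst z))"
      by (rule continuous_on_compose2[OF cont_cinv[OF c(1)]]) (use sub in \<open>auto intro!: continuous_intros\<close>)
    show "(\<lambda>z. cinv c (fst z)) ` ?K \<subseteq> fst c" using cinv_in[OF c(1)] sub by auto
  qed (auto intro!: continuous_intros)
  have comp: "compact ?K" by (intro compact_Times compact_cball compact_sphere)
  have "axis 1 1 \<in> sphere (0 :: real ^ 2) 1" by simp
  then have ne: "?K \<noteq> {}" using R by (metis Times_empty cball_eq_empty empty_iff less_asym)
  obtain z0 where z0: "z0 \<in> ?K" "\<And>z. z \<in> ?K \<Longrightarrow> ?f z0 \<le> ?f z"
    using continuous_attains_inf[OF comp ne cont] by blast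
  obtain z1 where z1: "z1 \<in> ?K" "\<And>z. z \<in> ?K \<Longrightarrow> ?f z \<le> ?f z1"
    using continuous_attains_sup[OF comp ne cont] by blast
  have pos: "0 < ?f z" if "z \<in> ?K" for z
    using that sub cinv_in[OF c(1)] by (intro gnorm_pos[OF c(1)]) auto
  have bd: "?f z0 * norm v \<le> gnorm c q v \<and> gnorm c q v \<le> ?f z1 * norm v"
    if q: "q \<in> fst c" "snd c q \<in> cball (snd c p) R" for q v
  proof (cases "v = 0")
    case True
    then show ?thesis by (simp add: gnorm_def)
  next
    case False
    let ?u = "v /\<^sub>R norm v"
    have "(snd c q, ?u) \<in> ?K" using q False by simp
    then have "?f z0 \<le> gnorm c q ?u" "gnorm c q ?u \<le> ?f z1"
      using z0(2) z1(2) c(1) q by fastforce+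
    moreover have "gnorm c q ?u = gnorm c q v / norm v"
      unfolding gnorm_scaleR by (simp add: field_simps)
    ultimately have "?f z0 \<le> gnorm c q v / norm v" "gnorm c q v / norm v \<le> ?f z1" by simp_all
    then show ?thesis using False by (simp add: field_simps)
  qed
  show ?thesis
    by (rule that[OF c R(1) pos[OF z0(1)] pos[OF z1(1)] R(2)]) (use bd in auto)
qed

lemma idist_segment:
  assumes c: "c \<in> A" and sub: "closed_segment a b \<subseteq> snd c ` (fst c \<inter> S)" and ab: "a \<noteq> b"
    and C: "\<And>q v. q \<in> fst c \<Longrightarrow> snd c q \<in> closed_segment a b \<Longrightarrow> gnorm c q v \<le> C * norm v"
  shows "idist S (cinv c a) (cinv c b) \<le> ereal (C * norm (b - a))"
proof -
  define \<gamma> where "\<gamma> t = cinv c (a + t *\<^sub>R (b - a))" for t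
  have seg: "a + t *\<^sub>R (b - a) \<in> closed_segment a b" if "t \<in> {0..1}" for t
    using that by (auto simp: closed_segment_def algebra_simps intro!: exI[of _ t])
  have cc: "snd c (\<gamma> t) = a + t *\<^sub>R (b - a)" "\<gamma> t \<in> fst c" "\<gamma> t \<in> S" if "t \<in> {0..1}" for t
  proof -
    have i: "a + t *\<^sub>R (b - a) \<in> snd c ` (fst c \<inter> S)" using seg[OF that] sub by blast
    then show "snd c (\<gamma> t) = a + t *\<^sub>R (b - a)" "\<gamma> t \<in> fst c"
      unfolding \<gamma>_def using c by (auto intro!: chart_cinv cinv_in)
    show "\<gamma> t \<in> S" using i unfolding \<gamma>_def using c by auto
  qed
  have cont: "continuous_on {0..1} \<gamma>"
  proof -
    have "(\<lambda>t. a + t *\<^sub>R (b - a)) ` {0..1} \<subseteq> snd c ` fst c"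
    proof
      fix z assume "z \<in> (\<lambda>t. a + t *\<^sub>R (b - a)) ` {0..1}"
      then have "z \<in> closed_segment a b" using seg by blast
      then show "z \<in> snd c ` fst c" using sub by blast
    qed
    moreover have "continuous_on {0..1} (\<lambda>t. a + t *\<^sub>R (b - a))" by (intro continuous_intros)
    ultimately show ?thesis
      unfolding \<gamma>_def using continuous_on_compose2[OF cont_cinv[OF c]] by blast
  qed
  have "smooth_on {t \<in> {0..1}. \<gamma> t \<in> U} (\<phi> \<circ> \<gamma>)" if d: "(U, \<phi>) \<in> A" for U \<phi>
  proof -
    have oU: "open U" using chart_open[OF d] by simp
    have ni: "nonisolated {t \<in> {0..1}. \<gamma> t \<in> U}"
      by (rule nonisolated_relopen[OF openin_path_preimage[OF cont oU]]) simp
    have "smooth_on (snd c ` (fst c \<inter> U)) (transition c (U, \<phi>))"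
    proof -
      have "\<forall>c\<in>A. \<forall>d\<in>A. smooth_on (snd c ` (fst c \<inter> fst d)) (transition c d)"
        using atlas unfolding smooth_atlas_def by blast
      from bspec[OF bspec[OF this c] d] show ?thesis by simp
    qed
    then have "Ck_on k {t \<in> {0..1}. \<gamma> t \<in> U} (\<lambda>t. transition c (U, \<phi>) (a + t *\<^sub>R (b - a)))" for k
    proof (intro Ck_on_affine[OF ni])
      fix t assume t: "t \<in> {t \<in> {0..1}. \<gamma> t \<in> U}"
      then show "a + t *\<^sub>R (b - a) \<in> snd c ` (fst c \<inter> U)"
        using cc[of t] by (auto simp: image_iff intro!: bexI[of _ "\<gamma> t"])
    qed (simp add: smooth_on_def)
    then show ?thesis by (simp add: smooth_on_def transition_def \<gamma>_def[abs_def] o_def)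
  qed
  moreover have "\<not> \<gamma> constant_on {0..1}"
  proof
    assume "\<gamma> constant_on {0..1}"
    then have "\<gamma> 0 = \<gamma> 1" unfolding constant_on_def by (metis atLeastAtMost_iff order_refl zero_le_one)
    then show False using cc(1)[of 0] cc(1)[of 1] ab by simp
  qed
  ultimately have sm: "smooth_path A \<gamma>" using cont by (auto simp: smooth_path_def path_def)
  have sp: "speed \<gamma> t \<le> C * norm (b - a)" if t: "t \<in> {0..1}" for t
  proof -
    have "((\<lambda>t. a + t *\<^sub>R (b - a)) has_vector_derivative (b - a)) (at t within {0..1})"
      by (auto intro!: derivative_eq_intros)
    then have "((snd c \<circ> \<gamma>) has_vector_derivative (b - a)) (at t within {0..1})"
      by (rule has_vector_derivative_transform[rotated 2]) (use t cc in auto)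
    then have "speed \<gamma> t = gnorm c (\<gamma> t) (b - a)"
      by (intro riem_speed_eq[OF cont t c]) (use cc t in auto)
    then show ?thesis using C[of "\<gamma> t" "b - a"] cc[OF t] seg[OF t] by simp
  qed
  have "len \<gamma> \<le> integral {0..1} (\<lambda>t::real. C * norm (b - a))"
    unfolding riem_length_def
    by (rule integral_le) (use sp continuous_on_riem_speed[OF sm] in \<open>auto intro: integrable_continuous_real\<close>)
  then have "len \<gamma> \<le> C * norm (b - a)" by simp
  moreover have "idist S (cinv c a) (cinv c b) \<le> ereal (len \<gamma>)"
    by (rule idist_le_length[OF sm]) (use cc in \<open>auto simp: path_image_def pathstart_def pathfinish_def \<gamma>_def\<close>)
  ultimately show ?thesis by (simp add: order_trans[of _ "ereal (len \<gamma>)"])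
qed

lemma idist_ball:
  assumes c: "c \<in> A" and sub: "ball x r \<subseteq> snd c ` (fst c \<inter> S)"
    and C: "\<And>q v. q \<in> fst c \<Longrightarrow> snd c q \<in> ball x r \<Longrightarrow> gnorm c q v \<le> C * norm v"
    and a: "a \<in> ball x r" and b: "b \<in> ball x r"
  shows "idist S (cinv c a) (cinv c b) \<le> ereal (C * norm (b - a))"
proof -
  have *: "idist S (cinv c a) (cinv c b) \<le> ereal (C * norm (b - a))"
    if a: "a \<in> ball x r" and b: "b \<in> ball x r" and "a \<noteq> b" for a b
  proof -
    have "closed_segment a b \<subseteq> ball x r" using a b by (simp add: closed_segment_subset)
    then show ?thesis using C sub c \<open>a \<noteq> b\<close> by (intro idist_segment) blast+
  qed
  show ?thesis
  proof (cases "a = b")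
    case True
    \<comment> \<open>Constant paths are not admitted, so the distance of a point to itself is bounded by going to a
       nearby point and back.\<close>
    have "idist S (cinv c a) (cinv c a) \<le> ereal e" if "0 < e" for e
    proof -
      obtain d where d: "0 < d" "ball a d \<subseteq> ball x r"
        using a openE[OF open_ball] by blast
      define \<delta> where "\<delta> = min (d / 2) (e / (2 * (\<bar>C\<bar> + 1)))"
      have \<delta>: "0 < \<delta>" "\<delta> < d" using d that by (auto simp: \<delta>_def)
      let ?b = "a + \<delta> *\<^sub>R axis 1 1"
      have n: "norm (?b - a) = \<delta>" using \<delta> by simp
      have "?b \<in> ball a d" using \<delta> by (simp add: dist_norm)
      then have b: "?b \<in> ball x r" using d by blast
      have "?b \<noteq> a" using n \<delta> by auto
      have "\<delta> \<le> e / (2 * (\<bar>C\<bar> + 1))" by (simp add: \<delta>_def)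
      then have "\<delta> * (2 * (\<bar>C\<bar> + 1)) \<le> e" by (simp add: pos_le_divide_eq)
      moreover have "C * \<delta> \<le> \<delta> * (\<bar>C\<bar> + 1)" using \<delta> mult_left_mono[of C "\<bar>C\<bar> + 1" \<delta>] by (simp add: mult.commute)
      ultimately have le: "C * \<delta> + C * \<delta> \<le> e" by (simp add: algebra_simps)
      have "idist S (cinv c a) (cinv c a) \<le> idist S (cinv c a) (cinv c ?b) + idist S (cinv c ?b) (cinv c a)"
        by (rule idist_triangle)
      also have "\<dots> \<le> ereal (C * \<delta>) + ereal (C * \<delta>)"
        using *[OF a b \<open>?b \<noteq> a\<close>[symmetric]] n idist_commute[of S "cinv c ?b"] by (intro add_mono) auto
      also have "\<dots> \<le> ereal e" using le by simp
      finally show ?thesis .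
    qed
    then have "idist S (cinv c a) (cinv c a) \<le> 0"
      using ereal_le_epsilon2[of "idist S (cinv c a) (cinv c a)" 0] by auto
    then show ?thesis using True by (simp add: zero_ereal_def)
  qed (use * a b in auto)
qed

lemma idist_local_small:
  assumes "open S" "p \<in> S" "0 < e"
  obtains W where "open W" "p \<in> W" "W \<subseteq> S" "\<And>a b. a \<in> W \<Longrightarrow> b \<in> W \<Longrightarrow> idist S a b < ereal e"
proof -
  obtain c R m C where c: "c \<in> A" "p \<in> fst c" "0 < R" "0 < m" "0 < C"
    "cball (snd c p) R \<subseteq> snd c ` (fst c \<inter> S)"
    "\<And>q v. q \<in> fst c \<Longrightarrow> snd c q \<in> cball (snd c p) R \<Longrightarrow> m * norm v \<le> gnorm c q v \<and> gnorm c q v \<le> C * norm v"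
    by (rule chart_constants[OF assms(1,2)]) blast
  define r where "r = min R (e / (2 * C))"
  have r: "0 < r" "r \<le> R" "2 * r * C \<le> e" using c assms by (auto simp: r_def field_simps min_def)
  have sub: "ball (snd c p) r \<subseteq> cball (snd c p) R" using r by auto
  let ?W = "{q \<in> fst c. snd c q \<in> ball (snd c p) r}"
  show ?thesis
  proof (rule that[of ?W])
    show "open ?W" by (rule chart_preimage_open) (use c in auto)
    show "p \<in> ?W" using c r by auto
    show "?W \<subseteq> S"
    proof
      fix q assume q: "q \<in> ?W"
      then have "snd c q \<in> snd c ` (fst c \<inter> S)" using c sub by blast
      then obtain q' where "q' \<in> fst c" "q' \<in> S" "snd c q = snd c q'" by blast
      then have "q = q'" using q c(1) cinv_chart by (metis (no_types, lifting) mem_Collect_eq)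
      then show "q \<in> S" using \<open>q' \<in> S\<close> by simp
    qed
    fix a b assume ab: "a \<in> ?W" "b \<in> ?W"
    have "idist S (cinv c (snd c a)) (cinv c (snd c b)) \<le> ereal (C * norm (snd c b - snd c a))"
    proof (rule idist_ball[OF c(1)])
      show "ball (snd c p) r \<subseteq> snd c ` (fst c \<inter> S)" using sub c by blast
      show "gnorm c q v \<le> C * norm v" if "q \<in> fst c" "snd c q \<in> ball (snd c p) r" for q v
        using c(7) that sub by blast
    qed (use ab in auto)
    also have "C * norm (snd c b - snd c a) < C * (2 * r)"
    proof -
      have "dist (snd c b) (snd c a) \<le> dist (snd c p) (snd c b) + dist (snd c p) (snd c a)"
        by (metis dist_commute dist_triangle)
      then have "norm (snd c b - snd c a) < 2 * r" using ab by (auto simp: dist_norm)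
      then show ?thesis using c by simp
    qed
    finally show "idist S a b < ereal e"
      using r ab c(1) by (auto simp: mult_ac elim!: order_less_le_trans)
  qed
qed

lemma idist_self: assumes "open S" "p \<in> S" shows "idist S p p = 0"
proof -
  have "idist S p p \<le> ereal e" if e: "0 < e" for e
    by (rule idist_local_small[OF assms e]) (meson less_imp_le)
  then have "idist S p p \<le> 0" using ereal_le_epsilon2[of "idist S p p" 0] by auto
  then show ?thesis using idist_nonneg[of S p p] by auto
qed

lemma idist_along_path:
  assumes "open S" and \<gamma>: "smooth_path A \<gamma>" "path_image \<gamma> \<subseteq> S" and \<Lambda>: "arclength \<gamma> \<Lambda>"
    and ab: "a \<in> {0..1}" "b \<in> {0..1}"
  shows "idist S (\<gamma> a) (\<gamma> b) \<le> ereal \<bar>\<Lambda> b - \<Lambda> a\<bar>"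
proof (cases "\<gamma> a = \<gamma> b")
  case True
  moreover have "\<gamma> b \<in> S" using ab \<gamma>(2) by (auto simp: path_image_def)
  ultimately show ?thesis using idist_self[OF assms(1), of "\<gamma> b"] by (simp add: zero_ereal_def)
qed (use idist_subarc[OF \<gamma> \<Lambda> ab] in auto)

text \<open>
A path from the disc of half the radius to the complement of a coordinate disc must cross an
annulus, in which its length is bounded below by a multiple of the Euclidean one. The bound does not
depend on the set \<open>S\<close> in which the path runs.
\<close>

lemma idist_separated:
  assumes U: "open U" "x \<in> U"
  obtains W V e where "open W" "open V" "x \<in> W" "- U \<subseteq> V" "0 < e"
    "\<And>x' y S. x' \<in> W \<Longrightarrow> y \<in> V \<Longrightarrow> ereal e \<le> idist S x' y"
proof -
  obtain c R m C where c: "c \<in> A" "x \<in> fst c" "0 < R" "0 < m" "0 < C"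
    "cball (snd c x) R \<subseteq> snd c ` (fst c \<inter> U)"
    "\<And>q v. q \<in> fst c \<Longrightarrow> snd c q \<in> cball (snd c x) R \<Longrightarrow> m * norm v \<le> gnorm c q v \<and> gnorm c q v \<le> C * norm v"
    by (rule chart_constants[OF U]) blast
  let ?B = "cball (snd c x) R"
  define K where "K = cinv c ` ?B"
  have subB: "?B \<subseteq> snd c ` fst c" using c by blast
  have "compact K" unfolding K_def
    by (rule compact_continuous_image[OF continuous_on_subset[OF cont_cinv[OF c(1)] subB]]) simp
  then have "closed K" by (rule compact_imp_closed)
  have K: "q \<in> K \<longleftrightarrow> q \<in> fst c \<and> snd c q \<in> ?B" for q
  proof
    assume "q \<in> K"
    then obtain z where "z \<in> ?B" "q = cinv c z" by (auto simp: K_def)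
    then show "q \<in> fst c \<and> snd c q \<in> ?B" using subB c(1) cinv_in chart_cinv by auto
  next
    assume "q \<in> fst c \<and> snd c q \<in> ?B"
    then show "q \<in> K" unfolding K_def using c(1) by (metis cinv_chart imageI)
  qed
  have KU: "K \<subseteq> U"
  proof
    fix q assume "q \<in> K"
    then obtain z where z: "z \<in> ?B" "q = cinv c z" by (auto simp: K_def)
    then obtain q' where "q' \<in> fst c" "q' \<in> U" "z = snd c q'" using c(6) by blast
    then show "q \<in> U" using z c(1) by simp
  qed
  let ?W = "{q \<in> fst c. snd c q \<in> ball (snd c x) (R / 2)}"
  let ?O = "{q \<in> fst c. snd c q \<in> ball (snd c x) R}"
  have oO: "open ?O" by (rule chart_preimage_open) (use c in auto)
  have "m * (R / 2) \<le> len \<gamma>"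
    if \<gamma>: "smooth_path A \<gamma>" "\<gamma> 0 \<in> ?W" "\<gamma> 1 \<notin> K" for \<gamma>
  proof -
    have cont: "continuous_on {0..1} \<gamma>" using \<gamma> by (simp add: smooth_path_def path_def)
    have "\<gamma> 0 \<in> ?O" "\<gamma> 1 \<notin> ?O" using \<gamma>(2,3) K[of "\<gamma> 1"] c(3) by auto
    then obtain \<tau> where "0 < \<tau>" and \<tau>: "\<tau> \<le> 1" "\<gamma> \<tau> \<notin> ?O" and lt: "\<And>t. 0 \<le> t \<Longrightarrow> t < \<tau> \<Longrightarrow> \<gamma> t \<in> ?O"
      and cl: "\<And>K. closed K \<Longrightarrow> (\<And>t. 0 \<le> t \<Longrightarrow> t < \<tau> \<Longrightarrow> \<gamma> t \<in> K) \<Longrightarrow> \<gamma> \<tau> \<in> K"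
      by (rule first_exit[OF cont oO]) blast
    have "\<gamma> \<tau> \<in> K" by (rule cl[OF \<open>closed K\<close>]) (use lt K in fastforce)
    then have \<tau>f: "\<gamma> \<tau> \<in> fst c" "R \<le> dist (snd c x) (snd c (\<gamma> \<tau>))" using \<tau> K by auto
    have inc: "\<gamma> t \<in> fst c \<and> snd c (\<gamma> t) \<in> ?B" if "t \<in> {0..\<tau>}" for t
      using lt[of t] \<open>\<gamma> \<tau> \<in> K\<close> K that by (cases "t = \<tau>") auto
    obtain \<Lambda> where \<Lambda>: "arclength \<gamma> \<Lambda>" using arclength_exists \<gamma> by blast
    \<comment> \<open>Up to the first exit time \<open>\<tau>\<close> the path stays in the chart, where its Euclidean speed is at
       most \<open>1 / m\<close> times its Riemannian speed.\<close>
    have "norm ((snd c \<circ> \<gamma>) \<tau> - (snd c \<circ> \<gamma>) 0) \<le> (1 / m) * \<Lambda> \<tau> - (1 / m) * \<Lambda> 0"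
    proof (rule differentiable_bound_general[OF \<open>0 < \<tau>\<close>])
      show "continuous_on {0..\<tau>} (snd c \<circ> \<gamma>)"
        using inc \<tau> by (intro continuous_on_compose continuous_on_subset[OF cont] continuous_on_subset[OF cont_chart[OF c(1)]]) auto
      show "continuous_on {0..\<tau>} (\<lambda>t. 1 / m * \<Lambda> t)"
        using \<tau> by (intro continuous_intros continuous_on_subset[OF arclength_continuous[OF \<Lambda>]]) auto
      fix t assume t: "0 < t" "t < \<tau>"
      have t01: "t \<in> {0..1}" using t \<tau> by auto
      have "t \<in> interior {0..1}" using t \<tau> by simp
      then have at: "at t within {0..1} = at t" by (rule at_within_interior)
      have it: "\<gamma> t \<in> fst c" "snd c (\<gamma> t) \<in> ?B" using inc t by auto
      show d: "((snd c \<circ> \<gamma>) has_vector_derivative vel c \<gamma> t) (at t)"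
        using has_velocity[OF \<gamma>(1) c(1) t01 it(1)] at by simp
      have "(\<Lambda> has_vector_derivative speed \<gamma> t) (at t)"
        using \<Lambda> t01 at unfolding arclength_def by metis
      then show "((\<lambda>t. 1 / m * \<Lambda> t) has_vector_derivative (1 / m) * speed \<gamma> t) (at t)"
        by (auto intro!: derivative_eq_intros)
      show "norm (vel c \<gamma> t) \<le> 1 / m * speed \<gamma> t"
        using speed_velocity[OF \<gamma>(1) c(1) t01 it(1)] c(7)[OF it, of "vel c \<gamma> t"] c(4) by (simp add: field_simps)
    qed
    moreover have "R / 2 \<le> norm ((snd c \<circ> \<gamma>) \<tau> - (snd c \<circ> \<gamma>) 0)"
    proof -
      have "dist (snd c x) (snd c (\<gamma> \<tau>)) \<le> dist (snd c x) (snd c (\<gamma> 0)) + dist (snd c (\<gamma> 0)) (snd c (\<gamma> \<tau>))"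
        by (rule dist_triangle)
      then show ?thesis using \<tau>f \<gamma>(2) by (auto simp: dist_norm norm_minus_commute)
    qed
    ultimately have "R / 2 \<le> (1 / m) * \<Lambda> \<tau> - (1 / m) * \<Lambda> 0" by (rule order_trans[rotated])
    also have "\<dots> = (\<Lambda> \<tau> - \<Lambda> 0) / m" by (simp add: diff_divide_distrib)
    finally have "R / 2 \<le> (\<Lambda> \<tau> - \<Lambda> 0) / m" .
    then have "m * (R / 2) \<le> \<Lambda> \<tau> - \<Lambda> 0" using c(4) by (simp add: field_simps)
    also have "\<dots> \<le> \<Lambda> 1 - \<Lambda> 0" using arclength_mono[OF \<Lambda>, of \<tau> 1] \<tau>(1) \<open>0 < \<tau>\<close> by simp
    finally show ?thesis using arclength_riem_length[OF \<Lambda>] by simp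
  qed
  then have lb: "ereal (m * (R / 2)) \<le> idist S x' y" if "x' \<in> ?W" "y \<in> - K" for x' y S
    using that unfolding inf_length_def by (auto intro!: INF_greatest simp: pathstart_def pathfinish_def)
  show ?thesis
  proof (rule that[of ?W "- K" "m * (R / 2)"])
    show "open ?W" by (rule chart_preimage_open[OF c(1) open_ball])
    show "ereal (m * (R / 2)) \<le> idist S x' y" if "x' \<in> ?W" "y \<in> - K" for x' y S
      using lb[OF that] .
  qed (use c \<open>closed K\<close> KU in auto)
qed

text \<open>
A path of length less than \<open>L\<close>, parametrized proportionally to its arc length. The parameter
with a given arc length is chosen arbitrarily; only the distances of the resulting points matter later.
\<close>

lemma proportional_curve:
  assumes S: "open S" and l: "idist S x y < ereal L" and xy: "x \<in> S" "y \<in> S"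
  obtains w where "w 0 = x" "w 1 = y" "\<And>t. t \<in> {0..1} \<Longrightarrow> w t \<in> S"
    "\<And>s t. 0 \<le> s \<Longrightarrow> s \<le> t \<Longrightarrow> t \<le> 1 \<Longrightarrow> idist S (w s) (w t) \<le> ereal ((t - s) * L)"
proof -
  obtain \<gamma> where \<gamma>: "smooth_path A \<gamma>" "path_image \<gamma> \<subseteq> S" "pathstart \<gamma> = x" "pathfinish \<gamma> = y"
    "len \<gamma> < L" using l idist_lessE by metis
  obtain \<Lambda> where \<Lambda>: "arclength \<gamma> \<Lambda>" "\<Lambda> 0 = 0" using arclength_exists \<gamma> by blast
  define lg where "lg = len \<gamma>"
  have lg: "\<Lambda> 1 = lg" "0 \<le> lg" "lg < L"
    using arclength_riem_length[OF \<Lambda>(1)] \<Lambda>(2) \<gamma>(5) riem_length_nonneg[OF \<gamma>(1)] by (simp_all add: lg_def)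
  have "\<exists>u\<in>{0..1}. \<Lambda> u = t * lg" if "t \<in> {0..1}" for t
  proof -
    have "\<Lambda> 0 \<le> t * lg" "t * lg \<le> \<Lambda> 1"
      using that lg \<Lambda>(2) by (simp_all add: mult_left_le_one_le)
    from IVT'[OF this _ arclength_continuous[OF \<Lambda>(1)]] show ?thesis by force
  qed
  then obtain u' where u': "\<And>t. t \<in> {0..1} \<Longrightarrow> u' t \<in> {0..1} \<and> \<Lambda> (u' t) = t * lg" by metis
  \<comment> \<open>The end points are prescribed separately, because other parameters have the same arc length if the speed vanishes near an end of the
     path.\<close>
  define u where "u t = (if t = 0 then 0 else if t = 1 then 1 else u' t)" for t :: real
  have u: "u t \<in> {0..1} \<and> \<Lambda> (u t) = t * lg" if "t \<in> {0..1}" for t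
    using u'[OF that] lg \<Lambda>(2) by (auto simp: u_def)
  show ?thesis
  proof (rule that[of "\<lambda>t. \<gamma> (u t)"])
    show "\<gamma> (u 0) = x" "\<gamma> (u 1) = y" using \<gamma> by (auto simp: u_def pathstart_def pathfinish_def)
    show "\<gamma> (u t) \<in> S" if "t \<in> {0..1}" for t using u[OF that] \<gamma>(2) by (auto simp: path_image_def)
    fix s t :: real assume st: "0 \<le> s" "s \<le> t" "t \<le> 1"
    then have us: "u s \<in> {0..1} \<and> \<Lambda> (u s) = s * lg" and ut: "u t \<in> {0..1} \<and> \<Lambda> (u t) = t * lg"
      using u[of s] u[of t] by auto
    have "idist S (\<gamma> (u s)) (\<gamma> (u t)) \<le> ereal \<bar>\<Lambda> (u t) - \<Lambda> (u s)\<bar>"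
      using us ut by (intro idist_along_path[OF S \<gamma>(1,2) \<Lambda>(1)]) auto
    also have "\<bar>\<Lambda> (u t) - \<Lambda> (u s)\<bar> = (t - s) * lg"
      using us ut st lg by (simp add: abs_mult flip: left_diff_distrib)
    also have "(t - s) * lg \<le> (t - s) * L" using st lg by (intro mult_left_mono) auto
    finally show "idist S (\<gamma> (u s)) (\<gamma> (u t)) \<le> ereal ((t - s) * L)" by simp
  qed
qed

text \<open>
A Lipschitz curve is replaced by an inscribed polygon with edges so short that they stay in the open
set. This is how circular arcs are travelled using straight segments only.
\<close>

lemma idist_lipschitz_curve:
  assumes c: "c \<in> A" and S: "open S"
    and w: "\<And>s t. s \<in> {0..T} \<Longrightarrow> t \<in> {0..T} \<Longrightarrow> dist (w s) (w t) \<le> M * \<bar>s - t\<bar>"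
    and sub: "w ` {0..T} \<subseteq> snd c ` (fst c \<inter> S) \<inter> ball x r" and T: "0 \<le> T" and C0: "0 \<le> C"
    and C: "\<And>q v. q \<in> fst c \<Longrightarrow> snd c q \<in> ball x r \<Longrightarrow> gnorm c q v \<le> C * norm v"
  shows "idist S (cinv c (w 0)) (cinv c (w T)) \<le> ereal (C * M * T)"
proof (cases "T = 0")
  case True
  then have "w 0 \<in> snd c ` (fst c \<inter> S)" using sub by auto
  then have "cinv c (w 0) \<in> S" using c by auto
  then show ?thesis using True idist_self[OF S] by (simp add: zero_ereal_def)
next
  case False
  then have "0 < T" using T by simp
  have "0 \<le> dist (w 0) (w T)" "dist (w 0) (w T) \<le> M * T" using w[of 0 T] T by auto
  then have M: "0 \<le> M" using \<open>0 < T\<close> by (metis order_trans zero_le_mult_iff not_less)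
  have "continuous_on {0..T} w"
  proof (rule continuous_on_iff[THEN iffD2], intro ballI allI impI)
    fix s e :: real assume s: "s \<in> {0..T}" and e: "0 < e"
    have "dist (w t) (w s) < e" if "t \<in> {0..T}" "dist t s < e / (M + 1)" for t
    proof -
      have "dist (w t) (w s) \<le> (M + 1) * \<bar>t - s\<bar>" using w[OF that(1) s] by (simp add: algebra_simps)
      also have "\<dots> < e" using that M by (simp add: dist_real_def pos_less_divide_eq mult.commute)
      finally show ?thesis .
    qed
    then show "\<exists>d>0. \<forall>t\<in>{0..T}. dist t s < d \<longrightarrow> dist (w t) (w s) < e"
      using e M by (intro exI[of _ "e / (M + 1)"]) auto
  qed
  then have comp: "compact (w ` {0..T})" by (intro compact_continuous_image) auto
  have op: "open (snd c ` (fst c \<inter> S) \<inter> ball x r)" using chart_image_open[OF c S] by auto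
  obtain e where e: "0 < e" "(\<Union>z\<in>w ` {0..T}. ball z e) \<subseteq> snd c ` (fst c \<inter> S) \<inter> ball x r"
    using compact_subset_open_imp_ball_epsilon_subset[OF comp op sub] by metis
  obtain n where n: "M * T / e < real n" using reals_Archimedean2 by blast
  define N where "N = Suc n"
  have N: "0 < N" "M * T < real N * e"
  proof -
    have "M * T < real n * e" using n e by (simp add: pos_divide_less_eq)
    also have "\<dots> \<le> real N * e" using e by (simp add: N_def)
    finally show "M * T < real N * e" .
  qed (simp add: N_def)
  define p where "p j = real j * T / real N" for j
  have p: "p j \<in> {0..T}" if "j \<le> N" for j
    using that N T by (auto simp: p_def field_simps mult_left_mono)
  have step: "idist S (cinv c (w (p j))) (cinv c (w (p (Suc j)))) \<le> ereal (C * M * T / real N)" if j: "Suc j \<le> N" for j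
  proof -
    have d: "\<bar>p j - p (Suc j)\<bar> = T / real N"
      using T by (simp add: p_def add_divide_distrib distrib_right)
    have "dist (w (p j)) (w (p (Suc j))) \<le> M * (T / real N)" using w[OF p p, of j "Suc j"] j d by simp
    then have dd: "norm (w (p (Suc j)) - w (p j)) \<le> M * (T / real N)" by (simp add: dist_norm norm_minus_commute)
    also have "M * (T / real N) < e" using N by (simp add: field_simps)
    finally have "w (p (Suc j)) \<in> ball (w (p j)) e" by (simp add: dist_norm norm_minus_commute)
    then have "idist S (cinv c (w (p j))) (cinv c (w (p (Suc j)))) \<le> ereal (C * norm (w (p (Suc j)) - w (p j)))"
    proof (intro idist_ball[OF c, of "w (p j)" e])
      have sb: "ball (w (p j)) e \<subseteq> snd c ` (fst c \<inter> S) \<inter> ball x r"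
        using p[of j] j by (intro order_trans[OF _ e(2)]) auto
      then show "ball (w (p j)) e \<subseteq> snd c ` (fst c \<inter> S)" by blast
      show "gnorm c q v \<le> C * norm v" if "q \<in> fst c" "snd c q \<in> ball (w (p j)) e" for q v
        using C that sb by blast
    qed (use e in auto)
    also have "C * norm (w (p (Suc j)) - w (p j)) \<le> C * (M * (T / real N))"
      using dd C0 by (rule mult_left_mono)
    finally show ?thesis by (simp add: mult_ac)
  qed
  have "idist S (cinv c (w 0)) (cinv c (w (p j))) \<le> ereal (real j * (C * M * T / real N))" if "j \<le> N" for j
    using that
  proof (induction j)
    case 0
    have "w 0 \<in> snd c ` (fst c \<inter> S)" using sub T by auto
    then have "cinv c (w 0) \<in> S" using c by auto
    then show ?case using idist_self[OF S] by (simp add: p_def zero_ereal_def)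
  next
    case (Suc j)
    have "idist S (cinv c (w 0)) (cinv c (w (p (Suc j))))
      \<le> idist S (cinv c (w 0)) (cinv c (w (p j))) + idist S (cinv c (w (p j))) (cinv c (w (p (Suc j))))"
      by (rule idist_triangle)
    also have "\<dots> \<le> ereal (real j * (C * M * T / real N)) + ereal (C * M * T / real N)"
      using Suc by (intro add_mono step) auto
    also have "\<dots> = ereal (real (Suc j) * (C * M * T / real N))"
    proof -
      have "x * K + K = (1 + x) * K" for x K :: real by (simp add: algebra_simps)
      then show ?thesis by (simp only: plus_ereal.simps of_nat_Suc)
    qed
    finally show ?case .
  qed
  from this[of N] show ?thesis using N by (simp add: p_def)
qed

end

section \<open>Interior and boundary of a submanifold\<close>

context riem_surface
begin

text \<open>
Near a point of positive first coordinate, the inverse of a half-plane chart is defined on an open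
subset of the plane. By invariance of domain, applied in a chart of the surface, it has open image.
\<close>

lemma boundary_chart_interior:
  fixes Y :: "'a set"
  assumes bc: "boundary_chart Y V \<phi>" and p: "p \<in> V" "0 < \<phi> p $ 1"
  shows "p \<in> interior Y"
proof -
  obtain c where c: "c \<in> A" "p \<in> fst c" using chart_cover by metis
  obtain \<psi> where \<psi>: "homeomorphism V (\<phi> ` V) \<phi> \<psi>" using bc by (auto simp: boundary_chart_def)
  let ?V = "{q \<in> V \<inter> fst c. 0 < \<phi> q $ 1}"
  have "openin (top_of_set V) (V \<inter> fst c)" using chart_open c by (simp add: openin_open_Int)
  then have "openin (top_of_set (\<phi> ` V)) (\<phi> ` (V \<inter> fst c))"
    by (rule homeomorphism_imp_open_map[OF \<psi>])
  then have "openin (top_of_set half_plane) (\<phi> ` (V \<inter> fst c))"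
    using bc openin_trans unfolding boundary_chart_def by blast
  then obtain W where W: "open W" "\<phi> ` (V \<inter> fst c) = half_plane \<inter> W" using openin_open by metis
  have "\<phi> ` ?V = \<phi> ` (V \<inter> fst c) \<inter> {v. 0 < v $ 1}" by auto
  also have "\<dots> = W \<inter> {v. 0 < v $ 1}" using W by (auto simp: half_plane_def)
  finally have eq: "\<phi> ` ?V = W \<inter> {v. 0 < v $ 1}" .
  have "open {v :: real ^ 2. 0 < v $ 1}" by (intro open_Collect_less continuous_intros)
  then have op: "open (\<phi> ` ?V)" unfolding eq using W by blast
  have inv: "\<psi> (\<phi> q) = q" if "q \<in> V" for q using \<psi> that by (simp add: homeomorphism_def)
  have \<psi>im: "\<psi> ` \<phi> ` ?V = ?V" using inv by force
  have "continuous_on (\<phi> ` ?V) (snd c \<circ> \<psi>)"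
  proof (rule continuous_on_compose)
    have "continuous_on (\<phi> ` V) \<psi>" using \<psi> by (simp add: homeomorphism_def)
    then show "continuous_on (\<phi> ` ?V) \<psi>" by (rule continuous_on_subset) auto
    show "continuous_on (\<psi> ` \<phi> ` ?V) (snd c)"
      unfolding \<psi>im by (rule continuous_on_subset[OF cont_chart[OF c(1)]]) auto
  qed
  moreover have "inj_on (snd c \<circ> \<psi>) (\<phi> ` ?V)"
  proof (rule comp_inj_on)
    show "inj_on \<psi> (\<phi> ` ?V)" using inv by (intro inj_on_inverseI[of _ \<phi>]) auto
    show "inj_on (snd c) (\<psi> ` \<phi> ` ?V)"
      unfolding \<psi>im using c(1) by (intro inj_on_inverseI[of _ "cinv c"]) auto
  qed
  ultimately have "open ((snd c \<circ> \<psi>) ` \<phi> ` ?V)" using op by (intro invariance_of_domain)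
  then have "open (snd c ` ?V)" using \<psi>im by (metis image_comp)
  then have "open {q \<in> fst c. snd c q \<in> snd c ` ?V}" by (rule chart_preimage_open[OF c(1)])
  moreover have "{q \<in> fst c. snd c q \<in> snd c ` ?V} \<subseteq> V"
  proof
    fix q assume "q \<in> {q \<in> fst c. snd c q \<in> snd c ` ?V}"
    then obtain q' where "q' \<in> V" "q' \<in> fst c" "q \<in> fst c" "snd c q = snd c q'" by blast
    then have "q = q'" using c(1) cinv_chart by metis
    then show "q \<in> V" using \<open>q' \<in> V\<close> by simp
  qed
  moreover have "V \<subseteq> Y" using bc openin_imp_subset unfolding boundary_chart_def by blast
  moreover have "p \<in> {q \<in> fst c. snd c q \<in> snd c ` ?V}" using p c by blast
  ultimately show ?thesis unfolding interior_def by blast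
qed

text \<open>
Otherwise the chart would map a neighbourhood of \<open>p\<close> in the surface onto an open subset of the plane,
by invariance of domain, and this subset would contain points of negative first coordinate.
\<close>

lemma interior_boundary_chart:
  fixes Y :: "'a set"
  assumes bc: "boundary_chart Y V \<phi>" and p: "p \<in> V" "p \<in> interior Y"
  shows "\<phi> p $ 1 \<noteq> 0"
proof
  assume z: "\<phi> p $ 1 = 0"
  obtain c where c: "c \<in> A" "p \<in> fst c" using chart_cover by metis
  obtain \<psi> where \<psi>: "homeomorphism V (\<phi> ` V) \<phi> \<psi>" using bc by (auto simp: boundary_chart_def)
  obtain W where W: "open W" "V = Y \<inter> W" using bc openin_open unfolding boundary_chart_def by metis
  define G where "G = interior Y \<inter> W"
  have G: "open G" "G \<subseteq> V" "p \<in> G" using W p interior_subset by (auto simp: G_def)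
  let ?D = "snd c ` (fst c \<inter> G)"
  have "open ?D" by (rule chart_image_open[OF c(1) G(1)])
  moreover have im: "cinv c ` ?D = fst c \<inter> G"
    using c(1) by (force simp: image_iff)
  moreover have "continuous_on ?D (\<phi> \<circ> cinv c)"
  proof (rule continuous_on_compose)
    show "continuous_on ?D (cinv c)" by (rule continuous_on_subset[OF cont_cinv[OF c(1)]]) auto
    have "continuous_on V \<phi>" using \<psi> by (simp add: homeomorphism_def)
    then show "continuous_on (cinv c ` ?D) \<phi>" unfolding im by (rule continuous_on_subset) (use G in auto)
  qed
  moreover have "inj_on (\<phi> \<circ> cinv c) ?D"
  proof (rule comp_inj_on)
    show "inj_on (cinv c) ?D" using c(1) by (intro inj_on_inverseI[of _ "snd c"]) auto
    show "inj_on \<phi> (cinv c ` ?D)" unfolding im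
      by (rule inj_on_inverseI[of _ \<psi>]) (use \<psi> G in \<open>auto simp: homeomorphism_def\<close>)
  qed
  ultimately have "open ((\<phi> \<circ> cinv c) ` ?D)" by (intro invariance_of_domain)
  then have "open (\<phi> ` (fst c \<inter> G))" using im by (metis image_comp)
  moreover have "\<phi> p \<in> \<phi> ` (fst c \<inter> G)" using c G by blast
  ultimately obtain e where e: "0 < e" "ball (\<phi> p) e \<subseteq> \<phi> ` (fst c \<inter> G)" by (rule openE)
  have "\<phi> ` V \<subseteq> half_plane" using bc openin_imp_subset unfolding boundary_chart_def by blast
  then have "ball (\<phi> p) e \<subseteq> half_plane" using e G by blast
  moreover have "\<phi> p - (e / 2) *\<^sub>R axis 1 1 \<in> ball (\<phi> p) e" using e by (simp add: dist_norm)
  ultimately have "0 \<le> (\<phi> p - (e / 2) *\<^sub>R axis 1 1) $ 1" unfolding half_plane_def by blast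
  then show False using z e by simp
qed

lemma manifold_interior_eq:
  fixes Y :: "'a set"
  assumes "C0_submanifold Y" shows "manifold_interior Y = interior Y"
proof (intro set_eqI iffI)
  fix p assume "p \<in> manifold_interior Y"
  then have p: "p \<in> Y" "p \<notin> manifold_boundary Y" by (auto simp: manifold_interior_def)
  then obtain V \<phi> where V: "p \<in> V" "boundary_chart Y V \<phi>" using assms by (auto simp: C0_submanifold_def)
  then have "\<phi> p $ 1 \<noteq> 0" using p by (auto simp: manifold_boundary_def)
  moreover have "\<phi> p \<in> half_plane" using V openin_imp_subset unfolding boundary_chart_def by blast
  ultimately have "0 < \<phi> p $ 1" by (simp add: half_plane_def)
  then show "p \<in> interior Y" using boundary_chart_interior V by blast
next
  fix p assume p: "p \<in> interior Y"
  then have "p \<notin> manifold_boundary Y" using interior_boundary_chart by (auto simp: manifold_boundary_def)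
  then show "p \<in> manifold_interior Y" using p interior_subset by (auto simp: manifold_interior_def)
qed

lemma manifold_boundary_subset: "manifold_boundary Y \<subseteq> Y"
  unfolding manifold_boundary_def boundary_chart_def using openin_imp_subset by blast

end

section \<open>Crossing a family of arcs in a half disc\<close>

definition half_disc :: "real \<Rightarrow> complex set" where
  "half_disc e = {z. 0 \<le> Re z \<and> cmod z \<le> e}"

lemma compact_half_disc: "compact (half_disc e)"
proof -
  have "half_disc e = cball 0 e \<inter> {z. 0 \<le> Re z}" by (auto simp: half_disc_def)
  moreover have "closed {z. 0 \<le> Re z}" by (intro closed_Collect_le continuous_intros)
  ultimately show ?thesis by (simp add: compact_Int_closed)
qed

text \<open>
Think of \<open>h\<close> as the distance from the boundary point \<open>0\<close> in another chart, and of \<open>F\<close> as the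
arcs of a circle inside the half disc, distributed into two families \<open>A\<close> and \<open>B\<close>. Let \<open>L\<close> be the
diameter of the half disc. If \<open>P\<close> avoids \<open>B\<close> and \<open>Q\<close> avoids \<open>A\<close>, neither \<open>B \<union> L\<close> nor \<open>A \<union> L\<close>
separates \<open>p\<close> from the outside. These sets have the connected intersection \<open>L\<close>, so by Janiszewski's
theorem their union does not separate either, although it contains the whole level set of \<open>h\<close>.
\<close>

lemma half_disc_crossing:
  fixes h :: "complex \<Rightarrow> real"
  assumes h: "continuous_on (half_disc e) h" and e: "0 < \<delta>" "\<delta> \<le> e"
    and inner: "\<And>z. z \<in> half_disc e \<Longrightarrow> cmod z < \<delta> \<Longrightarrow> h z < r"
    and outer: "\<And>z. z \<in> half_disc e \<Longrightarrow> cmod z = e \<Longrightarrow> r < h z"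
  defines "F \<equiv> {z \<in> half_disc e. 0 < Re z \<and> h z = r}"
  assumes oA: "openin (top_of_set F) A" and oB: "openin (top_of_set F) B"
    and AB: "A \<union> B = F" "A \<inter> B = {}"
    and P: "connected P" "P \<subseteq> {z \<in> half_disc e. 0 < Re z}" "p \<in> P" "cmod p < \<delta>" "p' \<in> P" "cmod p' = e"
    and Q: "connected Q" "Q \<subseteq> {z \<in> half_disc e. 0 < Re z}" "q \<in> Q" "cmod q < \<delta>" "q' \<in> Q" "cmod q' = e"
  shows "P \<inter> B \<noteq> {} \<or> Q \<inter> A \<noteq> {}"
proof (rule ccontr)
  assume "\<not> ?thesis"
  then have PB: "P \<inter> B = {}" and QA: "Q \<inter> A = {}" by auto
  define L where "L = {z. Re z = 0 \<and> cmod z \<le> e}"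
  have Leq: "L = half_disc e \<inter> {z. Re z = 0}" by (auto simp: L_def half_disc_def)
  have clRe: "closed {z. Re z = 0}" by (intro closed_Collect_eq continuous_intros)
  have compL: "compact L" unfolding Leq by (intro compact_Int_closed compact_half_disc clRe)
  have "convex {z. Re z = 0}"
    by (rule convexI) simp
  moreover have "L = cball 0 e \<inter> {z. Re z = 0}" by (auto simp: L_def)
  ultimately have connL: "connected L" by (simp add: convex_Int convex_connected)
  have level: "closed {z \<in> half_disc e. h z = r}"
  proof -
    have "closedin (top_of_set (half_disc e)) {z \<in> half_disc e. h z = r}"
      using continuous_closedin_preimage[OF h, of "{r}"] by (simp add: vimage_def Int_def)
    then show ?thesis using closedin_closed_trans compact_imp_closed[OF compact_half_disc] by blast
  qed
  have clFL: "closed (F \<union> L)"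
  proof -
    have "F \<union> L = {z \<in> half_disc e. h z = r} \<union> L" by (auto simp: F_def L_def half_disc_def)
    then show ?thesis using level compact_imp_closed[OF compL] by (simp add: closed_Un)
  qed
  have FLH: "F \<union> L \<subseteq> half_disc e" by (auto simp: F_def Leq)
  have comp: "compact (A' \<union> L)"
    if o: "openin (top_of_set F) B'" and u: "A' \<union> B' = F" "A' \<inter> B' = {}" for A' B'
  proof -
    obtain W where W: "open W" "B' = F \<inter> W" using o openin_open by metis
    have "A' \<union> L = (F \<union> L) - (W \<inter> {z. 0 < Re z})"
      using W(2) u by (auto simp: F_def L_def)
    moreover have "open (W \<inter> {z. 0 < Re z})" using W by (intro open_Int open_Collect_less continuous_intros)
    ultimately have "closed (A' \<union> L)" using clFL by (simp add: closed_Diff)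
    moreover have "A' \<union> L \<subseteq> half_disc e" using u FLH by blast
    ultimately show ?thesis by (metis compact_half_disc closed_Int_compact inf.absorb1)
  qed
  have compA: "compact (A \<union> L)" by (rule comp[OF oB AB])
  have compB: "compact (B \<union> L)" by (rule comp[OF oA]) (use AB in auto)
  define E where "E = {z. 0 < Re z \<and> e \<le> cmod z}"
  define b where "b = complex_of_real e"
  have be: "b \<in> E" using e by (simp add: b_def E_def)
  have bH: "b \<in> half_disc e" "cmod b = e" using e by (auto simp: b_def half_disc_def)
  have disjE: "E \<inter> F = {}" using outer by (force simp: E_def F_def half_disc_def)
  have disjL: "S \<inter> L = {}" if "S \<subseteq> {z. 0 < Re z}" for S using that by (auto simp: L_def)
  \<comment> \<open>Every point of \<open>E\<close> is joined within \<open>E\<close> to a half plane by a horizontal ray.\<close>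
  have connE: "connected E"
  proof -
    have "\<exists>C. connected C \<and> C \<subseteq> E \<and> z \<in> C \<and> {z. e \<le> Re z} \<subseteq> C" if z: "z \<in> E" for z
    proof -
      let ?R = "(\<lambda>s. z + complex_of_real s) ` {0..}"
      have "connected ?R" by (intro connected_continuous_image continuous_intros) auto
      moreover have "z + complex_of_real e \<in> ?R \<inter> {z. e \<le> Re z}" using z e by (auto simp: E_def)
      moreover have "connected {z. e \<le> Re z}"
        by (intro convex_connected convex_halfspace_Re_ge)
      ultimately have "connected (?R \<union> {z. e \<le> Re z})" by (intro connected_Un) auto
      moreover have "?R \<subseteq> E"
      proof
        fix w assume "w \<in> ?R"
        then obtain s where s: "0 \<le> s" "w = z + complex_of_real s" by auto
        have "\<bar>Re z\<bar> \<le> \<bar>Re w\<bar>" "Im w = Im z" using s z by (auto simp: E_def)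
        then have "cmod z \<le> cmod w" by (simp add: cmod_def power2_le_iff_abs_le power_mono abs_le_square_iff)
        then show "w \<in> E" using z s by (auto simp: E_def)
      qed
      moreover have "{z. e \<le> Re z} \<subseteq> E"
        using e complex_Re_le_cmod order_trans by (fastforce simp: E_def)
      moreover have "z \<in> ?R" by (rule image_eqI[of _ _ 0]) auto
      ultimately show ?thesis by (intro exI[of _ "?R \<union> {z. e \<le> Re z}"]) auto
    qed
    note ex = this
    have "b \<in> {z. e \<le> Re z}" by (simp add: b_def)
    with ex have "connected_component E z b" if "z \<in> E" for z
      using that unfolding connected_component_def by (metis subsetD)
    then show ?thesis
      unfolding connected_iff_connected_component by (meson connected_component_sym connected_component_trans)
  qed
  have "p' \<in> E" "q' \<in> E" using P Q by (auto simp: E_def)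
  have disj: "P \<inter> L = {}" "Q \<inter> L = {}" "E \<inter> L = {}"
    by (rule disjL; use P Q in \<open>auto simp: E_def\<close>)+
  have cB: "connected_component (- (B \<union> L)) p b"
    unfolding connected_component_def
  proof (intro exI[of _ "P \<union> E"] conjI)
    show "connected (P \<union> E)" by (rule connected_Un) (use P connE \<open>p' \<in> E\<close> in auto)
    show "P \<union> E \<subseteq> - (B \<union> L)" using PB disjE AB disj by blast
  qed (use P be in auto)
  define D where "D = {z. 0 < Re z \<and> cmod z < \<delta>}"
  have "D = ball 0 \<delta> \<inter> {z. Re z > 0}" by (auto simp: D_def)
  then have "connected D" by (simp add: convex_Int convex_connected convex_halfspace_Re_gt)
  have "D \<inter> F = {}" using inner by (force simp: D_def F_def)
  have disjD: "D \<inter> L = {}" by (rule disjL) (auto simp: D_def)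
  have "p \<in> D" "q \<in> D" using P Q by (auto simp: D_def)
  have cA: "connected_component (- (A \<union> L)) p b"
    unfolding connected_component_def
  proof (intro exI[of _ "D \<union> (Q \<union> E)"] conjI)
    have "connected (Q \<union> E)" by (rule connected_Un) (use Q connE \<open>q' \<in> E\<close> in auto)
    then show "connected (D \<union> (Q \<union> E))"
      by (rule connected_Un[OF \<open>connected D\<close>]) (use Q \<open>q \<in> D\<close> in auto)
    show "D \<union> (Q \<union> E) \<subseteq> - (A \<union> L)"
      using QA disjE AB disj disjD \<open>D \<inter> F = {}\<close> by blast
  qed (use \<open>p \<in> D\<close> be in auto)
  have "(A \<union> L) \<inter> (B \<union> L) = L" using AB by blast
  then have "connected ((A \<union> L) \<inter> (B \<union> L))" using connL by simp
  from Janiszewski[OF compA compact_imp_closed[OF compB] this cA cB]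
  obtain C where C: "connected C" "C \<subseteq> - ((A \<union> L) \<union> (B \<union> L))" "p \<in> C" "b \<in> C"
    unfolding connected_component_def by blast
  then have CF: "C \<inter> F = {}" "C \<inter> L = {}" using AB by auto
  \<comment> \<open>Outside \<open>F \<union> L\<close> the open set \<open>O1\<close> coincides with the closed set \<open>G\<close>, so that \<open>C\<close> cannot
     leave it.\<close>
  define O1 where "O1 = {z. 0 < Re z \<and> cmod z < e \<and> h z < r}"
  define G where "G = {z \<in> half_disc e. h z \<le> r}"
  have clG: "closed G"
  proof -
    have "closedin (top_of_set (half_disc e)) G"
      using continuous_closedin_preimage[OF h, of "{..r}"] by (simp add: vimage_def Int_def G_def)
    then show ?thesis using closedin_closed_trans compact_imp_closed[OF compact_half_disc] by blast
  qed
  have opO: "open O1"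
  proof -
    have o: "open {z. 0 < Re z \<and> cmod z < e}" by (intro open_Collect_conj open_Collect_less continuous_intros)
    have "continuous_on {z. 0 < Re z \<and> cmod z < e} h"
      by (rule continuous_on_subset[OF h]) (auto simp: half_disc_def)
    from continuous_open_preimage[OF this o, of "{..<r}"]
    have "open ({z. 0 < Re z \<and> cmod z < e} \<inter> h -` {..<r})" by simp
    moreover have "{z. 0 < Re z \<and> cmod z < e} \<inter> h -` {..<r} = O1" by (auto simp: O1_def)
    ultimately show ?thesis by simp
  qed
  have "C \<subseteq> O1 \<union> - G"
  proof
    fix z assume z: "z \<in> C"
    show "z \<in> O1 \<union> - G"
    proof (cases "z \<in> G")
      case True
      then have zH: "0 \<le> Re z" "cmod z \<le> e" "h z \<le> r" "z \<in> half_disc e" by (auto simp: G_def half_disc_def)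
      have "z \<notin> L" "z \<notin> F" using z CF by auto
      then have "0 < Re z" using zH by (auto simp: L_def)
      then have "h z \<noteq> r" using \<open>z \<notin> F\<close> zH by (auto simp: F_def)
      moreover have "cmod z \<noteq> e" using outer[OF zH(4)] zH by auto
      ultimately show ?thesis using zH \<open>0 < Re z\<close> by (auto simp: O1_def)
    qed simp
  qed
  moreover have "O1 \<subseteq> G" by (auto simp: O1_def G_def half_disc_def)
  ultimately have "O1 \<inter> C = {} \<or> - G \<inter> C = {}"
    using connectedD[OF C(1) opO open_Compl[OF clG]] by blast
  moreover have "p \<in> O1" using P inner e by (force simp: O1_def)
  moreover have "b \<in> - G" using outer[OF bH] by (auto simp: G_def)
  ultimately show False using C by blast
qed

text \<open>
Two points of a circle around \<open>0\<close> are related if one of the arcs between them, possibly with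
several turns, lies in \<open>S\<close>. Admitting several turns makes the relation transitive; superfluous turns
are removed in the lemma \<open>circ_arc_short\<close>.
\<close>

definition circ_arc :: "complex set \<Rightarrow> complex \<Rightarrow> complex \<Rightarrow> bool" where
  "circ_arc S u w \<longleftrightarrow> (\<exists>t. w = u * cis t \<and> (\<forall>s\<in>closed_segment 0 t. u * cis s \<in> S))"

lemma circ_arc_refl: "u \<in> S \<Longrightarrow> circ_arc S u u"
  unfolding circ_arc_def by (rule exI[of _ 0]) simp

lemma circ_arc_trans:
  assumes "circ_arc S u v" "circ_arc S v w" shows "circ_arc S u w"
proof -
  obtain t1 where t1: "v = u * cis t1" "\<And>s. s \<in> closed_segment 0 t1 \<Longrightarrow> u * cis s \<in> S"
    using assms(1) unfolding circ_arc_def by blast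
  obtain t2 where t2: "w = v * cis t2" "\<And>s. s \<in> closed_segment 0 t2 \<Longrightarrow> v * cis s \<in> S"
    using assms(2) unfolding circ_arc_def by blast
  have "u * cis s \<in> S" if s: "s \<in> closed_segment 0 (t1 + t2)" for s
  proof (cases "s \<in> closed_segment 0 t1")
    case False
    then have "s - t1 \<in> closed_segment 0 t2"
      using s by (auto simp: closed_segment_eq_real_ivl split: if_splits)
    then have "v * cis (s - t1) \<in> S" by (rule t2)
    then show ?thesis by (simp add: t1 mult.assoc cis_mult)
  qed (use t1 in auto)
  then show ?thesis unfolding circ_arc_def
    by (intro exI[of _ "t1 + t2"]) (simp add: t1 t2 mult.assoc cis_mult)
qed

lemma circ_arc_sym:
  assumes "circ_arc S u w" shows "circ_arc S w u"
proof -
  obtain t where t: "w = u * cis t" "\<And>s. s \<in> closed_segment 0 t \<Longrightarrow> u * cis s \<in> S"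
    using assms unfolding circ_arc_def by blast
  have "w * cis s \<in> S" if "s \<in> closed_segment 0 (- t)" for s
  proof -
    have "t + s \<in> closed_segment 0 t" using that by (auto simp: closed_segment_eq_real_ivl split: if_splits)
    from t(2)[OF this] show ?thesis by (simp add: t(1) mult.assoc cis_mult)
  qed
  then show ?thesis unfolding circ_arc_def
    by (intro exI[of _ "- t"]) (simp add: t(1) mult.assoc cis_mult)
qed

lemma circ_arc_short:
  assumes "circ_arc S u w"
  obtains t where "0 \<le> t" "t \<le> 2 * pi" "w = u * cis t" "\<And>s. s \<in> {0..t} \<Longrightarrow> u * cis s \<in> S"
  | t where "0 \<le> t" "t \<le> 2 * pi" "u = w * cis t" "\<And>s. s \<in> {0..t} \<Longrightarrow> w * cis s \<in> S"
proof -
  have *: "\<exists>t. 0 \<le> t \<and> t \<le> 2 * pi \<and> w = u * cis t \<and> (\<forall>s\<in>{0..t}. u * cis s \<in> S)"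
    if "w = u * cis t" "\<And>s. s \<in> closed_segment 0 t \<Longrightarrow> u * cis s \<in> S" "0 \<le> t" for t u w
  proof -
    define n where "n = \<lfloor>t / (2 * pi)\<rfloor>"
    define t' where "t' = t - 2 * pi * of_int n"
    have n0: "0 \<le> n" using that(3) by (simp add: n_def)
    have "of_int n \<le> t / (2 * pi)" "t / (2 * pi) < of_int n + 1" by (auto simp: n_def)
    then have "of_int n * (2 * pi) \<le> t" "t < (of_int n + 1) * (2 * pi)"
      by (simp_all add: pos_le_divide_eq pos_divide_less_eq)
    then have "0 \<le> t'" "t' \<le> 2 * pi" by (auto simp: t'_def algebra_simps)
    moreover have "t' \<le> t" using n0 by (simp add: t'_def)
    moreover have "cis t = cis t'"
      by (simp add: t'_def cis_divide[symmetric] cis_multiple_2pi)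
    ultimately show ?thesis using that by (intro exI[of _ t']) (auto simp: closed_segment_eq_real_ivl)
  qed
  obtain t where t: "w = u * cis t" "\<And>s. s \<in> closed_segment 0 t \<Longrightarrow> u * cis s \<in> S"
    using assms unfolding circ_arc_def by blast
  show ?thesis
  proof (cases "0 \<le> t")
    case True
    then show ?thesis using *[OF t] that(1) by blast
  next
    case False
    have "u = w * cis (- t)" by (simp add: t(1) mult.assoc cis_mult)
    moreover have "w * cis s \<in> S" if "s \<in> closed_segment 0 (- t)" for s
    proof -
      have "t + s \<in> closed_segment 0 t" using that by (auto simp: closed_segment_eq_real_ivl split: if_splits)
      from t(2)[OF this] show ?thesis by (simp add: t(1) mult.assoc cis_mult)
    qed
    ultimately show ?thesis using *[of u w "- t"] False that(2) by auto
  qed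
qed

lemma circ_arc_near:
  assumes "open S" "w \<in> S" "cmod w = r" "0 < r"
  obtains d where "0 < d" "\<And>w'. cmod w' = r \<Longrightarrow> w' \<in> ball w d \<Longrightarrow> circ_arc S w w'"
proof -
  have "continuous (at 0) (\<lambda>s. w * cis s)"
    unfolding cis_conv_exp by (intro continuous_intros)
  moreover obtain e0 where e0: "0 < e0" "ball w e0 \<subseteq> S" using assms(1,2) openE by blast
  ultimately have "\<exists>e>0. \<forall>s. dist s 0 < e \<longrightarrow> dist (w * cis s) (w * cis 0) < e0"
    unfolding continuous_at_eps_delta by blast
  then obtain e where e0': "0 < e" "\<forall>s. dist s 0 < e \<longrightarrow> dist (w * cis s) (w * cis 0) < e0" by blast
  have e: "w * cis s \<in> S" if "dist s 0 < e" for s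
  proof -
    have "dist w (w * cis s) < e0" using e0'(2) that by (simp add: dist_commute)
    then show ?thesis using e0(2) by auto
  qed
  have "continuous (at 1) Arg" by (rule continuous_at_Arg) simp
  then obtain d where d: "0 < d" "\<And>z. dist z 1 < d \<Longrightarrow> dist (Arg z) (Arg 1) < e"
    using e0'(1) unfolding continuous_at_eps_delta by blast
  show ?thesis
  proof (rule that[of "d * r"])
    show "0 < d * r" using d assms by simp
    fix w' assume w': "cmod w' = r" "w' \<in> ball w (d * r)"
    have wn: "w \<noteq> 0" using assms by auto
    have nz: "cmod (w' / w) = 1" using w' assms by (simp add: norm_divide)
    have "w' / w - 1 = (w' - w) / w" using wn by (simp add: field_simps)
    then have "dist (w' / w) 1 = cmod (w' - w) / r" using assms by (simp add: dist_norm norm_divide)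
    also have "\<dots> < d" using w' assms by (simp add: dist_norm norm_minus_commute pos_divide_less_eq)
    finally have a: "\<bar>Arg (w' / w)\<bar> < e" using d(2) by fastforce
    have "cis (Arg (w' / w)) = w' / w" using nz cis_Arg[of "w' / w"] by (metis norm_zero sgn_div_norm zero_neq_one divide_self_if inverse_1 scaleR_one)
    then have "w' = w * cis (Arg (w' / w))" using wn by simp
    moreover have "w * cis s \<in> S" if "s \<in> closed_segment 0 (Arg (w' / w))" for s
      using that a by (intro e) (auto simp: closed_segment_eq_real_ivl split: if_splits)
    ultimately show "circ_arc S w w'" unfolding circ_arc_def by blast
  qed
qed

lemma openin_circ_arc:
  assumes "open S" "0 < r"
  shows "openin (top_of_set (sphere 0 r \<inter> S)) {w \<in> sphere 0 r \<inter> S. \<exists>u\<in>X. circ_arc S u w}" (is "openin _ ?A")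
    "openin (top_of_set (sphere 0 r \<inter> S)) {w \<in> sphere 0 r \<inter> S. \<not> (\<exists>u\<in>X. circ_arc S u w)}" (is "openin _ ?B")
proof -
  have near: "\<exists>d>0. \<forall>w'\<in>sphere 0 r \<inter> S. dist w' w < d \<longrightarrow> circ_arc S w w'" if "w \<in> sphere 0 r \<inter> S" for w
  proof -
    have w: "w \<in> S" "cmod w = r" using that by auto
    obtain d where "0 < d" "\<And>w'. cmod w' = r \<Longrightarrow> w' \<in> ball w d \<Longrightarrow> circ_arc S w w'"
      by (rule circ_arc_near[OF assms(1) w assms(2)]) blast
    then show ?thesis by (intro exI[of _ d]) (simp add: dist_commute)
  qed
  show "openin (top_of_set (sphere 0 r \<inter> S)) ?A" unfolding openin_euclidean_subtopology_iff
  proof (intro conjI ballI)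
    fix w assume w: "w \<in> ?A"
    then obtain d where "0 < d" "\<forall>w'\<in>sphere 0 r \<inter> S. dist w' w < d \<longrightarrow> circ_arc S w w'" using near by blast
    with w show "\<exists>d>0. \<forall>w'\<in>sphere 0 r \<inter> S. dist w' w < d \<longrightarrow> w' \<in> ?A" using circ_arc_trans by blast
  qed auto
  show "openin (top_of_set (sphere 0 r \<inter> S)) ?B" unfolding openin_euclidean_subtopology_iff
  proof (intro conjI ballI)
    fix w assume w: "w \<in> ?B"
    then obtain d where "0 < d" "\<forall>w'\<in>sphere 0 r \<inter> S. dist w' w < d \<longrightarrow> circ_arc S w w'" using near by blast
    with w show "\<exists>d>0. \<forall>w'\<in>sphere 0 r \<inter> S. dist w' w < d \<longrightarrow> w' \<in> ?B" using circ_arc_trans circ_arc_sym by blast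
  qed auto
qed

lemma dist_cis_le: "dist (cis s) (cis t) \<le> \<bar>s - t\<bar>"
proof -
  have "cis s - cis t = cis t * (cis (s - t) - 1)" by (simp add: algebra_simps cis_mult)
  then have "dist (cis s) (cis t) = cmod (cis (s - t) - 1)" by (simp add: dist_norm norm_mult)
  also have "\<dots> = 2 * \<bar>sin ((s - t) / 2)\<bar>" using dist_exp_i_1[of "s - t"] by (simp add: cis_conv_exp)
  also have "\<dots> \<le> 2 * \<bar>(s - t) / 2\<bar>" by (intro mult_left_mono abs_sin_x_le_abs_x) auto
  finally show ?thesis by simp
qed

section \<open>Curves ending near a boundary point\<close>

text \<open>
Janiszewski's theorem lives in the complex plane, charts take values in \<open>real ^ 2\<close>.
\<close>

definition plane_of :: "complex \<Rightarrow> real ^ 2" where "plane_of z = vector [Re z, Im z]"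
definition complex_of :: "real ^ 2 \<Rightarrow> complex" where "complex_of v = Complex (v $ 1) (v $ 2)"

lemma plane_of_nth [simp]: "plane_of z $ 1 = Re z" "plane_of z $ 2 = Im z"
  by (simp_all add: plane_of_def)

lemma plane_complex [simp]: "plane_of (complex_of v) = v" "complex_of (plane_of z) = z"
  by (simp_all add: complex_of_def vec_eq_iff forall_2)

lemma norm_complex_of: "cmod (complex_of v) = norm v"
  by (simp add: complex_of_def cmod_def norm_vec_def L2_set_def sum_2)

lemma norm_plane_of: "norm (plane_of z) = cmod z"
  using norm_complex_of[of "plane_of z"] by simp

lemma plane_of_diff: "plane_of (x - y) = plane_of x - plane_of y"
  and complex_of_diff: "complex_of (v - w) = complex_of v - complex_of w"
  by (simp_all add: vec_eq_iff forall_2 complex_of_def complex_eq_iff)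

lemma dist_plane_of: "dist (plane_of x) (plane_of y) = dist x y"
  by (simp add: dist_norm norm_plane_of flip: plane_of_diff)

lemma dist_complex_of: "dist (complex_of v) (complex_of w) = dist v w"
  by (simp add: dist_norm norm_complex_of flip: complex_of_diff)

lemma continuous_on_plane_of: "continuous_on S plane_of"
  unfolding continuous_on_iff by (auto simp: dist_plane_of)

lemma continuous_on_complex_of: "continuous_on S complex_of"
  unfolding continuous_on_iff by (auto simp: dist_complex_of)

context riem_surface
begin

text \<open>
The half disc is taken to be closed because, by compactness, a continuous injection on it is a
homeomorphism onto its image.
\<close>

lemma half_disc_chart:
  fixes Y :: "'a set"
  assumes y: "y \<in> manifold_boundary Y" and N: "open N" "y \<in> N"
  obtains e \<theta> where "0 < e" "continuous_on (half_disc e) \<theta>" "inj_on \<theta> (half_disc e)" "\<theta> 0 = y"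
    "\<theta> ` half_disc e \<subseteq> Y \<inter> N"
    "\<And>z. z \<in> half_disc e \<Longrightarrow> \<theta> z \<in> interior Y \<longleftrightarrow> 0 < Re z"
    "openin (top_of_set Y) (\<theta> ` {z \<in> half_disc e. cmod z < e})"
proof -
  obtain V \<phi> where V: "y \<in> V" "boundary_chart Y V \<phi>" "\<phi> y $ 1 = 0"
    using y unfolding manifold_boundary_def by blast
  have oV: "openin (top_of_set Y) V" using V by (simp add: boundary_chart_def)
  then have VY: "V \<subseteq> Y" by (rule openin_imp_subset)
  obtain \<psi> where \<psi>: "homeomorphism V (\<phi> ` V) \<phi> \<psi>" using V by (auto simp: boundary_chart_def)
  have inv: "\<psi> (\<phi> q) = q" if "q \<in> V" for q using \<psi> that by (simp add: homeomorphism_def)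
  have "openin (top_of_set V) (V \<inter> N)" using N by (simp add: openin_open_Int)
  then have "openin (top_of_set (\<phi> ` V)) (\<phi> ` (V \<inter> N))" by (rule homeomorphism_imp_open_map[OF \<psi>])
  then have "openin (top_of_set half_plane) (\<phi> ` (V \<inter> N))"
    using V(2) openin_trans unfolding boundary_chart_def by blast
  then obtain W where W: "open W" "\<phi> ` (V \<inter> N) = half_plane \<inter> W" using openin_open by metis
  have "\<phi> y \<in> W" using W V(1) N by blast
  then obtain e where e: "0 < e" "cball (\<phi> y) e \<subseteq> W" using W(1) open_contains_cball by metis
  define \<tau> where "\<tau> z = \<phi> y + plane_of z" for z
  have \<tau>1: "\<tau> z $ 1 = Re z" for z using V by (simp add: \<tau>_def)
  have d\<tau>: "dist (\<phi> y) (\<tau> z) = cmod z" for z by (simp add: \<tau>_def dist_norm norm_plane_of)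
  have \<tau>H: "\<tau> z \<in> \<phi> ` (V \<inter> N)" if "z \<in> half_disc e" for z
  proof -
    have "\<tau> z \<in> half_plane" using that \<tau>1 by (simp add: half_plane_def half_disc_def)
    moreover have "\<tau> z \<in> W" using that d\<tau> e(2) by (auto simp: half_disc_def)
    ultimately show ?thesis using W by blast
  qed
  define \<theta> where "\<theta> z = \<psi> (\<tau> z)" for z
  have \<theta>: "\<theta> z \<in> V \<inter> N \<and> \<phi> (\<theta> z) = \<tau> z" if z: "z \<in> half_disc e" for z
  proof -
    obtain q where "q \<in> V \<inter> N" "\<tau> z = \<phi> q" using \<tau>H[OF z] by blast
    then show ?thesis using inv by (simp add: \<theta>_def)
  qed
  show ?thesis
  proof (rule that[of e \<theta>])
    show "0 < e" by fact
    have "continuous_on (half_disc e) \<tau>" unfolding \<tau>_def by (intro continuous_intros continuous_on_plane_of)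
    moreover have "continuous_on (\<phi> ` V) \<psi>" using \<psi> by (simp add: homeomorphism_def)
    moreover have "\<tau> ` half_disc e \<subseteq> \<phi> ` V" using \<tau>H by blast
    ultimately show "continuous_on (half_disc e) \<theta>" unfolding \<theta>_def by (metis continuous_on_compose2)
    show "inj_on \<theta> (half_disc e)"
    proof (rule inj_on_inverseI)
      fix z assume z: "z \<in> half_disc e"
      have "complex_of (\<tau> z - \<phi> y) = z" by (simp add: \<tau>_def)
      then show "(\<lambda>q. complex_of (\<phi> q - \<phi> y)) (\<theta> z) = z" using \<theta>[OF z] by simp
    qed
    have "\<tau> 0 = \<phi> y" using d\<tau>[of 0] by simp
    then show "\<theta> 0 = y" using inv V(1) by (simp add: \<theta>_def)
    show "\<theta> ` half_disc e \<subseteq> Y \<inter> N" using \<theta> VY by blast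
    show "\<theta> z \<in> interior Y \<longleftrightarrow> 0 < Re z" if z: "z \<in> half_disc e" for z
    proof
      assume "\<theta> z \<in> interior Y"
      then have "\<phi> (\<theta> z) $ 1 \<noteq> 0" using interior_boundary_chart[OF V(2)] \<theta>[OF z] by blast
      then show "0 < Re z" using \<theta>[OF z] \<tau>1 z by (auto simp: half_disc_def)
    next
      assume "0 < Re z"
      then show "\<theta> z \<in> interior Y" using boundary_chart_interior[OF V(2)] \<theta>[OF z] \<tau>1 by simp
    qed
    have "\<theta> ` {z \<in> half_disc e. cmod z < e} = V \<inter> \<phi> -` ball (\<phi> y) e"
    proof (intro set_eqI iffI)
      fix q assume "q \<in> \<theta> ` {z \<in> half_disc e. cmod z < e}"
      then show "q \<in> V \<inter> \<phi> -` ball (\<phi> y) e" using \<theta> d\<tau> by auto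
    next
      fix q assume q: "q \<in> V \<inter> \<phi> -` ball (\<phi> y) e"
      let ?z = "complex_of (\<phi> q - \<phi> y)"
      have tz: "\<tau> ?z = \<phi> q" by (simp add: \<tau>_def)
      have "\<phi> q \<in> half_plane" using V(2) q openin_imp_subset unfolding boundary_chart_def by blast
      then have "0 \<le> Re ?z" using \<tau>1[of ?z] tz by (simp add: half_plane_def)
      moreover have "cmod ?z < e" using d\<tau>[of ?z] tz q by simp
      ultimately have "?z \<in> {z \<in> half_disc e. cmod z < e}" by (simp add: half_disc_def)
      moreover have "\<theta> ?z = q" using tz inv q by (simp add: \<theta>_def)
      ultimately show "q \<in> \<theta> ` {z \<in> half_disc e. cmod z < e}" by (metis image_eqI)
    qed
    moreover have "continuous_on V \<phi>" using \<psi> by (simp add: homeomorphism_def)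
    then have "openin (top_of_set V) (V \<inter> \<phi> -` ball (\<phi> y) e)"
      by (rule continuous_openin_preimage_gen) simp
    ultimately show "openin (top_of_set Y) (\<theta> ` {z \<in> half_disc e. cmod z < e})"
      using oV openin_trans by metis
  qed
qed

text \<open>
The part of a curve up to its first exit from the image of the half disc is pulled back, which
gives a connected set as it is required in \<open>half_disc_crossing\<close>.
\<close>

lemma half_disc_exit:
  fixes Y :: "'a set" and \<theta> :: "complex \<Rightarrow> 'a"
  assumes \<theta>: "continuous_on (half_disc e) \<theta>" "homeomorphism (half_disc e) (\<theta> ` half_disc e) \<theta> \<theta>'"
    and int: "\<And>z. z \<in> half_disc e \<Longrightarrow> \<theta> z \<in> interior Y \<longleftrightarrow> 0 < Re z"
    and op: "openin (top_of_set Y) (\<theta> ` {z \<in> half_disc e. cmod z < e})"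
    and \<gamma>: "path \<gamma>" "path_image \<gamma> \<subseteq> interior Y" "pathstart \<gamma> = \<theta> p" "p \<in> half_disc e" "cmod p < e"
      "pathfinish \<gamma> \<notin> \<theta> ` half_disc e"
  obtains P p' where "connected P" "P \<subseteq> {z \<in> half_disc e. 0 < Re z}" "\<theta> ` P \<subseteq> path_image \<gamma>"
    "p \<in> P" "p' \<in> P" "cmod p' = e"
proof -
  let ?H = "half_disc e"
  let ?G = "\<theta> ` {z \<in> ?H. cmod z < e}"
  have cont: "continuous_on {0..1} \<gamma>" using \<gamma> by (simp add: path_def)
  have inv: "\<theta>' (\<theta> z) = z" if "z \<in> ?H" for z using \<theta>(2) that by (simp add: homeomorphism_def)
  have \<gamma>I: "\<gamma> t \<in> interior Y" if "t \<in> {0..1}" for t using \<gamma>(2) that by (auto simp: path_image_def)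
  obtain W where W: "open W" "?G = Y \<inter> W" using op unfolding openin_open by blast
  have \<gamma>Y: "\<gamma> t \<in> Y" if "t \<in> {0..1}" for t using \<gamma>I[OF that] interior_subset by auto
  have "\<gamma> 0 \<in> W" using W(2) \<gamma> by (auto simp: pathstart_def)
  moreover have "\<gamma> 1 \<notin> ?G" using \<gamma>(6) by (auto simp: pathfinish_def)
  then have "\<gamma> 1 \<notin> W" using W(2) \<gamma>Y[of 1] by auto
  ultimately obtain \<tau> where "0 < \<tau>" and \<tau>: "\<tau> \<le> 1" "\<gamma> \<tau> \<notin> W" and ltW: "\<And>t. 0 \<le> t \<Longrightarrow> t < \<tau> \<Longrightarrow> \<gamma> t \<in> W"
    and cl: "\<And>K. closed K \<Longrightarrow> (\<And>t. 0 \<le> t \<Longrightarrow> t < \<tau> \<Longrightarrow> \<gamma> t \<in> K) \<Longrightarrow> \<gamma> \<tau> \<in> K"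
    by (rule first_exit[OF cont W(1)]) blast
  have lt: "\<gamma> t \<in> ?G" if "0 \<le> t" "t < \<tau>" for t
    using ltW[OF that] \<gamma>Y[of t] W(2) that \<tau> by auto
  have "closed (\<theta> ` ?H)"
    by (intro compact_imp_closed compact_continuous_image \<theta> compact_half_disc)
  then have \<tau>K: "\<gamma> \<tau> \<in> \<theta> ` ?H" by (rule cl) (use lt in blast)
  have K: "\<gamma> t \<in> \<theta> ` ?H" if "t \<in> {0..\<tau>}" for t
    using lt[of t] \<tau>K that by (cases "t = \<tau>") auto
  define P where "P = (\<lambda>t. \<theta>' (\<gamma> t)) ` {0..\<tau>}"
  have P: "z \<in> ?H \<and> 0 < Re z \<and> \<theta> z \<in> path_image \<gamma>" if zP: "z \<in> P" for z
  proof -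
    obtain t where t: "t \<in> {0..\<tau>}" "z = \<theta>' (\<gamma> t)" using zP unfolding P_def by blast
    then obtain z' where z': "z' \<in> ?H" "\<gamma> t = \<theta> z'" using K by blast
    then have "z = z'" using inv t by simp
    moreover have t01: "t \<in> {0..1}" using t \<tau> by auto
    then have "\<gamma> t \<in> path_image \<gamma>" by (simp add: path_image_def)
    moreover have "0 < Re z'" using \<gamma>I[OF t01] int z' by simp
    ultimately show ?thesis using z' by simp
  qed
  show ?thesis
  proof (rule that[of P "\<theta>' (\<gamma> \<tau>)"])
    have "continuous_on (\<theta> ` ?H) \<theta>'" using \<theta>(2) by (simp add: homeomorphism_def)
    moreover have "continuous_on {0..\<tau>} \<gamma>" by (rule continuous_on_subset[OF cont]) (use \<tau> in auto)
    moreover have "\<gamma> ` {0..\<tau>} \<subseteq> \<theta> ` ?H" using K by blast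
    ultimately have "continuous_on {0..\<tau>} (\<lambda>t. \<theta>' (\<gamma> t))" by (rule continuous_on_compose2)
    then show "connected P" unfolding P_def by (intro connected_continuous_image) auto
    show "P \<subseteq> {z \<in> ?H. 0 < Re z}" "\<theta> ` P \<subseteq> path_image \<gamma>" using P by auto
    have "\<theta>' (\<gamma> 0) = p" using inv \<gamma> by (simp add: pathstart_def)
    then show "p \<in> P" unfolding P_def using \<open>0 < \<tau>\<close> by (auto intro!: image_eqI[of _ _ 0])
    show "\<theta>' (\<gamma> \<tau>) \<in> P" unfolding P_def using \<open>0 < \<tau>\<close> by auto
    obtain z where z: "z \<in> ?H" "\<gamma> \<tau> = \<theta> z" using \<tau>K by blast
    have "\<gamma> \<tau> \<notin> ?G" using \<tau> W(2) by blast
    then have "\<not> cmod z < e" using z by blast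
    then show "cmod (\<theta>' (\<gamma> \<tau>)) = e" using z inv by (simp add: half_disc_def)
  qed
qed

text \<open>
Curves of the interior that lead from \<open>V\<close> out of \<open>N\<close> cannot avoid each other: one can pass from any
of them to any other at cost \<open>\<eta>\<close>. This replaces a bound for the distance of their end points in \<open>V\<close>,
which fails near wild boundary points.
\<close>

definition linked :: "'a set \<Rightarrow> 'a set \<Rightarrow> 'a set \<Rightarrow> real \<Rightarrow> bool" where
  "linked Y V N \<eta> \<longleftrightarrow> (\<forall>\<gamma>1 \<gamma>2. (\<forall>\<gamma>\<in>{\<gamma>1, \<gamma>2}. path \<gamma> \<and> path_image \<gamma> \<subseteq> interior Y \<and>
       pathstart \<gamma> \<in> V \<and> pathfinish \<gamma> \<notin> N) \<longrightarrow>
     (\<exists>u\<in>path_image \<gamma>1. \<exists>v\<in>path_image \<gamma>2. idist (interior Y) u v \<le> ereal \<eta>))"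

text \<open>
For a small circle around \<open>y\<close>, there is an arc of the circle in the interior that both curves meet:
otherwise \<open>half_disc_crossing\<close> applies to the arcs met by the first curve and to the remaining ones.
\<close>

lemma boundary_crossing:
  fixes Y :: "'a set"
  assumes y: "y \<in> manifold_boundary Y" and N: "open N" "y \<in> N" and \<eta>: "0 < \<eta>"
  obtains V where "open V" "y \<in> V" "linked Y V N \<eta>"
proof -
  let ?I = "interior Y"
  obtain c R m C where c: "c \<in> A" "y \<in> fst c" "0 < R" "0 < m" "0 < C"
    "cball (snd c y) R \<subseteq> snd c ` (fst c \<inter> N)"
    "\<And>q v. q \<in> fst c \<Longrightarrow> snd c q \<in> cball (snd c y) R \<Longrightarrow> m * norm v \<le> gnorm c q v \<and> gnorm c q v \<le> C * norm v"
    by (rule chart_constants[OF N]) blast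
  let ?y = "snd c y"
  define N' where "N' = {q \<in> fst c. snd c q \<in> ball ?y R} \<inter> N"
  have N': "open N'" "y \<in> N'"
    using chart_preimage_open[OF c(1) open_ball] N c by (auto simp: N'_def)
  obtain e \<theta> where e: "0 < e" and \<theta>: "continuous_on (half_disc e) \<theta>" "inj_on \<theta> (half_disc e)" "\<theta> 0 = y"
    "\<theta> ` half_disc e \<subseteq> Y \<inter> N'"
    and int: "\<And>z. z \<in> half_disc e \<Longrightarrow> \<theta> z \<in> ?I \<longleftrightarrow> 0 < Re z"
    and op: "openin (top_of_set Y) (\<theta> ` {z \<in> half_disc e. cmod z < e})"
    by (rule half_disc_chart[OF y N']) blast
  let ?H = "half_disc e"
  obtain \<theta>' where \<theta>': "homeomorphism ?H (\<theta> ` ?H) \<theta> \<theta>'"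
    using homeomorphism_compact[OF compact_half_disc \<theta>(1) refl \<theta>(2)] by blast
  have \<theta>N: "\<theta> z \<in> fst c \<and> snd c (\<theta> z) \<in> ball ?y R \<and> \<theta> z \<in> N \<and> \<theta> z \<in> Y" if "z \<in> ?H" for z
    using \<theta>(4) that unfolding N'_def by blast
  have HN: "\<theta> ` ?H \<subseteq> N" using \<theta>N by (intro image_subsetI) simp
  obtain W where W: "open W" "\<theta> ` {z \<in> ?H. cmod z < e} = Y \<inter> W"
    using op unfolding openin_open by blast
  have "0 \<in> ?H" using e by (simp add: half_disc_def)
  then have "y \<in> \<theta> ` {z \<in> ?H. cmod z < e}" using e \<theta>(3) by force
  then have "y \<in> W" using W by blast
  then have "?y \<in> snd c ` (fst c \<inter> W)" using c by blast
  then obtain R2 where R2: "0 < R2" "cball ?y R2 \<subseteq> snd c ` (fst c \<inter> W)"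
    using chart_image_open[OF c(1) W(1)] open_contains_cball by metis
  \<comment> \<open>With \<open>r \<le> R2\<close> the circle of radius \<open>r\<close> meets \<open>Y\<close> only in the open half disc, and its circumference
     has length at most \<open>\<eta>\<close> in the Riemannian metric.\<close>
  define r where "r = min R2 (\<eta> / (2 * pi * C))"
  have r: "0 < r" "r \<le> R2" "C * r * (2 * pi) \<le> \<eta>"
  proof -
    have "0 < 2 * pi * C" using c by simp
    moreover have "r \<le> \<eta> / (2 * pi * C)" by (simp add: r_def)
    ultimately have "r * (2 * pi * C) \<le> \<eta>" by (simp only: pos_le_divide_eq)
    then show "C * r * (2 * pi) \<le> \<eta>" by (simp add: mult_ac)
  qed (use R2 \<eta> c in \<open>auto simp: r_def\<close>)
  define k where "k z = complex_of (snd c (\<theta> z) - ?y)" for z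
  define h where "h z = cmod (k z)" for z
  have h: "h z = dist ?y (snd c (\<theta> z))" for z
    by (simp add: h_def k_def norm_complex_of dist_norm norm_minus_commute)
  have ck: "continuous_on ?H k"
  proof -
    have "continuous_on ?H (\<lambda>z. snd c (\<theta> z))"
      by (rule continuous_on_compose2[OF cont_chart[OF c(1)] \<theta>(1)]) (use \<theta>N in blast)
    then have "continuous_on ?H (\<lambda>z. snd c (\<theta> z) - ?y)" by (intro continuous_intros)
    then show ?thesis unfolding k_def by (rule continuous_on_compose2[OF continuous_on_complex_of[of UNIV]]) auto
  qed
  then have ch: "continuous_on ?H h" unfolding h_def by (intro continuous_intros)
  have outer: "r < h z" if z: "z \<in> ?H" "cmod z = e" for z
  proof (rule ccontr)
    assume "\<not> r < h z"
    then have "snd c (\<theta> z) \<in> cball ?y R2" using r by (simp add: h)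
    then obtain q where q: "q \<in> fst c" "q \<in> W" "snd c (\<theta> z) = snd c q" using R2 by blast
    then have "\<theta> z = q" using \<theta>N[OF z(1)] cinv_chart[OF c(1)] by metis
    then have "\<theta> z \<in> \<theta> ` {z \<in> ?H. cmod z < e}" using q \<theta>N[OF z(1)] W(2) by blast
    then obtain z' where "z' \<in> ?H" "cmod z' < e" "\<theta> z = \<theta> z'" by blast
    then show False using inj_onD[OF \<theta>(2)] z by fastforce
  qed
  have "h 0 = 0" using \<theta>(3) by (simp add: h)
  with ch \<open>0 \<in> ?H\<close> obtain \<delta>' where \<delta>': "0 < \<delta>'" "\<And>z. z \<in> ?H \<Longrightarrow> dist z 0 < \<delta>' \<Longrightarrow> dist (h z) 0 < r"
    using r(1) unfolding continuous_on_iff by metis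
  define \<delta> where "\<delta> = min \<delta>' e"
  have \<delta>: "0 < \<delta>" "\<delta> \<le> e" using \<delta>' e by (auto simp: \<delta>_def)
  have inner: "h z < r" if "z \<in> ?H" "cmod z < \<delta>" for z
    using \<delta>'(2)[OF that(1)] that(2) by (simp add: \<delta>_def h_def)
  have "openin (top_of_set ?H) (?H \<inter> ball 0 \<delta>)" by (simp add: openin_open_Int)
  then have "openin (top_of_set (\<theta> ` ?H)) (\<theta> ` (?H \<inter> ball 0 \<delta>))" by (rule homeomorphism_imp_open_map[OF \<theta>'])
  then obtain W1 where W1: "open W1" "\<theta> ` (?H \<inter> ball 0 \<delta>) = \<theta> ` ?H \<inter> W1" using openin_open by metis
  define V where "V = W \<inter> W1"
  have V: "\<exists>p. q = \<theta> p \<and> p \<in> ?H \<and> cmod p < \<delta>" if "q \<in> V" "q \<in> Y" for q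
  proof -
    have "q \<in> \<theta> ` {z \<in> ?H. cmod z < e}" using that W(2) by (auto simp: V_def)
    then have "q \<in> \<theta> ` ?H \<inter> W1" using that by (auto simp: V_def)
    then have "q \<in> \<theta> ` (?H \<inter> ball 0 \<delta>)" unfolding W1(2) .
    then show ?thesis by auto
  qed
  show ?thesis
  proof (rule that[of V])
    show "open V" using W W1 by (auto simp: V_def)
    have "y \<in> \<theta> ` (?H \<inter> ball 0 \<delta>)" using \<open>0 \<in> ?H\<close> \<delta> \<theta>(3) by force
    then show "y \<in> V" using W1(2) \<open>y \<in> W\<close> by (auto simp: V_def)
    show "linked Y V N \<eta>" unfolding linked_def
    proof (intro allI impI)
      fix \<gamma>1 \<gamma>2
      assume "\<forall>\<gamma>\<in>{\<gamma>1, \<gamma>2}. path \<gamma> \<and> path_image \<gamma> \<subseteq> ?I \<and> pathstart \<gamma> \<in> V \<and> pathfinish \<gamma> \<notin> N"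
      then have 1: "path \<gamma>1" "path_image \<gamma>1 \<subseteq> ?I" "pathstart \<gamma>1 \<in> V" "pathfinish \<gamma>1 \<notin> N"
        and 2: "path \<gamma>2" "path_image \<gamma>2 \<subseteq> ?I" "pathstart \<gamma>2 \<in> V" "pathfinish \<gamma>2 \<notin> N" by simp_all
      have "pathstart \<gamma>1 \<in> Y" "pathstart \<gamma>2 \<in> Y"
        using 1(2) 2(2) interior_subset[of Y] pathstart_in_path_image[of \<gamma>1] pathstart_in_path_image[of \<gamma>2] by auto
      then obtain p q where p: "pathstart \<gamma>1 = \<theta> p" "p \<in> ?H" "cmod p < \<delta>"
        and q: "pathstart \<gamma>2 = \<theta> q" "q \<in> ?H" "cmod q < \<delta>"
        using V[OF 1(3)] V[OF 2(3)] by blast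
      have out: "pathfinish \<gamma>1 \<notin> \<theta> ` ?H" "pathfinish \<gamma>2 \<notin> \<theta> ` ?H" using 1(4) 2(4) HN by (meson subsetD)+
      have pe: "cmod p < e" "cmod q < e" using p q \<delta> by auto
      obtain P p' where P: "connected P" "P \<subseteq> {z \<in> ?H. 0 < Re z}" "\<theta> ` P \<subseteq> path_image \<gamma>1"
        "p \<in> P" "p' \<in> P" "cmod p' = e"
        by (rule half_disc_exit[OF \<theta>(1) \<theta>' int op 1(1,2) p(1,2) pe(1) out(1)]) blast
      obtain Q q' where Q: "connected Q" "Q \<subseteq> {z \<in> ?H. 0 < Re z}" "\<theta> ` Q \<subseteq> path_image \<gamma>2"
        "q \<in> Q" "q' \<in> Q" "cmod q' = e"
        by (rule half_disc_exit[OF \<theta>(1) \<theta>' int op 2(1,2) q(1,2) pe(2) out(2)]) blast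
      define S where "S = {\<zeta>. ?y + plane_of \<zeta> \<in> snd c ` (fst c \<inter> ?I) \<inter> ball ?y R}"
      have oS: "open S"
      proof -
        have "open (snd c ` (fst c \<inter> ?I) \<inter> ball ?y R)" using chart_image_open[OF c(1) open_interior] by auto
        moreover have "continuous_on UNIV (\<lambda>\<zeta>. ?y + plane_of \<zeta>)" by (intro continuous_intros continuous_on_plane_of)
        ultimately have "open ((\<lambda>\<zeta>. ?y + plane_of \<zeta>) -` (snd c ` (fst c \<inter> ?I) \<inter> ball ?y R))"
          by (rule open_vimage)
        then show ?thesis by (simp add: S_def vimage_def)
      qed
      define F where "F = {z \<in> ?H. 0 < Re z \<and> h z = r}"
      have yk: "?y + plane_of (k z) = snd c (\<theta> z)" for z by (simp add: k_def)
      have kF: "k ` F \<subseteq> sphere 0 r \<inter> S"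
      proof
        fix w assume "w \<in> k ` F"
        then obtain z where z: "z \<in> F" "w = k z" by blast
        then have "\<theta> z \<in> ?I" "z \<in> ?H" using int by (auto simp: F_def)
        then have "snd c (\<theta> z) \<in> snd c ` (fst c \<inter> ?I) \<inter> ball ?y R" using \<theta>N by blast
        then show "w \<in> sphere 0 r \<inter> S" using z by (simp add: S_def yk F_def h_def)
      qed
      \<comment> \<open>The two families consist of the arcs that meet \<open>P\<close> and of all others.\<close>
    define X where "X = k ` (P \<inter> F)"
      define A' where "A' = {z \<in> F. \<exists>u\<in>X. circ_arc S u (k z)}"
      define B' where "B' = {z \<in> F. \<not> (\<exists>u\<in>X. circ_arc S u (k z))}"
      have ckF: "continuous_on F k" by (rule continuous_on_subset[OF ck]) (auto simp: F_def)
      have "A' = F \<inter> k -` {w \<in> sphere 0 r \<inter> S. \<exists>u\<in>X. circ_arc S u w}" using kF by (auto simp: A'_def)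
      then have oA: "openin (top_of_set F) A'"
        using continuous_openin_preimage[OF ckF _ openin_circ_arc(1)[OF oS r(1), of X]] kF by auto
      have "B' = F \<inter> k -` {w \<in> sphere 0 r \<inter> S. \<not> (\<exists>u\<in>X. circ_arc S u w)}" using kF by (auto simp: B'_def)
      then have oB: "openin (top_of_set F) B'"
        using continuous_openin_preimage[OF ckF _ openin_circ_arc(2)[OF oS r(1), of X]] kF by auto
      have "P \<inter> B' = {}"
      proof -
        have "z \<notin> B'" if "z \<in> P" "z \<in> F" for z
        proof -
          have "k z \<in> S" using kF that by blast
          then have "circ_arc S (k z) (k z)" by (rule circ_arc_refl)
          then show ?thesis using that by (auto simp: B'_def X_def)
        qed
        then show ?thesis by (auto simp: B'_def)
      qed
      moreover have AB: "A' \<union> B' = F" "A' \<inter> B' = {}" by (auto simp: A'_def B'_def)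
      have "P \<inter> B' \<noteq> {} \<or> Q \<inter> A' \<noteq> {}"
        by (rule half_disc_crossing[OF ch \<delta> inner outer, folded F_def,
              OF _ _ _ _ oA oB AB P(1,2,4) p(3) P(5,6) Q(1,2,4) q(3) Q(5,6)])
      ultimately obtain v where v: "v \<in> Q" "v \<in> F" "\<exists>u\<in>X. circ_arc S u (k v)" by (auto simp: A'_def)
      then obtain u where u: "u \<in> P" "u \<in> F" "circ_arc S (k u) (k v)" by (auto simp: X_def)
      have arc: "idist ?I (\<theta> a) (\<theta> b) \<le> ereal \<eta>"
        if ab: "a \<in> F" "b \<in> F" and t: "0 \<le> t" "t \<le> 2 * pi" "k b = k a * cis t"
          and arcS: "\<And>s. s \<in> {0..t} \<Longrightarrow> k a * cis s \<in> S" for a b t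
      proof -
        define w where "w s = ?y + plane_of (k a * cis s)" for s
        have ha: "cmod (k a) = r" using ab by (simp add: F_def h_def)
        have "idist ?I (cinv c (w 0)) (cinv c (w t)) \<le> ereal (C * r * t)"
        proof (rule idist_lipschitz_curve[OF c(1) open_interior])
          fix s s' assume "s \<in> {0..t}" "s' \<in> {0..t}"
          have "dist (w s) (w s') = dist (k a * cis s) (k a * cis s')"
            by (simp add: w_def dist_plane_of)
          also have "\<dots> = r * dist (cis s) (cis s')"
            using ha by (simp add: dist_norm norm_mult flip: right_diff_distrib)
          also have "\<dots> \<le> r * \<bar>s - s'\<bar>" using r dist_cis_le by (intro mult_left_mono) auto
          finally show "dist (w s) (w s') \<le> r * \<bar>s - s'\<bar>" .
        next
          show "w ` {0..t} \<subseteq> snd c ` (fst c \<inter> ?I) \<inter> ball ?y R"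
            using arcS by (auto simp: w_def S_def)
          show "gnorm c q v \<le> C * norm v" if "q \<in> fst c" "snd c q \<in> ball ?y R" for q v
            using c(7)[of q v] that by auto
        qed (use t c in auto)
        moreover have "w 0 = snd c (\<theta> a)" "w t = snd c (\<theta> b)"
          using yk t(3) by (auto simp: w_def simp flip: t(3))
        moreover have "\<theta> a \<in> fst c" "\<theta> b \<in> fst c" using ab \<theta>N by (auto simp: F_def)
        ultimately have "idist ?I (\<theta> a) (\<theta> b) \<le> ereal (C * r * t)" using c(1) by simp
        also have "C * r * t \<le> C * r * (2 * pi)" using t r c by (intro mult_left_mono) auto
        also have "\<dots> \<le> \<eta>" by fact
        finally show ?thesis by simp
      qed
      have "idist ?I (\<theta> u) (\<theta> v) \<le> ereal \<eta>"
        by (rule circ_arc_short[OF u(3)])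
          (use arc[of u v] arc[of v u] u v idist_commute in \<open>blast, metis\<close>)
      moreover have "\<theta> u \<in> path_image \<gamma>1" "\<theta> v \<in> path_image \<gamma>2" using u v P Q by auto
      ultimately show "\<exists>u\<in>path_image \<gamma>1. \<exists>v\<in>path_image \<gamma>2. idist ?I u v \<le> ereal \<eta>" by blast
    qed
  qed
qed

lemma point_crossing:
  fixes Y :: "'a set"
  assumes Y: "C0_submanifold Y" and y: "y \<in> Y" and N: "open N" "y \<in> N" and \<eta>: "0 < \<eta>"
  obtains V where "open V" "y \<in> V" "linked Y V N \<eta>"
proof (cases "y \<in> manifold_boundary Y")
  case True
  show ?thesis by (rule boundary_crossing[OF True N \<eta>]) (rule that)
next
  case False
  then have "y \<in> interior Y" using y manifold_interior_eq[OF Y] by (auto simp: manifold_interior_def)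
  then obtain W where W: "open W" "y \<in> W" "W \<subseteq> interior Y"
    "\<And>a b. a \<in> W \<Longrightarrow> b \<in> W \<Longrightarrow> idist (interior Y) a b < ereal \<eta>"
    using idist_local_small[OF open_interior _ \<eta>] by metis
  have "linked Y W N \<eta>"
    unfolding linked_def using W(4) by (meson insertI1 insertI2 less_imp_le pathstart_in_path_image)
  then show ?thesis by (rule that[OF W(1,2)])
qed

end

section \<open>The boundary distance\<close>

context riem_surface
begin

lemma rho_lessD:
  fixes Y :: "'a set"
  assumes Y: "C0_submanifold Y" and l: "rho A g Y x y < a" and U: "open U" "x \<in> U" and V: "open V" "y \<in> V"
  obtains x' y' where "x' \<in> U" "x' \<in> interior Y" "y' \<in> V" "y' \<in> interior Y" "idist (interior Y) x' y' < a"
proof (rule ccontr)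
  assume n: "\<not> thesis"
  have "\<forall>\<^sub>F z in inf (nhds (x, y)) (principal (interior Y \<times> interior Y)).
      a \<le> (case z of (x', y') \<Rightarrow> idist (interior Y) x' y')"
    unfolding eventually_inf_principal eventually_nhds
  proof (intro exI[of _ "U \<times> V"] conjI ballI impI)
    fix z assume z: "z \<in> U \<times> V" "z \<in> interior Y \<times> interior Y"
    then obtain x' y' where z': "z = (x', y')" "x' \<in> U" "x' \<in> interior Y" "y' \<in> V" "y' \<in> interior Y" by auto
    then have "\<not> idist (interior Y) x' y' < a" using n that by blast
    then show "a \<le> (case z of (x', y') \<Rightarrow> idist (interior Y) x' y')" using z' by auto
  qed (use U V in \<open>auto intro: open_Times\<close>)
  then have "a \<le> rho A g Y x y"
    unfolding rho_def manifold_interior_eq[OF Y] by (rule Liminf_bounded)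
  then show False using l by simp
qed

text \<open>
Together with \<open>rho_lessD\<close> this characterizes \<open>rho\<close> by interior distances of nearby points; it also expresses
that \<open>rho\<close> is lower semicontinuous.
\<close>

lemma rho_leI:
  fixes Y :: "'a set"
  assumes Y: "C0_submanifold Y"
    and n: "\<And>U V. open U \<Longrightarrow> x \<in> U \<Longrightarrow> open V \<Longrightarrow> y \<in> V \<Longrightarrow>
      \<exists>x'\<in>U \<inter> interior Y. \<exists>y'\<in>V \<inter> interior Y. idist (interior Y) x' y' \<le> a"
  shows "rho A g Y x y \<le> a"
proof (rule ccontr)
  assume "\<not> ?thesis"
  then have "a < rho A g Y x y" by simp
  then have "\<forall>\<^sub>F z in inf (nhds (x, y)) (principal (interior Y \<times> interior Y)).
      a < (case z of (x', y') \<Rightarrow> idist (interior Y) x' y')"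
    unfolding rho_def manifold_interior_eq[OF Y] by (rule less_LiminfD)
  then obtain S where S: "open S" "(x, y) \<in> S"
    "\<And>z. z \<in> S \<Longrightarrow> z \<in> interior Y \<times> interior Y \<Longrightarrow> a < (case z of (x', y') \<Rightarrow> idist (interior Y) x' y')"
    unfolding eventually_inf_principal eventually_nhds by blast
  obtain U V where UV: "open U" "open V" "(x, y) \<in> U \<times> V" "U \<times> V \<subseteq> S"
    using open_prod_elim[OF S(1,2)] by blast
  then obtain x' y' where "x' \<in> U \<inter> interior Y" "y' \<in> V \<inter> interior Y" "idist (interior Y) x' y' \<le> a"
    using n[of U V] by blast
  moreover then have "a < idist (interior Y) x' y'" using S(3)[of "(x', y')"] UV by auto
  ultimately show False by simp
qed

lemma rho_nonneg: "0 \<le> rho A g Y x y"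
  unfolding rho_def by (rule Liminf_bounded) (auto intro!: always_eventually simp: idist_nonneg)

text \<open>
Finiteness excludes that \<open>x\<close> is isolated from the interior, in which case the lower limit would be
infinite.
\<close>

lemma rho_self:
  fixes Y :: "'a set"
  assumes Y: "C0_submanifold Y" and fin: "rho A g Y x x < \<infinity>"
  shows "rho A g Y x x = 0"
proof -
  have "rho A g Y x x \<le> 0"
  proof (rule rho_leI[OF Y])
    fix U V assume UV: "open U" "x \<in> U" "open V" "x \<in> V"
    then obtain x' where "x' \<in> U \<inter> V" "x' \<in> interior Y"
      using rho_lessD[OF Y fin, of "U \<inter> V" "U \<inter> V"] by blast
    then show "\<exists>x'\<in>U \<inter> interior Y. \<exists>y'\<in>V \<inter> interior Y. idist (interior Y) x' y' \<le> 0"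
      using idist_self[OF open_interior, of x' Y] by (intro bexI[of _ x']) simp_all
  qed
  then show ?thesis using rho_nonneg by (rule antisym)
qed

lemma rho_separated:
  fixes Y :: "'a set"
  assumes Y: "C0_submanifold Y" and U: "open U" "x \<in> U"
  obtains e where "0 < e" "\<And>y. y \<notin> U \<Longrightarrow> ereal e \<le> rho A g Y x y \<and> ereal e \<le> rho A g Y y x"
proof -
  obtain W V e where W: "open W" "open V" "x \<in> W" "- U \<subseteq> V" "0 < e"
    "\<And>x' y S. x' \<in> W \<Longrightarrow> y \<in> V \<Longrightarrow> ereal e \<le> idist S x' y"
    by (rule idist_separated[OF U]) blast
  show ?thesis
  proof (rule that[OF W(5)])
    fix y assume "y \<notin> U"
    then have y: "y \<in> V" using W by blast
    show "ereal e \<le> rho A g Y x y \<and> ereal e \<le> rho A g Y y x"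
    proof (intro conjI; rule ccontr)
      assume "\<not> ereal e \<le> rho A g Y x y"
      then have "rho A g Y x y < ereal e" by simp
      then obtain x' y' where "x' \<in> W" "y' \<in> V" "idist (interior Y) x' y' < ereal e"
        by (rule rho_lessD[OF Y _ W(1,3) W(2) y]) blast
      then show False using W(6) by (meson not_less)
    next
      assume "\<not> ereal e \<le> rho A g Y y x"
      then have "rho A g Y y x < ereal e" by simp
      then obtain x' y' where "x' \<in> V" "y' \<in> W" "idist (interior Y) x' y' < ereal e"
        by (rule rho_lessD[OF Y _ W(2) y W(1,3)]) blast
      then show False using W(6) idist_commute by (metis not_less)
    qed
  qed
qed

lemma rho_pos:
  fixes Y :: "'a set"
  assumes Y: "C0_submanifold Y" and "x \<noteq> y"
  shows "0 < rho A g Y x y"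
proof -
  obtain U where U: "open U" "x \<in> U" "y \<notin> U" using assms(2) hausdorff by blast
  obtain e where "0 < e" "\<And>y. y \<notin> U \<Longrightarrow> ereal e \<le> rho A g Y x y \<and> ereal e \<le> rho A g Y y x"
    by (rule rho_separated[OF Y U(1,2)]) blast
  then have "ereal e \<le> rho A g Y x y" "0 < ereal e" using U by auto
  then show ?thesis by (rule order_less_le_trans[rotated])
qed

lemma idist_to_end:
  fixes \<gamma> :: "real \<Rightarrow> 'a"
  assumes S: "open S" and \<gamma>: "smooth_path A \<gamma>" "path_image \<gamma> \<subseteq> S" and u: "u \<in> path_image \<gamma>"
  shows "idist S u (pathfinish \<gamma>) \<le> ereal (len \<gamma>)"
proof -
  obtain \<Lambda> where \<Lambda>: "arclength \<gamma> \<Lambda>" "\<Lambda> 0 = 0" using arclength_exists \<gamma> by blast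
  obtain t where t: "t \<in> {0..1}" "u = \<gamma> t" using u by (auto simp: path_image_def)
  have "idist S (\<gamma> t) (\<gamma> 1) \<le> ereal \<bar>\<Lambda> 1 - \<Lambda> t\<bar>"
    by (rule idist_along_path[OF S \<gamma> \<Lambda>(1) t(1)]) simp
  also have "\<bar>\<Lambda> 1 - \<Lambda> t\<bar> \<le> len \<gamma>"
    using arclength_riem_length[OF \<Lambda>(1)] arclength_mono[OF \<Lambda>(1), of 0 t] arclength_mono[OF \<Lambda>(1), of t 1] t \<Lambda>(2) by auto
  finally show ?thesis using t by (simp add: pathfinish_def)
qed

text \<open>
Almost shortest curves from \<open>x\<close> and from \<open>z\<close> to the neighbourhood of \<open>y\<close> come close to each other
by \<open>point_crossing\<close>, provided that \<open>x\<close> and \<open>z\<close> differ from \<open>y\<close>; there one changes from one to the other.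
\<close>

lemma rho_triangle_less:
  fixes Y :: "'a set"
  assumes Y: "C0_submanifold Y" and y: "y \<in> Y"
    and a: "rho A g Y x y < ereal a" and b: "rho A g Y y z < ereal b"
  shows "rho A g Y x z \<le> ereal (a + b)"
proof -
  have "0 < ereal a" "0 < ereal b" using a b rho_nonneg order_le_less_trans by blast+
  then have pos: "0 < a" "0 < b" by auto
  consider "x = y" | "y = z" | "x \<noteq> y" "z \<noteq> y" by blast
  then show ?thesis
  proof cases
    case 1
    then have "rho A g Y x z < ereal b" using b by simp
    also have "\<dots> \<le> ereal (a + b)" using pos by simp
    finally show ?thesis by simp
  next
    case 2
    then have "rho A g Y x z < ereal a" using a by simp
    also have "\<dots> \<le> ereal (a + b)" using pos by simp
    finally show ?thesis by simp
  next
    case 3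
    obtain Ux Nx where X: "open Ux" "x \<in> Ux" "open Nx" "y \<in> Nx" "Ux \<inter> Nx = {}"
      using hausdorff[OF 3(1)] by blast
    obtain Uz Nz where Z: "open Uz" "z \<in> Uz" "open Nz" "y \<in> Nz" "Uz \<inter> Nz = {}"
      using hausdorff[OF 3(2)] by blast
    have N: "open (Nx \<inter> Nz)" "y \<in> Nx \<inter> Nz" using X Z by auto
    have "rho A g Y x z \<le> ereal (a + b) + ereal \<eta>" if \<eta>: "0 < \<eta>" for \<eta>
    proof (rule rho_leI[OF Y])
      fix U V assume UV: "open U" "x \<in> U" "open V" "z \<in> V"
      obtain W where W: "open W" "y \<in> W" "linked Y W (Nx \<inter> Nz) \<eta>"
        by (rule point_crossing[OF Y y N \<eta>]) blast
      have UX: "open (U \<inter> Ux)" "x \<in> U \<inter> Ux" and VZ: "open (V \<inter> Uz)" "z \<in> V \<inter> Uz" using UV X Z by auto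
      obtain x1 y1 where 1: "x1 \<in> U \<inter> Ux" "x1 \<in> interior Y" "y1 \<in> W" "y1 \<in> interior Y" "idist (interior Y) x1 y1 < ereal a"
        by (rule rho_lessD[OF Y a UX W(1,2)]) blast
      obtain y2 z1 where 2: "y2 \<in> W" "y2 \<in> interior Y" "z1 \<in> V \<inter> Uz" "z1 \<in> interior Y" "idist (interior Y) y2 z1 < ereal b"
        by (rule rho_lessD[OF Y b W(1,2) VZ]) blast
      have flipped: "idist (interior Y) y1 x1 < ereal a" using 1(5) by (simp add: idist_commute)
      obtain \<gamma>1 where \<gamma>1: "smooth_path A \<gamma>1" "path_image \<gamma>1 \<subseteq> interior Y" "pathstart \<gamma>1 = y1" "pathfinish \<gamma>1 = x1"
        "len \<gamma>1 < a" by (rule idist_lessE[OF flipped]) blast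
      obtain \<gamma>2 where \<gamma>2: "smooth_path A \<gamma>2" "path_image \<gamma>2 \<subseteq> interior Y" "pathstart \<gamma>2 = y2" "pathfinish \<gamma>2 = z1"
        "len \<gamma>2 < b" by (rule idist_lessE[OF 2(5)]) blast
      have "\<exists>u\<in>path_image \<gamma>1. \<exists>v\<in>path_image \<gamma>2. idist (interior Y) u v \<le> ereal \<eta>"
        by (rule W(3)[unfolded linked_def, rule_format])
          (use \<gamma>1 \<gamma>2 1 2 X Z in \<open>auto simp: smooth_path_def\<close>)
      then obtain u v where uv: "u \<in> path_image \<gamma>1" "v \<in> path_image \<gamma>2" "idist (interior Y) u v \<le> ereal \<eta>" by blast
      have "idist (interior Y) u x1 \<le> ereal (len \<gamma>1)"
        using idist_to_end[OF open_interior \<gamma>1(1,2) uv(1)] \<gamma>1(4) by simp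
      also have "\<dots> \<le> ereal a" using \<gamma>1 by simp
      finally have u: "idist (interior Y) x1 u \<le> ereal a" by (simp add: idist_commute)
      have "idist (interior Y) v z1 \<le> ereal (len \<gamma>2)"
        using idist_to_end[OF open_interior \<gamma>2(1,2) uv(2)] \<gamma>2(4) by simp
      also have "\<dots> \<le> ereal b" using \<gamma>2 by simp
      finally have v: "idist (interior Y) v z1 \<le> ereal b" .
      have "idist (interior Y) x1 z1 \<le> idist (interior Y) x1 u + idist (interior Y) u z1" by (rule idist_triangle)
      also have "\<dots> \<le> idist (interior Y) x1 u + (idist (interior Y) u v + idist (interior Y) v z1)"
        by (intro add_left_mono idist_triangle)
      also have "\<dots> \<le> ereal a + (ereal \<eta> + ereal b)" by (intro add_mono u v uv)
      also have "\<dots> = ereal (a + b) + ereal \<eta>" by simp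
      finally show "\<exists>x'\<in>U \<inter> interior Y. \<exists>y'\<in>V \<inter> interior Y. idist (interior Y) x' y' \<le> ereal (a + b) + ereal \<eta>"
        using 1 2 by blast
    qed
    then show ?thesis using ereal_le_epsilon2 by blast
  qed
qed

lemma rho_triangle:
  fixes Y :: "'a set"
  assumes Y: "C0_submanifold Y" and y: "y \<in> Y"
    and a: "rho A g Y x y \<le> ereal a" and b: "rho A g Y y z \<le> ereal b"
  shows "rho A g Y x z \<le> ereal (a + b)"
proof -
  have "rho A g Y x z \<le> ereal (a + b) + ereal e" if e: "0 < e" for e
  proof -
    have "rho A g Y x y < ereal (a + e / 2)" using a e by (auto elim!: order_le_less_trans)
    moreover have "rho A g Y y z < ereal (b + e / 2)" using b e by (auto elim!: order_le_less_trans)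
    ultimately have "rho A g Y x z \<le> ereal ((a + e / 2) + (b + e / 2))" by (rule rho_triangle_less[OF Y y])
    then show ?thesis by (simp add: algebra_simps)
  qed
  then show ?thesis using ereal_le_epsilon2 by blast
qed

end

section \<open>Compactness of closed balls\<close>

text \<open>
The theorem of Hopf-Rinow and Cohn-Vossen: a complete, locally compact length space is proper. The
supremum \<open>R\<close> of the radii of compact balls cannot be finite. The ball of radius \<open>R\<close> is totally bounded,
since every point of it is almost reached from within a smaller ball. Then a finite cover by compact balls
contains a slightly larger ball.
\<close>

lemma (in Metric_space) compactin_mcball:
  assumes compl: "mcomplete" and loc: "\<And>x. x \<in> M \<Longrightarrow> \<exists>r>0. compactin mtopology (mcball x r)"
    and len: "\<And>x y a b. x \<in> M \<Longrightarrow> y \<in> M \<Longrightarrow> 0 < a \<Longrightarrow> 0 < b \<Longrightarrow> d x y < a + b \<Longrightarrow> \<exists>z\<in>M. d x z < a \<and> d z y < b"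
    and x: "x \<in> M"
  shows "compactin mtopology (mcball x r)"
proof (rule ccontr)
  assume nr: "\<not> compactin mtopology (mcball x r)"
  define G where "G = {s. 0 < s \<and> compactin mtopology (mcball x s)}"
  have down: "compactin mtopology (mcball x s')" if "compactin mtopology (mcball x s)" "s' \<le> s" for s s'
    by (rule closed_compactin[OF that(1)]) (use that in auto)
  have bd: "s \<le> r" if "s \<in> G" for s using down[of s r] nr that linear[of s r] by (auto simp: G_def)
  then have bdd: "bdd_above G" by (rule bdd_aboveI)
  have ne: "G \<noteq> {}" using loc[OF x] by (auto simp: G_def)
  define R where "R = Sup G"
  have R: "0 < R" using ne cSup_upper[OF _ bdd] unfolding R_def G_def by (force intro: less_le_trans)
  have good: "compactin mtopology (mcball x s)" if sR: "s < R" for s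
  proof -
    obtain s' where "s' \<in> G" "s < s'" using less_cSupE[of s G] sR ne unfolding R_def by blast
    then show ?thesis using down[of s' s] by (simp add: G_def)
  qed
  have "mtotally_bounded (mcball x R)"
    unfolding mtotally_bounded_def
  proof (intro allI impI)
    fix e :: real assume e: "0 < e"
    define s where "s = max (R - e / 4) (R / 2)"
    have s: "0 < s" "s < R" "R < s + e / 2" using R e by (auto simp: s_def)
    have "mtotally_bounded (mcball x s)" using compactin_imp_mtotally_bounded[OF good[OF s(2)]] .
    then obtain K where K: "finite K" "K \<subseteq> mcball x s" "mcball x s \<subseteq> (\<Union>k\<in>K. mball k (e / 2))"
      unfolding mtotally_bounded_def using e by (metis half_gt_zero)
    have "mcball x R \<subseteq> (\<Union>k\<in>K. mball k e)"
    proof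
      fix y assume y: "y \<in> mcball x R"
      then have "d x y < s + e / 2" using s by auto
      then obtain z where z: "z \<in> M" "d x z < s" "d z y < e / 2"
        using len[of x y s "e / 2"] x y s e by auto
      then have "z \<in> mcball x s" using x by simp
      then obtain k where k: "k \<in> K" "z \<in> mball k (e / 2)" using K by blast
      have "d k y \<le> d k z + d z y" using k z y by (intro triangle) auto
      then show "y \<in> (\<Union>k\<in>K. mball k e)" using k z y by (intro UN_I[of k]) auto
    qed
    moreover have "K \<subseteq> mcball x R" using K s by fastforce
    ultimately show "\<exists>K. finite K \<and> K \<subseteq> mcball x R \<and> mcball x R \<subseteq> (\<Union>k\<in>K. mball k e)" using K by blast
  qed
  then have "compactin mtopology (mtopology closure_of (mcball x R))"
    using mtotally_bounded_eq_compact_closure_of[OF compl] by blast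
  then have cR: "compactin mtopology (mcball x R)" by (simp add: closure_of_closedin)
  obtain q where q: "\<And>k. k \<in> M \<Longrightarrow> 0 < q k \<and> compactin mtopology (mcball k (q k))" using loc by metis
  have "\<exists>\<F>. finite \<F> \<and> \<F> \<subseteq> (\<lambda>k. mball k (q k / 2)) ` mcball x R \<and> mcball x R \<subseteq> \<Union> \<F>"
  proof -
    have "k \<in> mball k (q k / 2)" if "k \<in> mcball x R" for k using q[of k] that by auto
    then have "mcball x R \<subseteq> \<Union> ((\<lambda>k. mball k (q k / 2)) ` mcball x R)" by blast
    then show ?thesis using cR unfolding compactin_def by (smt (verit) imageE openin_mball)
  qed
  then obtain K where K: "finite K" "K \<subseteq> mcball x R" "mcball x R \<subseteq> (\<Union>k\<in>K. mball k (q k / 2))"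
    by (metis (no_types, lifting) finite_subset_image)
  have "x \<in> mcball x R" using x R by simp
  then have Kne: "K \<noteq> {}" using K by blast
  define \<delta> where "\<delta> = Min ((\<lambda>k. q k / 4) ` K)"
  have \<delta>: "0 < \<delta>" "\<And>k. k \<in> K \<Longrightarrow> \<delta> \<le> q k / 4"
  proof -
    have "0 < q k" if "k \<in> K" for k using K(2) q[of k] that by auto
    then show "0 < \<delta>" using K(1) Kne by (simp add: \<delta>_def)
    show "\<delta> \<le> q k / 4" if "k \<in> K" for k unfolding \<delta>_def by (rule Min_le) (use K(1) that in auto)
  qed
  have cover: "mcball x (R + \<delta>) \<subseteq> (\<Union>k\<in>K. mcball k (q k))"
  proof
    fix y assume y: "y \<in> mcball x (R + \<delta>)"
    then have "d x y < R + 2 * \<delta>" using \<delta> by auto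
    then obtain z where z: "z \<in> M" "d x z < R" "d z y < 2 * \<delta>"
      using len[of x y R "2 * \<delta>"] x y R \<delta> by auto
    then have "z \<in> mcball x R" using x by simp
    then obtain k where k: "k \<in> K" "z \<in> mball k (q k / 2)" using K by blast
    have "d k y \<le> d k z + d z y" using k z y by (intro triangle) auto
    then show "y \<in> (\<Union>k\<in>K. mcball k (q k))" using k z y \<delta>(2)[OF k(1)] by (intro UN_I[of k]) auto
  qed
  have "compactin mtopology (\<Union>k\<in>K. mcball k (q k))"
    by (rule compactin_Union) (use K q in auto)
  then have "compactin mtopology (mcball x (R + \<delta>))"
    by (rule closed_compactin[OF _ cover]) simp
  then have "R + \<delta> \<in> G" using R \<delta> by (simp add: G_def)
  then have "R + \<delta> \<le> R" unfolding R_def by (rule cSup_upper[OF _ bdd])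
  then show False using \<delta> by simp
qed

locale complete_riem_surface = riem_surface +
  assumes complete: "Metric_space.mcomplete UNIV (riem_dist A g)"
    and conn: "connected (UNIV :: 'a set)"
begin

lemma idist_UNIV_finite: "idist UNIV x y < \<infinity>"
proof -
  let ?S = "{y. idist UNIV x y < \<infinity>}"
  have loc: "\<exists>W. open W \<and> y \<in> W \<and> (\<forall>z\<in>W. idist UNIV x z < \<infinity> \<longleftrightarrow> idist UNIV x y < \<infinity>)" for y
  proof -
    obtain W where W: "open W" "y \<in> W" "\<And>a b. a \<in> W \<Longrightarrow> b \<in> W \<Longrightarrow> idist UNIV a b < ereal 1"
      by (rule idist_local_small[of UNIV y 1]) auto
    have "idist UNIV x b < \<infinity>" if "a \<in> W" "b \<in> W" "idist UNIV x a < \<infinity>" for a b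
    proof -
      have "idist UNIV x b \<le> idist UNIV x a + idist UNIV a b" by (rule idist_triangle)
      also have "\<dots> < \<infinity>" using W(3)[OF that(1,2)] that(3) by auto
      finally show ?thesis .
    qed
    then show ?thesis using W by blast
  qed
  have "open ?S"
  proof (subst open_subopen, intro ballI)
    fix y assume "y \<in> ?S"
    with loc[of y] show "\<exists>T. open T \<and> y \<in> T \<and> T \<subseteq> ?S" by auto
  qed
  moreover have "open (- ?S)"
  proof (subst open_subopen, intro ballI)
    fix y assume "y \<in> - ?S"
    with loc[of y] show "\<exists>T. open T \<and> y \<in> T \<and> T \<subseteq> - ?S" by auto
  qed
  moreover have "x \<in> ?S" using idist_self[of UNIV x] by simp
  ultimately have "- ?S = {}" using connectedD[OF conn, of ?S "- ?S"] by auto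
  then show ?thesis by blast
qed

lemma idist_UNIV: "idist UNIV x y = ereal (riem_dist A g x y)"
  unfolding riem_dist_def using idist_UNIV_finite[of x y] idist_nonneg[of UNIV x y]
  by (cases "idist UNIV x y") auto

sublocale R: Metric_space UNIV "riem_dist A g"
proof
  show "0 \<le> riem_dist A g x y" for x y using idist_nonneg[of UNIV x y] by (simp add: idist_UNIV)
  show "riem_dist A g x y = riem_dist A g y x" for x y using idist_commute[of UNIV x y] by (simp add: idist_UNIV)
  show "riem_dist A g x z \<le> riem_dist A g x y + riem_dist A g y z" for x y z
    using idist_triangle[of UNIV x z y] by (simp add: idist_UNIV)
  show "riem_dist A g x y = 0 \<longleftrightarrow> x = y" for x y
  proof
    assume z: "riem_dist A g x y = 0"
    show "x = y"
    proof (rule ccontr)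
      assume "x \<noteq> y"
      then obtain U where U: "open U" "x \<in> U" "y \<notin> U" using hausdorff by blast
      obtain W V e where "x \<in> W" "- U \<subseteq> V" "0 < e"
        "\<And>x' y S. x' \<in> W \<Longrightarrow> y \<in> V \<Longrightarrow> ereal e \<le> idist S x' y"
        by (rule idist_separated[OF U(1,2)]) blast
      then have "ereal e \<le> idist UNIV x y" using U by blast
      then show False using z \<open>0 < e\<close> by (simp add: idist_UNIV)
    qed
  next
    assume "x = y"
    then show "riem_dist A g x y = 0" using idist_self[of UNIV y] by (simp add: idist_UNIV)
  qed
qed

lemma mtopology_eq: "R.mtopology = euclidean"
proof -
  have "openin R.mtopology U \<longleftrightarrow> open U" for U
  proof
    assume o: "openin R.mtopology U"
    show "open U"
    proof (subst open_subopen, intro ballI)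
      fix x assume "x \<in> U"
      then obtain r where r: "0 < r" "R.mball x r \<subseteq> U" using o R.openin_mtopology by blast
      obtain W where W: "open W" "x \<in> W" "\<And>a b. a \<in> W \<Longrightarrow> b \<in> W \<Longrightarrow> idist UNIV a b < ereal r"
        by (rule idist_local_small[of UNIV x r]) (use r in auto)
      then have "W \<subseteq> R.mball x r" by (auto simp: idist_UNIV)
      then show "\<exists>T. open T \<and> x \<in> T \<and> T \<subseteq> U" using W r by blast
    qed
  next
    assume U: "open U"
    show "openin R.mtopology U" unfolding R.openin_mtopology
    proof (intro conjI allI impI)
      fix x assume "x \<in> U"
      then obtain W V e where W: "x \<in> W" "- U \<subseteq> V" "0 < e"
        "\<And>x' y S. x' \<in> W \<Longrightarrow> y \<in> V \<Longrightarrow> ereal e \<le> idist S x' y"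
        by (rule idist_separated[OF U]) blast
      have "R.mball x e \<subseteq> U"
      proof
        fix y assume "y \<in> R.mball x e"
        then have "\<not> ereal e \<le> idist UNIV x y" by (simp add: idist_UNIV)
        then show "y \<in> U" using W by blast
      qed
      then show "\<exists>r>0. R.mball x r \<subseteq> U" using W by blast
    qed simp
  qed
  then show ?thesis by (simp add: topology_eq open_openin[symmetric])
qed

lemma compact_riem_ball: "compact (R.mcball x r)"
proof -
  have "compactin R.mtopology (R.mcball x r)"
  proof (rule R.compactin_mcball[OF complete])
    fix x :: 'a
    obtain c Rd m C where c: "c \<in> A" "x \<in> fst c" "0 < Rd" "cball (snd c x) Rd \<subseteq> snd c ` (fst c \<inter> UNIV)"
      by (rule chart_constants[of UNIV x]) auto
    let ?K = "cinv c ` cball (snd c x) Rd"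
    let ?W = "{q \<in> fst c. snd c q \<in> ball (snd c x) Rd}"
    have K: "compact ?K"
      by (intro compact_continuous_image compact_cball continuous_on_subset[OF cont_cinv[OF c(1)]]) (use c in auto)
    have "?W \<subseteq> ?K"
    proof
      fix q assume "q \<in> ?W"
      then have "q = cinv c (snd c q)" "snd c q \<in> cball (snd c x) Rd" using c(1) by auto
      then show "q \<in> ?K" by blast
    qed
    moreover have "openin R.mtopology ?W"
      unfolding mtopology_eq using chart_preimage_open[OF c(1) open_ball] by (simp add: open_openin[symmetric])
    moreover have "x \<in> ?W" using c by auto
    ultimately obtain s where s: "0 < s" "R.mcball x s \<subseteq> ?K"
      unfolding R.openin_mtopology_mcball by blast
    have "compactin R.mtopology ?K" using K by (simp add: mtopology_eq)
    then have "compactin R.mtopology (R.mcball x s)" by (rule closed_compactin[OF _ s(2)]) simp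
    then show "\<exists>r>0. compactin R.mtopology (R.mcball x r)" using s by blast
  next
    fix x y :: 'a and a b :: real assume ab: "0 < a" "0 < b" "riem_dist A g x y < a + b"
    define L where "L = (riem_dist A g x y + (a + b)) / 2"
    have L: "riem_dist A g x y < L" "L < a + b" using ab by (auto simp: L_def)
    define t where "t = a / (a + b)"
    have t: "0 < t" "t < 1" "t * (a + b) = a" using ab by (auto simp: t_def field_simps)
    have lt: "t * L < a" "(1 - t) * L < b"
    proof -
      have "t * L < t * (a + b)" using L t by (intro mult_strict_left_mono) auto
      then show "t * L < a" using t by simp
      have "(1 - t) * L < (1 - t) * (a + b)" using L t by (intro mult_strict_left_mono) auto
      then show "(1 - t) * L < b" using t by (simp add: algebra_simps)
    qed
    have "idist UNIV x y < ereal L" using L by (simp add: idist_UNIV)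
    then obtain w where w: "w 0 = x" "w 1 = y"
      "\<And>s t. 0 \<le> s \<Longrightarrow> s \<le> t \<Longrightarrow> t \<le> 1 \<Longrightarrow> idist UNIV (w s) (w t) \<le> ereal ((t - s) * L)"
      by (rule proportional_curve[OF open_UNIV]) auto
    have "riem_dist A g x (w t) \<le> t * L" "riem_dist A g (w t) y \<le> (1 - t) * L"
      using w(3)[of 0 t] w(3)[of t 1] w(1,2) t by (auto simp: idist_UNIV)
    then show "\<exists>z\<in>UNIV. riem_dist A g x z < a \<and> riem_dist A g z y < b"
      using lt by (intro bexI[of _ "w t"]) auto
  qed simp
  then show ?thesis by (simp add: mtopology_eq)
qed

section \<open>Existence and concatenation of shortest paths\<close>

text \<open>
Almost shortest curves \<open>f n\<close> of the interior are elements of a power of a compact set, so that they have a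
cluster point \<open>\<Gamma>\<close> in the product topology. The inequalities for pairs of parameters pass to \<open>\<Gamma>\<close> by
lower semicontinuity, one pair at a time.
\<close>

lemma lipschitz_limit_curve:
  fixes Y :: "'a set"
  assumes Y: "C0_submanifold Y" "closed Y" and l: "rho A g Y x y = ereal l"
  obtains \<Gamma> where "\<Gamma> 0 = x" "\<Gamma> 1 = y" "\<And>t. t \<in> {0..1} \<Longrightarrow> \<Gamma> t \<in> Y"
    "\<And>s t. 0 \<le> s \<Longrightarrow> s \<le> t \<Longrightarrow> t \<le> 1 \<Longrightarrow> rho A g Y (\<Gamma> s) (\<Gamma> t) \<le> ereal ((t - s) * l)"
proof -
  let ?I = "interior Y"
  \<comment> \<open>The starting points of the curves are kept in \<open>X\<close>, so that all curves lie in one ball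
     around \<open>x\<close>.\<close>
  obtain X where X: "open X" "x \<in> X" "\<And>a b. a \<in> X \<Longrightarrow> b \<in> X \<Longrightarrow> idist UNIV a b < ereal 1"
    by (rule idist_local_small[of UNIV x 1]) auto
  obtain Ux where Ux: "\<And>i. open (Ux i)" "\<And>i. x \<in> Ux i" "\<And>S. open S \<Longrightarrow> x \<in> S \<Longrightarrow> eventually (\<lambda>i::nat. Ux i \<subseteq> S) sequentially"
    by (rule countable_basis_at_decseq[of x]) blast
  obtain Uy where Uy: "\<And>i. open (Uy i)" "\<And>i. y \<in> Uy i" "\<And>S. open S \<Longrightarrow> y \<in> S \<Longrightarrow> eventually (\<lambda>i::nat. Uy i \<subseteq> S) sequentially"
    by (rule countable_basis_at_decseq[of y]) blast
  have "\<exists>w. w 0 \<in> Ux n \<inter> X \<and> w 1 \<in> Uy n \<and> (\<forall>t\<in>{0..1}. w t \<in> ?I) \<and>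
      (\<forall>s t. 0 \<le> s \<longrightarrow> s \<le> t \<longrightarrow> t \<le> 1 \<longrightarrow> idist ?I (w s) (w t) \<le> ereal ((t - s) * (l + inverse (real (Suc n)))))" for n
  proof -
    have "rho A g Y x y < ereal (l + inverse (real (Suc n)))" using l by simp
    then obtain x' y' where xy: "x' \<in> Ux n \<inter> X" "x' \<in> ?I" "y' \<in> Uy n" "y' \<in> ?I"
      "idist ?I x' y' < ereal (l + inverse (real (Suc n)))"
      by (rule rho_lessD[OF Y(1), of _ _ _ "Ux n \<inter> X" "Uy n"]) (use Ux Uy X in auto)
    obtain w where w: "w 0 = x'" "w 1 = y'" "\<And>t. t \<in> {0..1} \<Longrightarrow> w t \<in> ?I"
      "\<And>s t. 0 \<le> s \<Longrightarrow> s \<le> t \<Longrightarrow> t \<le> 1 \<Longrightarrow> idist ?I (w s) (w t) \<le> ereal ((t - s) * (l + inverse (real (Suc n))))"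
      by (rule proportional_curve[OF open_interior xy(5,2,4)]) blast
    show ?thesis
      by (intro exI[of _ w] conjI allI impI ballI w(3,4)) (use xy w(1,2) in simp_all)
  qed
  from choice[OF allI[OF this]]
  obtain w where w0: "\<forall>n. w n 0 \<in> Ux n \<inter> X \<and> w n 1 \<in> Uy n \<and> (\<forall>t\<in>{0..1}. w n t \<in> ?I) \<and>
      (\<forall>s t. 0 \<le> s \<longrightarrow> s \<le> t \<longrightarrow> t \<le> 1 \<longrightarrow> idist ?I (w n s) (w n t) \<le> ereal ((t - s) * (l + inverse (real (Suc n)))))" ..
  have w: "\<And>n. w n 0 \<in> Ux n \<inter> X" "\<And>n. w n 1 \<in> Uy n" "\<And>n t. t \<in> {0..1} \<Longrightarrow> w n t \<in> ?I"
    "\<And>n s t. 0 \<le> s \<Longrightarrow> s \<le> t \<Longrightarrow> t \<le> 1 \<Longrightarrow> idist ?I (w n s) (w n t) \<le> ereal ((t - s) * (l + inverse (real (Suc n))))"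
    using w0 by simp_all
  have l0: "0 \<le> l" using rho_nonneg[of Y x y] l by simp
  define f where "f n t = w n (max 0 (min 1 t))" for n and t :: real
  have f: "f n t = w n t" if "t \<in> {0..1}" for n t using that by (simp add: f_def)
  define K where "K = R.mcball x (l + 2)"
  have fK: "f n t \<in> K" for n t
  proof -
    let ?u = "max 0 (min 1 t)"
    have "idist UNIV x (w n ?u) \<le> idist UNIV x (w n 0) + idist UNIV (w n 0) (w n ?u)" by (rule idist_triangle)
    also have "\<dots> \<le> ereal 1 + ereal (?u * (l + inverse (real (Suc n))))"
    proof (rule add_mono)
      show "idist UNIV x (w n 0) \<le> ereal 1" using X(3)[OF X(2)] w(1)[of n] by (auto intro: less_imp_le)
      have "idist UNIV (w n 0) (w n ?u) \<le> idist ?I (w n 0) (w n ?u)" by (rule idist_mono) simp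
      also have "\<dots> \<le> ereal ((?u - 0) * (l + inverse (real (Suc n))))" by (rule w(4)) auto
      finally show "idist UNIV (w n 0) (w n ?u) \<le> ereal (?u * (l + inverse (real (Suc n))))" by simp
    qed
    also have "\<dots> \<le> ereal (l + 2)"
    proof -
      have "inverse (real (Suc n)) \<le> 1" by (simp add: inverse_le_1_iff)
      moreover have "?u * (l + inverse (real (Suc n))) \<le> 1 * (l + inverse (real (Suc n)))"
        using l0 by (intro mult_right_mono) auto
      ultimately show ?thesis by simp
    qed
    finally show ?thesis by (simp add: K_def f_def idist_UNIV)
  qed
  have "compact K" unfolding K_def by (rule compact_riem_ball)
  then have "compactin (product_topology (\<lambda>_::real. euclidean) UNIV) (PiE UNIV (\<lambda>_. K))"
    by (simp add: compactin_PiE)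
  then have compK: "compact (PiE UNIV (\<lambda>_::real. K))" by (simp add: euclidean_product_topology)
  have "filtermap f sequentially \<noteq> bot" by (simp add: filtermap_bot_iff)
  moreover have "eventually (\<lambda>h. h \<in> PiE UNIV (\<lambda>_::real. K)) (filtermap f sequentially)"
    using fK by (simp add: eventually_filtermap PiE_UNIV_domain)
  ultimately obtain \<Gamma> where \<Gamma>: "inf (nhds \<Gamma>) (filtermap f sequentially) \<noteq> bot"
    using compK unfolding compact_filter by blast
  have cluster: "\<exists>n. f n \<in> S \<and> P n" if "open S" "\<Gamma> \<in> S" "eventually P sequentially" for S P
  proof (rule ccontr)
    assume "\<not> ?thesis"
    then have n: "\<And>n. f n \<in> S \<Longrightarrow> \<not> P n" by blast
    have "eventually (\<lambda>h. h \<in> S) (nhds \<Gamma>)" using that eventually_nhds by blast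
    moreover have "eventually (\<lambda>h. h \<notin> S) (filtermap f sequentially)"
      unfolding eventually_filtermap using that(3) by eventually_elim (use n in blast)
    ultimately have "eventually (\<lambda>_. False) (inf (nhds \<Gamma>) (filtermap f sequentially))"
      unfolding eventually_inf by blast
    then show False using \<Gamma> by (simp add: trivial_limit_def)
  qed
  have coord: "open {h. h t \<in> U}" if "open U" for t :: real and U :: "'a set"
  proof -
    have "continuous_on UNIV (\<lambda>h::real \<Rightarrow> 'a. h t)" by (rule continuous_on_product_coordinates)
    from open_vimage[OF that this] show ?thesis by (simp add: vimage_def)
  qed
  show ?thesis
  proof (rule that[of \<Gamma>])
    show "\<Gamma> 0 = x"
    proof (rule ccontr)
      assume ne: "\<Gamma> 0 \<noteq> x"
      obtain U V where UV: "open U" "open V" "\<Gamma> 0 \<in> U" "x \<in> V" "U \<inter> V = {}" using hausdorff[OF ne] by blast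
      have "\<Gamma> \<in> {h. h 0 \<in> U}" using UV(3) by simp
      from cluster[OF coord[OF UV(1)] this Ux(3)[OF UV(2,4)]]
      obtain n where "f n 0 \<in> U" "Ux n \<subseteq> V" by auto
      then show False using w(1)[of n] UV(5) f[of 0 n] by auto
    qed
    show "\<Gamma> 1 = y"
    proof (rule ccontr)
      assume ne: "\<Gamma> 1 \<noteq> y"
      obtain U V where UV: "open U" "open V" "\<Gamma> 1 \<in> U" "y \<in> V" "U \<inter> V = {}" using hausdorff[OF ne] by blast
      have "\<Gamma> \<in> {h. h 1 \<in> U}" using UV(3) by simp
      from cluster[OF coord[OF UV(1)] this Uy(3)[OF UV(2,4)]]
      obtain n where "f n 1 \<in> U" "Uy n \<subseteq> V" by auto
      then show False using w(2)[of n] UV(5) f[of 1 n] by auto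
    qed
    show "\<Gamma> t \<in> Y" if t: "t \<in> {0..1}" for t
    proof (rule ccontr)
      assume "\<Gamma> t \<notin> Y"
      then have o: "open (- Y)" "\<Gamma> t \<in> - Y" using Y by auto
      have "\<Gamma> \<in> {h. h t \<in> - Y}" using o(2) by simp
      from cluster[OF coord[OF o(1)] this always_eventually[of "\<lambda>_. True"]]
      obtain n where "f n t \<in> - Y" by auto
      then show False using w(3)[OF t, of n] f[OF t] interior_subset[of Y] by auto
    qed
    fix s t :: real assume st: "0 \<le> s" "s \<le> t" "t \<le> 1"
    have "rho A g Y (\<Gamma> s) (\<Gamma> t) \<le> ereal ((t - s) * l) + ereal e" if e: "0 < e" for e
    proof (rule rho_leI[OF Y(1)])
      fix U V assume UV: "open U" "\<Gamma> s \<in> U" "open V" "\<Gamma> t \<in> V"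
      have "eventually (\<lambda>n. inverse (real (Suc n)) < e) sequentially"
        using LIMSEQ_inverse_real_of_nat e by (rule order_tendstoD(2))
      moreover have "open ({h. h s \<in> U} \<inter> {h. h t \<in> V})" by (intro open_Int coord UV)
      moreover have "\<Gamma> \<in> {h. h s \<in> U} \<inter> {h. h t \<in> V}" using UV by simp
      ultimately have "\<exists>n. f n \<in> {h. h s \<in> U} \<inter> {h. h t \<in> V} \<and> inverse (real (Suc n)) < e"
        by (intro cluster)
      then obtain n where n: "f n s \<in> U" "f n t \<in> V" "inverse (real (Suc n)) < e" by auto
      have s01: "s \<in> {0..1}" "t \<in> {0..1}" using st by auto
      have "idist ?I (w n s) (w n t) \<le> ereal ((t - s) * (l + inverse (real (Suc n))))" using w(4) st by blast
      also have "(t - s) * (l + inverse (real (Suc n))) \<le> (t - s) * l + e"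
      proof -
        have "(t - s) * inverse (real (Suc n)) \<le> 1 * inverse (real (Suc n))"
          using st by (intro mult_right_mono) auto
        then show ?thesis unfolding distrib_left using n(3) by linarith
      qed
      finally have "idist ?I (w n s) (w n t) \<le> ereal ((t - s) * l) + ereal e" by simp
      then show "\<exists>x'\<in>U \<inter> ?I. \<exists>y'\<in>V \<inter> ?I. idist ?I x' y' \<le> ereal ((t - s) * l) + ereal e"
        using n w(3) f s01 by (intro bexI[of _ "w n s"] bexI[of _ "w n t"]) auto
    qed
    then show "rho A g Y (\<Gamma> s) (\<Gamma> t) \<le> ereal ((t - s) * l)" using ereal_le_epsilon2 by blast
  qed
qed

text \<open>
The triangle inequality, applied to the partition of \<open>\<Gamma>\<close> at \<open>s\<close> and \<open>t\<close>, excludes a strict inequality. Continuity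
holds because points outside a neighbourhood have a positive distance \<open>rho\<close> from its centre.
\<close>

lemma shortest_pathI:
  fixes Y :: "'a set"
  assumes Y: "C0_submanifold Y" and L: "rho A g Y x y = ereal L" "0 < L"
    and \<Gamma>: "\<Gamma> 0 = x" "\<Gamma> 1 = y" "\<And>t. t \<in> {0..1} \<Longrightarrow> \<Gamma> t \<in> Y"
    and lip: "\<And>s t. 0 \<le> s \<Longrightarrow> s \<le> t \<Longrightarrow> t \<le> 1 \<Longrightarrow> rho A g Y (\<Gamma> s) (\<Gamma> t) \<le> ereal ((t - s) * L)"
  shows "shortest_path A g Y x y \<Gamma>"
proof -
  have "continuous_on {0..1} \<Gamma>"
    unfolding continuous_on_topological
  proof (intro ballI allI impI)
    fix s U assume s: "s \<in> {0..1::real}" and U: "open U" "\<Gamma> s \<in> U"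
    obtain e where e: "0 < e" "\<And>z. z \<notin> U \<Longrightarrow> ereal e \<le> rho A g Y (\<Gamma> s) z \<and> ereal e \<le> rho A g Y z (\<Gamma> s)"
      by (rule rho_separated[OF Y U]) blast
    have "\<Gamma> t \<in> U" if t: "t \<in> {0..1}" "t \<in> ball s (e / L)" for t
    proof (rule ccontr)
      assume "\<Gamma> t \<notin> U"
      note e' = e(2)[OF this]
      have "\<bar>t - s\<bar> * L < e" using t L by (simp add: dist_real_def pos_less_divide_eq abs_minus_commute)
      moreover have "ereal e \<le> ereal (\<bar>t - s\<bar> * L)"
      proof (cases "s \<le> t")
        case True
        then have "rho A g Y (\<Gamma> s) (\<Gamma> t) \<le> ereal (\<bar>t - s\<bar> * L)" using lip[of s t] s t by simp
        with e' show ?thesis using order_trans by blast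
      next
        case False
        then have "rho A g Y (\<Gamma> t) (\<Gamma> s) \<le> ereal (\<bar>t - s\<bar> * L)" using lip[of t s] s t by simp
        with e' show ?thesis using order_trans by blast
      qed
      ultimately show False by simp
    qed
    then show "\<exists>B. open B \<and> s \<in> B \<and> (\<forall>t\<in>{0..1}. t \<in> B \<longrightarrow> \<Gamma> t \<in> U)"
      using e(1) L by (intro exI[of _ "ball s (e / L)"]) auto
  qed
  moreover have "rho A g Y (\<Gamma> s) (\<Gamma> t) = ereal (t - s) * rho A g Y x y" if st: "0 \<le> s" "s < t" "t \<le> 1" for s t
  proof -
    have le: "rho A g Y (\<Gamma> s) (\<Gamma> t) \<le> ereal ((t - s) * L)" using lip st by simp
    then obtain r where r: "rho A g Y (\<Gamma> s) (\<Gamma> t) = ereal r"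
      using rho_nonneg[of Y "\<Gamma> s" "\<Gamma> t"] by (cases "rho A g Y (\<Gamma> s) (\<Gamma> t)") auto
    have "rho A g Y x (\<Gamma> s) \<le> ereal (s * L)" using lip[of 0 s] \<Gamma>(1) st by simp
    moreover have "rho A g Y (\<Gamma> t) y \<le> ereal ((1 - t) * L)" using lip[of t 1] \<Gamma>(2) st by simp
    moreover have "\<Gamma> s \<in> Y" "\<Gamma> t \<in> Y" using \<Gamma>(3) st by auto
    ultimately have "rho A g Y x y \<le> ereal ((s * L + r) + (1 - t) * L)"
      using rho_triangle[OF Y] r by (metis order_refl)
    then have "(t - s) * L \<le> r" using L by (simp add: algebra_simps)
    then show ?thesis using le r L by (simp add: antisym)
  qed
  moreover have "x \<noteq> y"
  proof
    assume "x = y"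
    then have "rho A g Y x y = 0" using rho_self[OF Y, of x] L by simp
    then show False using L by simp
  qed
  ultimately show ?thesis
    using \<Gamma> unfolding shortest_path_def path_def pathstart_def pathfinish_def path_image_def by auto
qed

text \<open>
The parameter at which the concatenated curve passes \<open>z\<close> is \<open>\<tau> = p / (p + q)\<close>, which makes it
proportionally parametrized.
\<close>

lemma shortest_path_through:
  fixes Y :: "'a set"
  assumes Y: "C0_submanifold Y" "closed Y" and z: "z \<in> Y"
    and p: "rho A g Y x z = ereal p" "0 < p" and q: "rho A g Y z y = ereal q" "0 < q"
    and pq: "rho A g Y x y = ereal (p + q)"
  obtains \<Gamma> where "shortest_path A g Y x y \<Gamma>" "z \<in> \<Gamma> ` {0<..<1}"
proof -
  obtain \<Gamma>1 where 1: "\<Gamma>1 0 = x" "\<Gamma>1 1 = z" "\<And>t. t \<in> {0..1} \<Longrightarrow> \<Gamma>1 t \<in> Y"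
    "\<And>s t. 0 \<le> s \<Longrightarrow> s \<le> t \<Longrightarrow> t \<le> 1 \<Longrightarrow> rho A g Y (\<Gamma>1 s) (\<Gamma>1 t) \<le> ereal ((t - s) * p)"
    by (rule lipschitz_limit_curve[OF Y p(1)]) blast
  obtain \<Gamma>2 where 2: "\<Gamma>2 0 = z" "\<Gamma>2 1 = y" "\<And>t. t \<in> {0..1} \<Longrightarrow> \<Gamma>2 t \<in> Y"
    "\<And>s t. 0 \<le> s \<Longrightarrow> s \<le> t \<Longrightarrow> t \<le> 1 \<Longrightarrow> rho A g Y (\<Gamma>2 s) (\<Gamma>2 t) \<le> ereal ((t - s) * q)"
    by (rule lipschitz_limit_curve[OF Y q(1)]) blast
  define L where "L = p + q"
  define \<tau> where "\<tau> = p / L"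
  have L: "0 < L" using p q by (simp add: L_def)
  have \<tau>: "0 < \<tau>" "\<tau> < 1" "\<tau> * L = p" "(1 - \<tau>) * L = q"
    using p q L by (auto simp: \<tau>_def L_def field_simps)
  define \<Gamma> where "\<Gamma> t = (if t \<le> \<tau> then \<Gamma>1 (t / \<tau>) else \<Gamma>2 ((t - \<tau>) / (1 - \<tau>)))" for t
  have \<Gamma>\<tau>: "\<Gamma> \<tau> = z" using 1 \<tau> by (simp add: \<Gamma>_def)
  have b1: "rho A g Y (\<Gamma> s) (\<Gamma> t) \<le> ereal ((t - s) * L)" if "0 \<le> s" "s \<le> t" "t \<le> \<tau>" for s t
  proof -
    have "rho A g Y (\<Gamma>1 (s / \<tau>)) (\<Gamma>1 (t / \<tau>)) \<le> ereal ((t / \<tau> - s / \<tau>) * p)"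
      by (rule 1(4)) (use that \<tau> in \<open>auto simp: divide_right_mono\<close>)
    also have "(t / \<tau> - s / \<tau>) * p = (t - s) * L"
      using \<tau>(1) by (simp add: \<tau>(3)[symmetric] field_simps)
    finally show ?thesis using that by (simp add: \<Gamma>_def)
  qed
  have \<Gamma>2: "\<Gamma> t = \<Gamma>2 ((t - \<tau>) / (1 - \<tau>))" if "\<tau> \<le> t" for t
    using that \<Gamma>\<tau> 2(1) by (cases "t = \<tau>") (auto simp: \<Gamma>_def)
  have b2: "rho A g Y (\<Gamma> s) (\<Gamma> t) \<le> ereal ((t - s) * L)" if "\<tau> \<le> s" "s \<le> t" "t \<le> 1" for s t
  proof -
    have "rho A g Y (\<Gamma>2 ((s - \<tau>) / (1 - \<tau>))) (\<Gamma>2 ((t - \<tau>) / (1 - \<tau>)))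
       \<le> ereal (((t - \<tau>) / (1 - \<tau>) - (s - \<tau>) / (1 - \<tau>)) * q)"
      by (rule 2(4)) (use that \<tau> in \<open>auto simp: divide_right_mono\<close>)
    also have "((t - \<tau>) / (1 - \<tau>) - (s - \<tau>) / (1 - \<tau>)) * q = (t - s) * L"
      using \<tau>(2) by (simp add: \<tau>(4)[symmetric] flip: diff_divide_distrib)
    finally show ?thesis using that \<Gamma>2 by simp
  qed
  have "shortest_path A g Y x y \<Gamma>"
  proof (rule shortest_pathI[OF Y(1) pq[folded L_def] L])
    show "\<Gamma> 0 = x" using 1 \<tau> by (simp add: \<Gamma>_def)
    show "\<Gamma> 1 = y" using 2 \<tau> by (simp add: \<Gamma>_def)
    show "\<Gamma> t \<in> Y" if "t \<in> {0..1}" for t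
      using that \<tau> 1(3)[of "t / \<tau>"] 2(3)[of "(t - \<tau>) / (1 - \<tau>)"] by (auto simp: \<Gamma>_def)
    fix s t :: real assume st: "0 \<le> s" "s \<le> t" "t \<le> 1"
    consider "t \<le> \<tau>" | "\<tau> \<le> s" | "s < \<tau>" "\<tau> < t" by linarith
    then show "rho A g Y (\<Gamma> s) (\<Gamma> t) \<le> ereal ((t - s) * L)"
    proof cases
      case 3
      have "rho A g Y (\<Gamma> s) (\<Gamma> t) \<le> ereal ((\<tau> - s) * L + (t - \<tau>) * L)"
        by (rule rho_triangle[OF Y(1) z]) (use b1[of s \<tau>] b2[of \<tau> t] 3 st \<Gamma>\<tau> in auto)
      then show ?thesis by (simp flip: distrib_right)
    qed (use b1 b2 st in auto)
  qed
  moreover have "z \<in> \<Gamma> ` {0<..<1}" using \<Gamma>\<tau> \<tau> by (intro image_eqI[of _ _ \<tau>]) auto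
  ultimately show ?thesis using that by blast
qed

lemma property_circ_strict_triangle:
  fixes Y :: "'a set"
  assumes Y: "C0_submanifold Y" "closed Y" "condition_i A g Y"
    and xyz: "x \<in> manifold_boundary Y" "y \<in> manifold_boundary Y" "z \<in> manifold_boundary Y"
    and c: "property_circ A g Y" and p: "0 < p" "0 < q"
    and rho: "rho A g Y x z = ereal p" "rho A g Y z y = ereal q"
  shows "rho A g Y x y \<noteq> ereal (p + q)"
proof
  assume "rho A g Y x y = ereal (p + q)"
  then obtain \<Gamma> where "shortest_path A g Y x y \<Gamma>" "z \<in> \<Gamma> ` {0<..<1}"
    using shortest_path_through[OF Y(1,2) _ rho(1) p(1) rho(2) p(2)] xyz(3) manifold_boundary_subset by blast
  then have "z \<in> manifold_interior Y" using c xyz unfolding property_circ_def by blast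
  then show False using xyz(3) by (simp add: manifold_interior_def)
qed

end

section \<open>Comparison of two submanifolds\<close>

theorem theorem3p8:
  fixes A :: "'a::{t2_space, second_countable_topology} chart set"
    and g :: "'a chart \<Rightarrow> 'a \<Rightarrow> real ^ 2 ^ 2"
    and Y1 Y2 :: "'a set"
  assumes "complete_riemannian_surface A g" and "connected (UNIV :: 'a set)"
    and "C0_submanifold Y1" and "closed Y1" and "connected Y1" and "manifold_boundary Y1 \<noteq> {}"
    and "condition_i A g Y1" and "property_circ A g Y1"
    and "C0_submanifold Y2" and "closed Y2" and "connected Y2" and "manifold_boundary Y2 \<noteq> {}"
    and "condition_i A g Y2"
    and "isometric_boundaries A g Y1 Y2"
  shows "property_circ A g Y2"
proof -
  interpret complete_riem_surface A g
    using assms(1,2) by unfold_locales (auto simp: complete_riemannian_surface_def)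
  obtain f where f: "f ` manifold_boundary Y1 = manifold_boundary Y2"
    "\<And>x y. x \<in> manifold_boundary Y1 \<Longrightarrow> y \<in> manifold_boundary Y1 \<Longrightarrow> rho A g Y2 (f x) (f y) = rho A g Y1 x y"
    using assms(14) unfolding isometric_boundaries_def by blast
  show ?thesis unfolding property_circ_def
  proof (intro ballI allI impI subsetI)
    fix x y \<gamma> z
    assume xy: "x \<in> manifold_boundary Y2" "y \<in> manifold_boundary Y2" and s: "shortest_path A g Y2 x y \<gamma>"
      and z: "z \<in> \<gamma> ` {0<..<1}"
    obtain t where t: "0 < t" "t < 1" "z = \<gamma> t" using z by auto
    have sp: "x \<noteq> y" "\<gamma> 0 = x" "\<gamma> 1 = y" "z \<in> Y2"
      "\<And>s t. 0 \<le> s \<and> s < t \<and> t \<le> 1 \<Longrightarrow> rho A g Y2 (\<gamma> s) (\<gamma> t) = ereal (t - s) * rho A g Y2 x y"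
      using s t unfolding shortest_path_def pathstart_def pathfinish_def path_image_def by auto
    have "rho A g Y2 x y < \<infinity>"
      using assms(13) xy manifold_boundary_subset unfolding condition_i_def by blast
    moreover have "0 < rho A g Y2 x y" by (rule rho_pos[OF assms(9) sp(1)])
    ultimately obtain L where L: "rho A g Y2 x y = ereal L" "0 < L" by (cases "rho A g Y2 x y") auto
    have r1: "rho A g Y2 x z = ereal (t * L)" using sp(5)[of 0 t] sp(2) t L by simp
    have r2: "rho A g Y2 z y = ereal ((1 - t) * L)" using sp(5)[of t 1] sp(3) t L by simp
    show "z \<in> manifold_interior Y2"
    proof (rule ccontr)
      assume "z \<notin> manifold_interior Y2"
      then have z2: "z \<in> manifold_boundary Y2" using sp(4) by (simp add: manifold_interior_def)
      obtain x' where x': "x' \<in> manifold_boundary Y1" "f x' = x"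
        using xy(1) unfolding f(1)[symmetric] by blast
      obtain y' where y': "y' \<in> manifold_boundary Y1" "f y' = y"
        using xy(2) unfolding f(1)[symmetric] by blast
      obtain z' where z': "z' \<in> manifold_boundary Y1" "f z' = z"
        using z2 unfolding f(1)[symmetric] by blast
      have "rho A g Y1 x' z' = ereal (t * L)" "rho A g Y1 z' y' = ereal ((1 - t) * L)"
        "rho A g Y1 x' y' = ereal (t * L + (1 - t) * L)"
        using f(2) x' y' z' r1 r2 L by (auto simp: algebra_simps)
      moreover have "0 < t * L" "0 < (1 - t) * L" using t L by auto
      ultimately show False
        using property_circ_strict_triangle[OF assms(3,4,7) x'(1) y'(1) z'(1) assms(8)] by blast
    qed
  qed
qed

end
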